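(* Suppose that $\mathsf p=1/|H|$ is such that Bernoulli site percolation on $X(G,S)$ with parameter $\mathsf p$ satisfies $\theta(\mathsf p)=0$, that is, $$\mathsf{Pr}_{\mathsf p}[C(e)\text{ is finite}]=\sum_{A\in\mathcal C}\mathsf{Pr}_{\mathsf p}[C(e)=A]=1.$$ Then $\operatorname{spec}(R_{\widetilde\mu})$ is pure point, and it is the closure of $$\Lambda=\bigcup\bigl\{\operatorname{spec}(P_A): A\in\mathcal C,\ A\neq\emptyset\bigr\}\cup\{0\}.$$ There is a complete orthonormal system in $\ell^2(H\wr G)$ consisting of finitely supported eigenfunctions of $R_{\widetilde\mu}$ associated with the eigenvalues in $\Lambda$.
   Context: $G$ is a finitely generated group with identity $e$; $H$ is a finite group with identity $o$ and $|H|\ge 2$. Let $\mathcal{L}=\bigoplus_G H$ be the group (under pointwise multiplication) of functions $\eta:G\to H$ with finite support $\{x:\eta(x)\ne o\}$; its identity is $\iota\equiv o$. $G$ acts on $\mathcal L$ by $L_g\eta(x)=\eta(g^{-1}x)$. The lamplighter group is $H\wr G=\mathcal{L}\rtimes G$ with $(\eta,g)(\eta',g')=(\eta\cdot L_g\eta',gg')$. $G$ and $H$ embed into $H\wr G$ via $g\mapsto(\iota,g)$ and $h\mapsto(\eta_e^h,e)$, where $\eta_e^h(e)=h$ and $\eta_e^h(x)=o$ for $x\neq e$; measures on $G$ and $H$ are regarded as measures on $H\wr G$ via these embeddings. $\mu$ is a symmetric probability measure on $G$ whose support $S$ is finite and generates $G$; $p(x,y)=\mu(x^{-1}y)$. The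 Cayley graph $X(G,S)$ has vertex set $G$ and unoriented edges $[x,xs]$, $x\in G$, $s\in S$. $\nu$ is the uniform distribution on $H$, $\widetilde\mu=\nu*\mu*\nu$ on $H\wr G$, and $R_{\widetilde\mu}F=F*\widetilde\mu$ on $\ell^2(H\wr G)$ (a bounded self-adjoint operator). The spectrum of a self-adjoint operator is called pure point if the Hilbert space has a complete orthonormal system of eigenvectors. $\mathcal C$ is the collection of all finite sets $A\subset G$ with $e\in A$ whose induced subgraph in $X(G,S)$ is connected, together with $A=\emptyset$. For $A\in\mathcal C$, $P_A$ is the matrix (operator) with entries $p_A(x,y)=p(x,y)$ if $x,y\in A$ and $0$ otherwise, and $\operatorname{spec}(P_A)$ is its spectrum. Site percolation with parameter $\mathsf{p}$: each vertex of $X(G,S)$ is independently open with probability $\mathsf{p}$ and closed with probability $1-\mathsf{p}$ (under $\mathsf{Pr}_{\mathsf p}$). If $e$ is open, $C(e)$ is the set of open vertices connected to $e$ by a path of open vertices; if $e$ is closed, $C(e)=\emptyset$. $\theta(\mathsf p)=\mathsf{Pr}_{\mathsf p}[C(e)\text{ is infinite}]$. *)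

theory Defs
  imports "HOL-Probability.Probability" "HOL-Algebra.Product_Groups"
begin

section \<open>The Hilbert space of square summable functions\<close>

text \<open>
  Complex functions on a set \<open>X\<close>, extended by \<open>0\<close> outside \<open>X\<close> so that extensional
  equality of functions is equality on \<open>X\<close>.
\<close>

definition ell2 :: "'x set \<Rightarrow> ('x \<Rightarrow> complex) set" where
  "ell2 X = {f. (\<forall>x. x \<notin> X \<longrightarrow> f x = 0) \<and> (\<lambda>x. (cmod (f x))\<^sup>2) summable_on X}"

definition ell2_inner :: "'x set \<Rightarrow> ('x \<Rightarrow> complex) \<Rightarrow> ('x \<Rightarrow> complex) \<Rightarrow> complex" where
  "ell2_inner X f g = (\<Sum>\<^sub>\<infinity>x\<in>X. f x * cnj (g x))"

definition ell2_norm :: "'x set \<Rightarrow> ('x \<Rightarrow> complex) \<Rightarrow> real" where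
  "ell2_norm X f = sqrt (\<Sum>\<^sub>\<infinity>x\<in>X. (cmod (f x))\<^sup>2)"

definition bounded_operator ::
    "'x set \<Rightarrow> (('x \<Rightarrow> complex) \<Rightarrow> ('x \<Rightarrow> complex)) \<Rightarrow> bool" where
  "bounded_operator X T \<longleftrightarrow>
     (\<forall>f\<in>ell2 X. T f \<in> ell2 X) \<and>
     (\<forall>f\<in>ell2 X. \<forall>g\<in>ell2 X. T (\<lambda>x. f x + g x) = (\<lambda>x. T f x + T g x)) \<and>
     (\<forall>f\<in>ell2 X. \<forall>c. T (\<lambda>x. c * f x) = (\<lambda>x. c * T f x)) \<and>
     (\<exists>K. \<forall>f\<in>ell2 X. ell2_norm X (T f) \<le> K * ell2_norm X f)"

text \<open>
  The complex numbers \<open>c\<close> for which \<open>T - c I\<close> has no bounded two-sided inverse.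
\<close>

definition op_spectrum ::
    "'x set \<Rightarrow> (('x \<Rightarrow> complex) \<Rightarrow> ('x \<Rightarrow> complex)) \<Rightarrow> complex set" where
  "op_spectrum X T =
     {c. \<not> (\<exists>B. bounded_operator X B \<and>
            (\<forall>f\<in>ell2 X. B (\<lambda>x. T f x - c * f x) = f \<and>
                        (\<lambda>x. T (B f) x - c * B f x) = f))}"

definition eigenfunction ::
    "'x set \<Rightarrow> (('x \<Rightarrow> complex) \<Rightarrow> ('x \<Rightarrow> complex)) \<Rightarrow> complex \<Rightarrow> ('x \<Rightarrow> complex) \<Rightarrow> bool" where
  "eigenfunction X T c f \<longleftrightarrow>
     f \<in> ell2 X \<and> f \<noteq> (\<lambda>x. 0) \<and> T f = (\<lambda>x. c * f x)"

definition complete_orthonormal :: "'x set \<Rightarrow> ('x \<Rightarrow> complex) set \<Rightarrow> bool" where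
  "complete_orthonormal X U \<longleftrightarrow>
     U \<subseteq> ell2 X \<and>
     (\<forall>u\<in>U. \<forall>v\<in>U. ell2_inner X u v = (if u = v then 1 else 0)) \<and>
     (\<forall>f\<in>ell2 X. (\<forall>u\<in>U. ell2_inner X f u = 0) \<longrightarrow> f = (\<lambda>x. 0))"

definition pure_point_spectrum ::
    "'x set \<Rightarrow> (('x \<Rightarrow> complex) \<Rightarrow> ('x \<Rightarrow> complex)) \<Rightarrow> bool" where
  "pure_point_spectrum X T \<longleftrightarrow>
     (\<exists>U. complete_orthonormal X U \<and> (\<forall>u\<in>U. \<exists>c. eigenfunction X T c u))"


section \<open>Lamplighter groups\<close>

text \<open>
  The library's \<^const>\<open>sum_group\<close> has as carrier the finitely supported functions in
  \<open>carrier G \<rightarrow>\<^sub>E carrier H\<close>, with pointwise multiplication.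
\<close>

definition lamp_configs ::
    "('h, 'n) monoid_scheme \<Rightarrow> ('g, 'm) monoid_scheme \<Rightarrow> ('g \<Rightarrow> 'h) monoid" where
  "lamp_configs H G = sum_group (carrier G) (\<lambda>_. H)"

definition translate ::
    "('g, 'm) monoid_scheme \<Rightarrow> 'g \<Rightarrow> ('g \<Rightarrow> 'h) \<Rightarrow> ('g \<Rightarrow> 'h)" where
  "translate G g \<eta> = (\<lambda>x\<in>carrier G. \<eta> (inv\<^bsub>G\<^esub> g \<otimes>\<^bsub>G\<^esub> x))"

definition lamplighter ::
    "('h, 'n) monoid_scheme \<Rightarrow> ('g, 'm) monoid_scheme \<Rightarrow> (('g \<Rightarrow> 'h) \<times> 'g) monoid" where
  "lamplighter H G =
     \<lparr>carrier = carrier (lamp_configs H G) \<times> carrier G,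
      monoid.mult = (\<lambda>(\<eta>, g) (\<eta>', g').
        (\<eta> \<otimes>\<^bsub>lamp_configs H G\<^esub> translate G g \<eta>', g \<otimes>\<^bsub>G\<^esub> g')),
      one = (\<one>\<^bsub>lamp_configs H G\<^esub>, \<one>\<^bsub>G\<^esub>)\<rparr>"

definition embed_base ::
    "('h, 'n) monoid_scheme \<Rightarrow> ('g, 'm) monoid_scheme \<Rightarrow> 'g \<Rightarrow> ('g \<Rightarrow> 'h) \<times> 'g" where
  "embed_base H G g = (\<one>\<^bsub>lamp_configs H G\<^esub>, g)"

definition embed_lamp ::
    "('h, 'n) monoid_scheme \<Rightarrow> ('g, 'm) monoid_scheme \<Rightarrow> 'h \<Rightarrow> ('g \<Rightarrow> 'h) \<times> 'g" where
  "embed_lamp H G h =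
     ((\<lambda>x\<in>carrier G. if x = \<one>\<^bsub>G\<^esub> then h else \<one>\<^bsub>H\<^esub>), \<one>\<^bsub>G\<^esub>)"


section \<open>Convolution and the switch-walk-switch operator\<close>

definition conv_pmf :: "('k, 'm) monoid_scheme \<Rightarrow> 'k pmf \<Rightarrow> 'k pmf \<Rightarrow> 'k pmf" where
  "conv_pmf K a b = map_pmf (\<lambda>(x, y). x \<otimes>\<^bsub>K\<^esub> y) (pair_pmf a b)"

definition right_conv_op ::
    "('k, 'm) monoid_scheme \<Rightarrow> 'k pmf \<Rightarrow> ('k \<Rightarrow> complex) \<Rightarrow> ('k \<Rightarrow> complex)" where
  "right_conv_op K \<kappa> F =
     (\<lambda>x. if x \<in> carrier K
          then \<Sum>\<^sub>\<infinity>y\<in>carrier K. F y * of_real (pmf \<kappa> (inv\<^bsub>K\<^esub> y \<otimes>\<^bsub>K\<^esub> x)) else 0)"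

definition sws_measure ::
    "('h, 'n) monoid_scheme \<Rightarrow> ('g, 'm) monoid_scheme \<Rightarrow> 'g pmf \<Rightarrow> (('g \<Rightarrow> 'h) \<times> 'g) pmf" where
  "sws_measure H G \<mu> =
     (let K = lamplighter H G;
          \<nu> = map_pmf (embed_lamp H G) (pmf_of_set (carrier H))
      in conv_pmf K (conv_pmf K \<nu> (map_pmf (embed_base H G) \<mu>)) \<nu>)"

definition sws_operator ::
    "('h, 'n) monoid_scheme \<Rightarrow> ('g, 'm) monoid_scheme \<Rightarrow> 'g pmf \<Rightarrow>
     (('g \<Rightarrow> 'h) \<times> 'g \<Rightarrow> complex) \<Rightarrow> (('g \<Rightarrow> 'h) \<times> 'g \<Rightarrow> complex)" where
  "sws_operator H G \<mu> = right_conv_op (lamplighter H G) (sws_measure H G \<mu>)"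


section \<open>Cayley graphs and finite clusters\<close>

definition cayley_edges :: "('g, 'm) monoid_scheme \<Rightarrow> 'g set \<Rightarrow> 'g set set" where
  "cayley_edges G S = {{x, x \<otimes>\<^bsub>G\<^esub> s} | x s. x \<in> carrier G \<and> s \<in> S}"

text \<open>Joined by a path all of whose vertices, endpoints included, lie in \<open>A\<close>.\<close>

definition joined_in :: "'v set set \<Rightarrow> 'v set \<Rightarrow> 'v \<Rightarrow> 'v \<Rightarrow> bool" where
  "joined_in E A x y \<longleftrightarrow>
     x \<in> A \<and> y \<in> A \<and> (\<lambda>u v. u \<in> A \<and> v \<in> A \<and> {u, v} \<in> E)\<^sup>*\<^sup>* x y"

definition cluster_shapes :: "('g, 'm) monoid_scheme \<Rightarrow> 'g set \<Rightarrow> 'g set set" where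
  "cluster_shapes G S =
     {A. finite A \<and> A \<subseteq> carrier G \<and> \<one>\<^bsub>G\<^esub> \<in> A \<and>
         (\<forall>x\<in>A. \<forall>y\<in>A. joined_in (cayley_edges G S) A x y)} \<union> {{}}"

definition transition :: "('g, 'm) monoid_scheme \<Rightarrow> 'g pmf \<Rightarrow> 'g \<Rightarrow> 'g \<Rightarrow> real" where
  "transition G \<mu> x y = pmf \<mu> (inv\<^bsub>G\<^esub> x \<otimes>\<^bsub>G\<^esub> y)"

text \<open>
  The matrix is indexed by all of \<open>carrier G\<close>, with entries \<open>0\<close> outside \<open>A \<times> A\<close>; it acts on
  \<open>ell2 (carrier G)\<close>.
\<close>

definition truncated_transition ::
    "('g, 'm) monoid_scheme \<Rightarrow> 'g pmf \<Rightarrow> 'g set \<Rightarrow> 'g \<Rightarrow> 'g \<Rightarrow> real" where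
  "truncated_transition G \<mu> A x y = (if x \<in> A \<and> y \<in> A then transition G \<mu> x y else 0)"

definition truncated_operator ::
    "('g, 'm) monoid_scheme \<Rightarrow> 'g pmf \<Rightarrow> 'g set \<Rightarrow> ('g \<Rightarrow> complex) \<Rightarrow> ('g \<Rightarrow> complex)" where
  "truncated_operator G \<mu> A f =
     (\<lambda>x. \<Sum>\<^sub>\<infinity>y\<in>carrier G. of_real (truncated_transition G \<mu> A x y) * f y)"

definition Lambda :: "('g, 'm) monoid_scheme \<Rightarrow> 'g pmf \<Rightarrow> complex set" where
  "Lambda G \<mu> =
     (\<Union>A \<in> cluster_shapes G (set_pmf \<mu>) - {{}}.
        op_spectrum (carrier G) (truncated_operator G \<mu> A)) \<union> {0}"


section \<open>Bernoulli site percolation\<close>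

definition site_percolation :: "('g, 'm) monoid_scheme \<Rightarrow> real \<Rightarrow> ('g \<Rightarrow> bool) measure" where
  "site_percolation G p = PiM (carrier G) (\<lambda>_. measure_pmf (bernoulli_pmf p))"

text \<open>The cluster is empty when \<open>\<one>\<^bsub>G\<^esub>\<close> is closed.\<close>

definition cluster ::
    "('g, 'm) monoid_scheme \<Rightarrow> 'g set \<Rightarrow> ('g \<Rightarrow> bool) \<Rightarrow> 'g set" where
  "cluster G S \<omega> =
     {x. joined_in (cayley_edges G S) {v \<in> carrier G. \<omega> v} \<one>\<^bsub>G\<^esub> x}"

text \<open>
  For finite \<open>S\<close> generating \<open>G\<close> the vertex set is countable and the event below is measurable
  (a countable union, over finite sets \<open>A\<close>, of events "the cluster is \<open>A\<close>", complemented), so its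
  measure is not the default value \<open>0\<close> of \<^const>\<open>measure\<close> on non-measurable sets.
\<close>

definition percolation_prob :: "('g, 'm) monoid_scheme \<Rightarrow> 'g set \<Rightarrow> real \<Rightarrow> real" where
  "percolation_prob G S p =
     measure (site_percolation G p)
       {\<omega> \<in> space (site_percolation G p). infinite (cluster G S \<omega>)}"

end

theory Submission
  imports Defs "HOL-Computational_Algebra.Fundamental_Theorem_Algebra"
begin

text \<open>
  Let \<open>Q\<^sub>x\<close> be the projection averaging a function of the lamp configuration over the lamp at \<open>x\<close>.
  The switch-walk-switch operator maps \<open>F\<close> to \<open>(\<eta>, x) \<mapsto> \<Sum>y. p(x, y) (Q\<^sub>x Q\<^sub>y F(\<cdot>, y))(\<eta>)\<close>. For a finite
  set \<open>A\<close> with outer boundary \<open>B\<close>, put \<open>\<Pi>\<^sub>A = \<Prod>x\<in>A. Q\<^sub>x \<cdot> \<Prod>x\<in>B. (1 - Q\<^sub>x)\<close>. If \<open>f\<close> is in the range of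
  \<open>\<Pi>\<^sub>A\<close> and \<open>\<phi>\<close> is an eigenvector of \<open>P\<^sub>A\<close>, then \<open>\<phi> \<otimes> f\<close> is an eigenfunction with the same eigenvalue.
  For \<open>A = {}\<close> and \<open>B = {x}\<close> the function \<open>\<delta>\<^sub>x \<otimes> f\<close> is in the kernel.

  Over the finite connected \<open>A\<close> containing a given \<open>x\<close>, together with \<open>A = {}\<close>, \<open>B = {x}\<close>, the projections
  \<open>\<Pi>\<^sub>A\<close> are mutually orthogonal, and \<open>\<langle>\<Pi>\<^sub>A \<delta>\<^sub>\<zeta>, \<delta>\<^sub>\<zeta>\<rangle> = p\<^bsup>|A|\<^esup> (1 - p)\<^bsup>|B|\<^esup>\<close> with \<open>p = 1/|H|\<close> is the
  probability that the percolation cluster of \<open>x\<close> is \<open>A\<close>. These numbers sum to \<open>1 = \<parallel>\<delta>\<^sub>\<zeta>\<parallel>\<^sup>2\<close>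
  exactly when the cluster is almost surely finite; then \<open>\<delta>\<^sub>\<zeta> = \<Sum>A. \<Pi>\<^sub>A \<delta>\<^sub>\<zeta>\<close> and the
  eigenfunctions above are total.
\<close>

section \<open>Eigenvectors of finite symmetric kernels\<close>

text \<open>The functions built from clusters are not yet an orthonormal system: for one cluster the
  projected point masses of different \<zeta> overlap. They serve to prove totality, namely that an
  \<open>F\<close> orthogonal to all finitely supported eigenfunctions with eigenvalue in
  \<open>Lambda\<close> vanishes. The orthonormal system comes afterwards: symmetry separates
  distinct eigenvalues, and each eigenspace is orthonormalised within its finitely supported
  elements, a space that need not be complete. Totality is quantitative: the squared modulus of
  \<open>F (\<zeta>, x)\<close> is at most the squared norm of \<open>F\<close> times the
  probability missed by any finite set of clusters. For a finite cluster the argument runs by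
  contradiction and asks for a single eigenvector that is not orthogonal to a given function,
  instead of a diagonalisation of the matrix. The boundary lamps decouple the clusters. A function
  in the range of \<open>1 - Q\<^sub>x\<close> is annihilated as soon as the lamp at
  \<open>x\<close> is averaged, so that no mass flows from \<open>A\<close> to its boundary. The
  spectrum is read off from the same system, on which the operator is diagonal and has an explicit
  resolvent away from the closure of \<open>Lambda\<close>.\<close>

lemma exists_linear_relation:
  fixes w :: "'i \<Rightarrow> 'x \<Rightarrow> 'c::field"
  assumes "finite A" "finite I" "card A < card I"
  shows "\<exists>c. (\<exists>i\<in>I. c i \<noteq> 0) \<and> (\<forall>x\<in>A. (\<Sum>i\<in>I. c i * w i x) = 0)"
  using assms
proof (induction A arbitrary: I w rule: finite_induct)
  case empty
  then have "I \<noteq> {}" by auto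
  then show ?case by (intro exI[of _ "\<lambda>_. 1"]) auto
next
  case (insert a A)
  show ?case
  proof (cases "\<forall>i\<in>I. w i a = 0")
    case True
    have "card A < card I" using insert by simp
    from insert.IH[OF insert.prems(1) this, of w] show ?thesis using True by auto
  next
    case False
    then obtain j where j: "j \<in> I" "w j a \<noteq> 0" by auto
    let ?I = "I - {j}"
    have "card A < card ?I" using insert j by simp
    \<comment> \<open>Gaussian elimination: \<open>w j\<close> is the pivot, and subtracting its
      multiples clears the coordinate \<open>a\<close> at the price of one vector.\<close>
    from insert.IH[OF _ this, of "\<lambda>i x. w i x - w i a / w j a * w j x"] insert.prems
    obtain c where c: "\<exists>i\<in>?I. c i \<noteq> 0"
      "\<forall>x\<in>A. (\<Sum>i\<in>?I. c i * (w i x - w i a / w j a * w j x)) = 0" by auto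
    define d where "d = c(j := - (\<Sum>i\<in>?I. c i * w i a / w j a))"
    have d: "(\<Sum>i\<in>I. d i * w i x) = (\<Sum>i\<in>?I. c i * (w i x - w i a / w j a * w j x))" for x
    proof -
      have "(\<Sum>i\<in>I. d i * w i x) = d j * w j x + (\<Sum>i\<in>?I. d i * w i x)"
        using j insert.prems by (simp add: sum.remove)
      also have "(\<Sum>i\<in>?I. d i * w i x) = (\<Sum>i\<in>?I. c i * w i x)"
        by (rule sum.cong) (auto simp: d_def)
      also have "d j * w j x = - (\<Sum>i\<in>?I. c i * w i a / w j a * w j x)"
        by (simp add: d_def sum_distrib_right)
      finally show ?thesis by (simp add: algebra_simps sum_subtractf)
    qed
    have "(\<Sum>i\<in>I. d i * w i a) = 0"
      unfolding d using j by (intro sum.neutral) simp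
    moreover have "\<exists>i\<in>I. d i \<noteq> 0" using c(1) by (auto simp: d_def)
    ultimately show ?thesis using c(2) d by (intro exI[of _ d]) auto
  qed
qed

text \<open>If \<open>p\<close> is a nonzero polynomial of least degree with \<open>p(k) \<psi> = 0\<close> and \<open>p = (X - c) q\<close>, then
  \<open>v = q(k) \<psi>\<close> is an eigenvector and \<open>\<langle>v, v\<rangle>\<close> is a multiple of \<open>\<langle>\<psi>, v\<rangle>\<close> by symmetry.\<close>
lemma exists_nonorthogonal_eigenvector:
  fixes k :: "'x \<Rightarrow> 'x \<Rightarrow> real" and \<psi> :: "'x \<Rightarrow> complex"
  assumes A: "finite A" and sym: "\<And>x y. x \<in> A \<Longrightarrow> y \<in> A \<Longrightarrow> k x y = k y x"
    and psi: "x0 \<in> A" "\<psi> x0 \<noteq> 0"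
  shows "\<exists>\<phi> c. (\<forall>x. x \<notin> A \<longrightarrow> \<phi> x = 0) \<and> (\<forall>x\<in>A. (\<Sum>y\<in>A. of_real (k x y) * \<phi> y) = c * \<phi> x) \<and>
      (\<Sum>x\<in>A. \<psi> x * cnj (\<phi> x)) \<noteq> 0"
proof -
  define T where "T f x = (if x \<in> A then \<Sum>y\<in>A. of_real (k x y) * f y else 0)"
    for f :: "'x \<Rightarrow> complex" and x
  define \<psi>' where "\<psi>' x = (if x \<in> A then \<psi> x else 0)" for x
  define w where "w i = (T ^^ i) \<psi>'" for i
  have wS: "w (Suc i) = T (w i)" for i by (simp add: w_def)
  have w0: "w i x = 0" if "x \<notin> A" for i x
    using that by (cases i) (auto simp: w_def T_def \<psi>'_def)
  \<comment> \<open>\<open>ev p\<close> is the polynomial \<open>p\<close> in \<open>T\<close>,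
    applied to \<open>\<psi>'\<close>.\<close>
  define ev where "ev p x = (\<Sum>i\<le>Polynomial.degree p. Polynomial.coeff p i * w i x)" for p x
  have ev_alt: "ev p x = (\<Sum>i\<le>N. Polynomial.coeff p i * w i x)" if "Polynomial.degree p \<le> N" for p x N
    unfolding ev_def using that
    by (intro sum.mono_neutral_left) (auto simp: coeff_eq_0)
  have ev0: "ev p x = 0" if "x \<notin> A" for p x using w0[OF that] by (simp add: ev_def)
  have evT: "T (ev q) x = (\<Sum>i\<le>Polynomial.degree q. Polynomial.coeff q i * w (Suc i) x)" for q x
  proof (cases "x \<in> A")
    case True
    have "T (ev q) x = (\<Sum>y\<in>A. \<Sum>i\<le>Polynomial.degree q. Polynomial.coeff q i * (of_real (k x y) * w i y))"
      using True by (simp add: T_def ev_def sum_distrib_left algebra_simps)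
    also have "\<dots> = (\<Sum>i\<le>Polynomial.degree q. \<Sum>y\<in>A. Polynomial.coeff q i * (of_real (k x y) * w i y))"
      by (rule sum.swap)
    finally show ?thesis using True by (simp add: wS T_def sum_distrib_left)
  next
    case False then show ?thesis using w0 by (simp add: T_def)
  qed
  define P where "P p \<longleftrightarrow> p \<noteq> 0 \<and> (\<forall>x\<in>A. ev p x = 0)" for p :: "complex poly"
  have "\<exists>p. P p"
  proof -
    \<comment> \<open>The vectors \<open>w 0\<close>, ..., \<open>w (card A)\<close> are one more
      than there are coordinates in \<open>A\<close>; a linear relation between them is an
      annihilating polynomial.\<close>
    have "card A < card {..card A}" by simp
    from exists_linear_relation[OF A finite_atMost this, of w]
    obtain c where c: "\<exists>i\<le>card A. c i \<noteq> 0" "\<forall>x\<in>A. (\<Sum>i\<le>card A. c i * w i x) = 0" by auto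
    define p where "p = (\<Sum>i\<le>card A. Polynomial.monom (c i) i)"
    have cf: "Polynomial.coeff p i = (if i \<le> card A then c i else 0)" for i
      by (auto simp: p_def coeff_sum)
    then have "Polynomial.degree p \<le> card A" by (intro degree_le) auto
    then have "ev p x = (\<Sum>i\<le>card A. c i * w i x)" for x by (subst ev_alt) (auto simp: cf)
    moreover have "p \<noteq> 0" using c(1) cf by (metis coeff_0)
    ultimately show ?thesis using c(2) by (auto simp: P_def)
  qed
  then obtain p where p: "P p" and pmin: "\<And>q. P q \<Longrightarrow> Polynomial.degree p \<le> Polynomial.degree q"
    by (metis ex_has_least_nat)
  have "Polynomial.degree p \<noteq> 0"
  proof
    assume "Polynomial.degree p = 0"
    then obtain a where a: "p = [:a:]" by (metis degree_eq_zeroE)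
    have "ev p x0 = 0" using p psi by (auto simp: P_def)
    then show False using p psi a by (auto simp: ev_def w_def \<psi>'_def P_def)
  qed
  then have "\<not> constant (poly p)" by (simp add: constant_degree)
  then obtain c where "poly p c = 0" using fundamental_theorem_of_algebra by blast
  then obtain q where q: "p = [:-c, 1:] * q" by (auto simp: poly_eq_0_iff_dvd elim: dvdE)
  have q0: "q \<noteq> 0" using q p by (auto simp: P_def)
  have dp: "Polynomial.degree p = Suc (Polynomial.degree q)"
  proof -
    have "Polynomial.degree p = Polynomial.degree [:-c, 1:] + Polynomial.degree q"
      unfolding q using q0 by (intro degree_mult_eq) auto
    then show ?thesis by simp
  qed
  define v where "v = ev q"
  have "\<not> P q" using pmin[of q] dp by auto
  then obtain x1 where x1: "x1 \<in> A" "v x1 \<noteq> 0" using q0 by (auto simp: P_def v_def)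
  have Tv: "T v x = c * v x" if "x \<in> A" for x
  proof -
    have "ev p x = (\<Sum>i\<le>Suc (Polynomial.degree q). Polynomial.coeff p i * w i x)"
      by (rule ev_alt) (simp add: dp)
    also have "\<dots> = (\<Sum>i\<le>Suc (Polynomial.degree q). (Polynomial.coeff (pCons 0 q) i - c * Polynomial.coeff q i) * w i x)"
      by (rule sum.cong) (auto simp: q)
    also have "\<dots> = (\<Sum>i\<le>Suc (Polynomial.degree q). Polynomial.coeff (pCons 0 q) i * w i x) - c * ev q x"
      by (subst ev_alt[where N="Suc (Polynomial.degree q)"]) (auto simp: algebra_simps sum_subtractf sum_distrib_left)
    also have "(\<Sum>i\<le>Suc (Polynomial.degree q). Polynomial.coeff (pCons 0 q) i * w i x) = T (ev q) x"
      by (subst sum.atMost_Suc_shift) (simp add: evT)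
    finally show ?thesis using p that by (auto simp: P_def v_def)
  qed
  have real_k: "cnj (of_real (k x y)) = of_real (k x y)" for x y by simp
  have symT: "(\<Sum>x\<in>A. T f x * cnj (g x)) = (\<Sum>x\<in>A. f x * cnj (T g x))" for f g
  proof -
    have "(\<Sum>x\<in>A. T f x * cnj (g x)) = (\<Sum>x\<in>A. \<Sum>y\<in>A. of_real (k x y) * f y * cnj (g x))"
      by (simp add: T_def sum_distrib_right)
    also have "\<dots> = (\<Sum>y\<in>A. \<Sum>x\<in>A. of_real (k x y) * f y * cnj (g x))" by (rule sum.swap)
    also have "\<dots> = (\<Sum>y\<in>A. \<Sum>x\<in>A. of_real (k y x) * f y * cnj (g x))"
      by (intro sum.cong refl) (simp add: sym)
    finally show ?thesis by (simp add: T_def sum_distrib_left algebra_simps)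
  qed
  \<comment> \<open>Each power of \<open>T\<close> is moved onto the eigenvector \<open>v\<close> in
    the second argument, where it turns into a factor \<open>cnj c\<close>. Every pairing with
    \<open>v\<close> is thus a multiple of the pairing with \<psi>.\<close>
  have wv: "(\<Sum>x\<in>A. w i x * cnj (v x)) = cnj c ^ i * (\<Sum>x\<in>A. \<psi> x * cnj (v x))" for i
  proof (induction i)
    case 0 show ?case by (simp add: w_def \<psi>'_def)
  next
    case (Suc i)
    have "(\<Sum>x\<in>A. w (Suc i) x * cnj (v x)) = (\<Sum>x\<in>A. w i x * (cnj c * cnj (v x)))"
      unfolding wS symT by (intro sum.cong) (auto simp: Tv)
    also have "\<dots> = cnj c * (\<Sum>x\<in>A. w i x * cnj (v x))"
      by (simp add: sum_distrib_left algebra_simps)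
    finally show ?case by (simp add: Suc.IH)
  qed
  have "(\<Sum>x\<in>A. v x * cnj (v x)) = (\<Sum>i\<le>Polynomial.degree q. Polynomial.coeff q i * (\<Sum>x\<in>A. w i x * cnj (v x)))"
    unfolding v_def by (subst (1) ev_def) (simp add: sum_distrib_right sum_distrib_left sum.swap[of _ A] mult.assoc)
  also have "\<dots> = (\<Sum>i\<le>Polynomial.degree q. Polynomial.coeff q i * cnj c ^ i) * (\<Sum>x\<in>A. \<psi> x * cnj (v x))"
    by (simp add: wv sum_distrib_right mult.assoc)
  finally have vv: "(\<Sum>x\<in>A. v x * cnj (v x)) = \<dots>" .
  have "(\<Sum>x\<in>A. v x * cnj (v x)) = of_real (\<Sum>x\<in>A. (cmod (v x))\<^sup>2)"
    by (simp add: complex_norm_square del: of_real_power)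
  moreover have "(\<Sum>x\<in>A. (cmod (v x))\<^sup>2) > 0"
    using x1 A by (intro sum_pos2[of A x1]) auto
  ultimately have "(\<Sum>x\<in>A. \<psi> x * cnj (v x)) \<noteq> 0"
    using vv by (metis less_irrefl mult_zero_right of_real_eq_0_iff)
  moreover have "\<forall>x\<in>A. (\<Sum>y\<in>A. of_real (k x y) * v y) = c * v x"
    using Tv by (auto simp: T_def)
  moreover have "\<forall>x. x \<notin> A \<longrightarrow> v x = 0" using ev0 by (simp add: v_def)
  ultimately show ?thesis by blast
qed

section \<open>Square summable functions\<close>

lemma ell2_zero_outside: "f \<in> ell2 X \<Longrightarrow> x \<notin> X \<Longrightarrow> f x = 0"
  by (simp add: ell2_def)

lemma ell2_finite_sum_le:
  assumes "f \<in> ell2 X" "finite S" "S \<subseteq> X"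
  shows "(\<Sum>x\<in>S. (cmod (f x))\<^sup>2) \<le> (ell2_norm X f)\<^sup>2"
proof -
  have "(\<lambda>x. (cmod (f x))\<^sup>2) summable_on X" using assms by (simp add: ell2_def)
  then have "(\<Sum>x\<in>S. (cmod (f x))\<^sup>2) \<le> (\<Sum>\<^sub>\<infinity>x\<in>X. (cmod (f x))\<^sup>2)"
    using assms by (intro finite_sum_le_infsum) auto
  then show ?thesis by (simp add: ell2_norm_def infsum_nonneg)
qed

text \<open>For nonnegative families summability is boundedness of the finite partial sums, so
  membership and norm estimates reduce to inequalities between finite sums.\<close>

lemma ell2I_bounded:
  assumes "\<And>x. x \<notin> X \<Longrightarrow> f x = 0" "0 \<le> b"
    and bd: "\<And>S. finite S \<Longrightarrow> S \<subseteq> X \<Longrightarrow> (\<Sum>x\<in>S. (cmod (f x))\<^sup>2) \<le> b\<^sup>2"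
  shows "f \<in> ell2 X" "ell2_norm X f \<le> b"
proof -
  have s: "(\<lambda>x. (cmod (f x))\<^sup>2) summable_on X"
    by (rule nonneg_bdd_above_summable_on) (auto intro!: bdd_aboveI2[where M="b\<^sup>2"] bd)
  then show "f \<in> ell2 X" using assms by (simp add: ell2_def)
  have "(\<Sum>\<^sub>\<infinity>x\<in>X. (cmod (f x))\<^sup>2) \<le> b\<^sup>2"
    by (rule infsum_le_finite_sums[OF s]) (auto intro: bd)
  then show "ell2_norm X f \<le> b"
    using assms(2) by (simp add: ell2_norm_def real_le_lsqrt infsum_nonneg)
qed

lemma ell2_norm_nonneg: "0 \<le> ell2_norm X f"
  by (simp add: ell2_norm_def infsum_nonneg)

lemma ell2_scale:
  assumes "f \<in> ell2 X"
  shows "(\<lambda>x. c * f x) \<in> ell2 X" "ell2_norm X (\<lambda>x. c * f x) = cmod c * ell2_norm X f"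
proof -
  have "(\<lambda>x. (cmod (f x))\<^sup>2) summable_on X" using assms by (simp add: ell2_def)
  then show "(\<lambda>x. c * f x) \<in> ell2 X"
    using assms by (auto simp: ell2_def norm_mult power_mult_distrib summable_on_cmult_right)
  show "ell2_norm X (\<lambda>x. c * f x) = cmod c * ell2_norm X f"
    by (simp add: ell2_norm_def norm_mult power_mult_distrib infsum_cmult_right' real_sqrt_mult)
qed

lemma ell2_add:
  assumes "f \<in> ell2 X" "g \<in> ell2 X"
  shows "(\<lambda>x. f x + g x) \<in> ell2 X"
proof (rule ell2I_bounded(1))
  let ?b = "sqrt (2 * ((ell2_norm X f)\<^sup>2 + (ell2_norm X g)\<^sup>2))"
  show "0 \<le> ?b" by simp
  fix S assume S: "finite S" "S \<subseteq> X"
  have "(cmod (f x + g x))\<^sup>2 \<le> 2 * ((cmod (f x))\<^sup>2 + (cmod (g x))\<^sup>2)" for x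
  proof -
    have "(cmod (f x + g x))\<^sup>2 \<le> (cmod (f x) + cmod (g x))\<^sup>2"
      by (intro power_mono norm_triangle_ineq) auto
    also have "\<dots> \<le> 2 * ((cmod (f x))\<^sup>2 + (cmod (g x))\<^sup>2)"
      using sum_squares_bound[of "cmod (f x)" "cmod (g x)"] by (simp add: power2_sum)
    finally show ?thesis .
  qed
  then have "(\<Sum>x\<in>S. (cmod (f x + g x))\<^sup>2) \<le> (\<Sum>x\<in>S. 2 * ((cmod (f x))\<^sup>2 + (cmod (g x))\<^sup>2))"
    by (intro sum_mono)
  also have "\<dots> = 2 * ((\<Sum>x\<in>S. (cmod (f x))\<^sup>2) + (\<Sum>x\<in>S. (cmod (g x))\<^sup>2))"
    by (simp add: sum_distrib_left sum.distrib distrib_left)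
  also have "\<dots> \<le> 2 * ((ell2_norm X f)\<^sup>2 + (ell2_norm X g)\<^sup>2)"
    using ell2_finite_sum_le[OF assms(1) S] ell2_finite_sum_le[OF assms(2) S] by simp
  finally show "(\<Sum>x\<in>S. (cmod (f x + g x))\<^sup>2) \<le> ?b\<^sup>2" by simp
qed (use assms in \<open>auto simp: ell2_zero_outside\<close>)

lemma ell2_diff_scale:
  assumes "f \<in> ell2 X" "g \<in> ell2 X"
  shows "(\<lambda>x. f x - c * g x) \<in> ell2 X"
  using ell2_add[OF assms(1) ell2_scale(1)[OF assms(2), of "- c"]] by simp

lemma ell2_finite_support:
  assumes "finite {x. f x \<noteq> 0}" "{x. f x \<noteq> 0} \<subseteq> X"
  shows "f \<in> ell2 X"
proof -
  have "(\<lambda>x. (cmod (f x))\<^sup>2) summable_on {x. f x \<noteq> 0}" using assms by simp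
  then have "(\<lambda>x. (cmod (f x))\<^sup>2) summable_on X"
    by (rule summable_on_cong_neutral[THEN iffD1, rotated -1]) (use assms in auto)
  then show ?thesis using assms by (auto simp: ell2_def)
qed

lemma ell2_inner_finite:
  assumes "finite S" "S \<subseteq> X" "\<And>x. x \<notin> S \<Longrightarrow> g x = 0"
  shows "ell2_inner X f g = (\<Sum>x\<in>S. f x * cnj (g x))"
proof -
  have "ell2_inner X f g = (\<Sum>\<^sub>\<infinity>x\<in>S. f x * cnj (g x))"
    unfolding ell2_inner_def by (rule infsum_cong_neutral) (use assms in auto)
  then show ?thesis using assms by simp
qed

section \<open>Finitely supported functions\<close>

definition finsupp :: "'x set \<Rightarrow> ('x \<Rightarrow> complex) set" where
  "finsupp X = {g. finite {x. g x \<noteq> 0} \<and> {x. g x \<noteq> 0} \<subseteq> X}"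

lemma finsupp_ell2: "g \<in> finsupp X \<Longrightarrow> g \<in> ell2 X"
  by (auto simp: finsupp_def intro: ell2_finite_support)

lemma finsupp_diff_scale: "f \<in> finsupp X \<Longrightarrow> g \<in> finsupp X \<Longrightarrow> (\<lambda>x. f x - c * g x) \<in> finsupp X"
  unfolding finsupp_def
  by (auto intro: finite_subset[of _ "{x. f x \<noteq> 0} \<union> {x. g x \<noteq> 0}"]) force

lemma finsupp_scale: "g \<in> finsupp X \<Longrightarrow> (\<lambda>x. c * g x) \<in> finsupp X"
  unfolding finsupp_def by (auto intro: finite_subset[of _ "{x. g x \<noteq> 0}"])

text \<open>Against a finitely supported \<open>g\<close> the inner product is a finite sum whatever
  the other argument is, which makes linearity in that argument immediate.\<close>

lemma ell2_inner_finsupp: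
  assumes "g \<in> finsupp X"
  shows "ell2_inner X f g = (\<Sum>x | g x \<noteq> 0. f x * cnj (g x))"
  using assms by (intro ell2_inner_finite) (auto simp: finsupp_def)

lemma ell2_inner_diff_scale_left:
  "g \<in> finsupp X \<Longrightarrow>
    ell2_inner X (\<lambda>x. f x - c * h x) g = ell2_inner X f g - c * ell2_inner X h g"
  by (simp add: ell2_inner_finsupp algebra_simps sum_subtractf sum_distrib_left)

lemma ell2_inner_add_left:
  "g \<in> finsupp X \<Longrightarrow>
    ell2_inner X (\<lambda>x. f x + h x) g = ell2_inner X f g + ell2_inner X h g"
  by (simp add: ell2_inner_finsupp algebra_simps sum.distrib)

lemma ell2_inner_scale_left:
  "g \<in> finsupp X \<Longrightarrow> ell2_inner X (\<lambda>x. c * h x) g = c * ell2_inner X h g"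
  by (simp add: ell2_inner_finsupp algebra_simps sum_distrib_left)

lemma ell2_inner_commute: "ell2_inner X g f = cnj (ell2_inner X f g)"
  unfolding ell2_inner_def by (subst infsum_cnj[symmetric]) (simp add: mult.commute)

lemma ell2_inner_diff_scale_right:
  assumes "g \<in> finsupp X" "h \<in> finsupp X"
  shows "ell2_inner X f (\<lambda>x. g x - c * h x) = ell2_inner X f g - cnj c * ell2_inner X f h"
proof -
  let ?S = "{x. g x \<noteq> 0} \<union> {x. h x \<noteq> 0}"
  have "finite ?S" "?S \<subseteq> X" using assms by (auto simp: finsupp_def)
  then have "ell2_inner X f w = (\<Sum>x\<in>?S. f x * cnj (w x))" if "\<And>x. x \<notin> ?S \<Longrightarrow> w x = 0" for w
    using that by (intro ell2_inner_finite) auto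
  then show ?thesis by (simp add: algebra_simps sum_subtractf sum_distrib_left)
qed

lemma ell2_inner_scale_right:
  "f \<in> finsupp X \<Longrightarrow> ell2_inner X f (\<lambda>x. c * h x) = cnj c * ell2_inner X f h"
  by (subst (1 2) ell2_inner_commute) (simp add: ell2_inner_scale_left)

lemma ell2_inner_self_finsupp:
  assumes "g \<in> finsupp X"
  shows "ell2_inner X g g = of_real (\<Sum>x | g x \<noteq> 0. (cmod (g x))\<^sup>2)"
  by (simp add: ell2_inner_finsupp[OF assms] complex_norm_square del: of_real_power)

lemma ell2_norm_finsupp:
  assumes "g \<in> finsupp X"
  shows "(ell2_norm X g)\<^sup>2 = (\<Sum>x | g x \<noteq> 0. (cmod (g x))\<^sup>2)"
proof -
  have "(\<Sum>\<^sub>\<infinity>x\<in>X. (cmod (g x))\<^sup>2) = (\<Sum>\<^sub>\<infinity>x\<in>{x. g x \<noteq> 0}. (cmod (g x))\<^sup>2)"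
    using assms by (intro infsum_cong_neutral) (auto simp: finsupp_def)
  also have "\<dots> = (\<Sum>x | g x \<noteq> 0. (cmod (g x))\<^sup>2)" using assms by (simp add: finsupp_def)
  finally show ?thesis by (simp add: ell2_norm_def sum_nonneg)
qed

lemma ell2_inner_self_norm:
  "g \<in> finsupp X \<Longrightarrow> ell2_inner X g g = of_real ((ell2_norm X g)\<^sup>2)"
  by (simp only: ell2_norm_finsupp ell2_inner_self_finsupp)

lemma ell2_inner_self_eq_0:
  assumes "g \<in> finsupp X"
  shows "ell2_inner X g g = 0 \<longleftrightarrow> g = (\<lambda>x. 0)"
proof
  assume "ell2_inner X g g = 0"
  then have "(\<Sum>x | g x \<noteq> 0. (cmod (g x))\<^sup>2) = 0"
    using ell2_inner_self_finsupp[OF assms] by (simp del: of_real_sum)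
  then show "g = (\<lambda>x. 0)"
    using assms by (subst (asm) sum_nonneg_eq_0_iff) (auto simp: finsupp_def)
qed (simp add: ell2_inner_def)

lemma ell2_inner_delta:
  assumes "x \<in> X" "g \<in> finsupp X"
  shows "ell2_inner X (\<lambda>y. of_bool (y = x)) g = cnj (g x)"
proof -
  have "ell2_inner X (\<lambda>y. of_bool (y = x)) g = (\<Sum>y | g y \<noteq> 0. if y = x then cnj (g y) else 0)"
    using assms by (auto simp: ell2_inner_finsupp intro!: sum.cong)
  then show ?thesis using assms by (auto simp: finsupp_def)
qed

section \<open>Orthonormal systems and Bessel's inequality\<close>

definition orthonormal :: "'x set \<Rightarrow> ('x \<Rightarrow> complex) set \<Rightarrow> bool" where
  "orthonormal X U \<longleftrightarrow>
     U \<subseteq> finsupp X \<and> (\<forall>u\<in>U. \<forall>v\<in>U. ell2_inner X u v = (if u = v then 1 else 0))"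

text \<open>Pythagoras, with \<open>S\<close> a finite set carrying all supports, so that norms and
  inner products are finite sums over \<open>S\<close>.\<close>

lemma orthonormal_combination_norm:
  assumes U: "orthonormal X U" and V: "finite V" "V \<subseteq> U"
    and S: "finite S" "S \<subseteq> X" "\<And>u x. u \<in> V \<Longrightarrow> x \<notin> S \<Longrightarrow> u x = 0"
  shows "(\<Sum>x\<in>S. (cmod (\<Sum>u\<in>V. a u * u x))\<^sup>2) = (\<Sum>u\<in>V. (cmod (a u))\<^sup>2)"
proof -
  have on: "(\<Sum>x\<in>S. u x * cnj (v x)) = (if u = v then 1 else 0)" if "u \<in> V" "v \<in> V" for u v
  proof -
    have "ell2_inner X u v = (if u = v then 1 else 0)"
      using U V that unfolding orthonormal_def by blast
    then show ?thesis using S that by (subst ell2_inner_finite[symmetric, of S X]) auto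
  qed
  have "complex_of_real (\<Sum>x\<in>S. (cmod (\<Sum>u\<in>V. a u * u x))\<^sup>2)
      = (\<Sum>x\<in>S. \<Sum>u\<in>V. \<Sum>v\<in>V. a u * cnj (a v) * (u x * cnj (v x)))"
    by (simp add: complex_norm_square sum_product algebra_simps del: of_real_power)
  also have "\<dots> = (\<Sum>u\<in>V. \<Sum>v\<in>V. a u * cnj (a v) * (\<Sum>x\<in>S. u x * cnj (v x)))"
    by (simp add: sum_distrib_left sum.swap[of _ S])
  also have "\<dots> = (\<Sum>u\<in>V. \<Sum>v\<in>V. if u = v then a u * cnj (a v) else 0)"
    by (intro sum.cong refl) (simp add: on)
  also have "\<dots> = complex_of_real (\<Sum>u\<in>V. (cmod (a u))\<^sup>2)"
    using V by (simp add: complex_norm_square del: of_real_power)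
  finally show ?thesis by (simp only: of_real_eq_iff)
qed

text \<open>On the finite union \<open>S\<close> of the supports, \<open>g\<close> is the projection
  of \<open>f\<close> to the span of \<open>V\<close>. Expanding the squared norm of
  \<open>f - g\<close> over \<open>S\<close> gives the inequality there, and restriction to
  \<open>S\<close> does not increase the norm of \<open>f\<close>.\<close>

lemma bessel:
  assumes U: "orthonormal X U" and V: "finite V" "V \<subseteq> U" and f: "f \<in> ell2 X"
  shows "(\<Sum>u\<in>V. (cmod (ell2_inner X f u))\<^sup>2) \<le> (ell2_norm X f)\<^sup>2"
proof -
  define S where "S = (\<Union>u\<in>V. {x. u x \<noteq> 0})"
  have S: "finite S" "S \<subseteq> X" "\<And>u x. u \<in> V \<Longrightarrow> x \<notin> S \<Longrightarrow> u x = 0"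
    using U V by (auto simp: S_def orthonormal_def finsupp_def)
  define a where "a u = ell2_inner X f u" for u
  have a: "a u = (\<Sum>x\<in>S. f x * cnj (u x))" if "u \<in> V" for u
    unfolding a_def using S that by (intro ell2_inner_finite) auto
  define g where "g x = (\<Sum>u\<in>V. a u * u x)" for x
  have gg: "(\<Sum>x\<in>S. (cmod (g x))\<^sup>2) = (\<Sum>u\<in>V. (cmod (a u))\<^sup>2)"
    unfolding g_def by (rule orthonormal_combination_norm[OF U V S(1,2)]) (use S(3) in auto)
  have "(\<Sum>x\<in>S. f x * cnj (g x)) = (\<Sum>u\<in>V. cnj (a u) * (\<Sum>x\<in>S. f x * cnj (u x)))"
    by (simp add: g_def sum_distrib_left sum.swap[of _ S] algebra_simps)
  also have "\<dots> = of_real (\<Sum>u\<in>V. (cmod (a u))\<^sup>2)"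
    by (simp add: a[symmetric] complex_norm_square mult.commute del: of_real_power)
  finally have fg: "(\<Sum>x\<in>S. f x * cnj (g x)) = of_real (\<Sum>u\<in>V. (cmod (a u))\<^sup>2)" .
  have re: "(cmod (f x - g x))\<^sup>2 = (cmod (f x))\<^sup>2 + (cmod (g x))\<^sup>2 - 2 * Re (f x * cnj (g x))" for x
    unfolding cmod_power2 by (simp add: power2_eq_square algebra_simps)
  have "0 \<le> (\<Sum>x\<in>S. (cmod (f x - g x))\<^sup>2)" by (intro sum_nonneg) auto
  also have "\<dots> = (\<Sum>x\<in>S. (cmod (f x))\<^sup>2) + (\<Sum>x\<in>S. (cmod (g x))\<^sup>2) - 2 * Re (\<Sum>x\<in>S. f x * cnj (g x))"
    unfolding re by (simp add: sum_subtractf sum.distrib sum_distrib_left)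
  also have "\<dots> = (\<Sum>x\<in>S. (cmod (f x))\<^sup>2) - (\<Sum>u\<in>V. (cmod (a u))\<^sup>2)"
    unfolding gg fg by simp
  finally show ?thesis using ell2_finite_sum_le[OF f S(1,2)] by (simp add: a_def)
qed

section \<open>Symmetric substochastic kernels\<close>

definition kernel_op :: "'x set \<Rightarrow> ('x \<Rightarrow> 'x \<Rightarrow> real) \<Rightarrow> ('x \<Rightarrow> complex) \<Rightarrow> 'x \<Rightarrow> complex" where
  "kernel_op X k f = (\<lambda>x. if x \<in> X then \<Sum>\<^sub>\<infinity>y\<in>X. of_real (k x y) * f y else 0)"

text \<open>A common frame for the walk on the lamplighter group and for its truncations to finite
  sets of sites. Finite rows make the operator a pointwise finite sum, defined on arbitrary
  functions.\<close>

locale symmetric_kernel =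
  fixes X :: "'x set" and k :: "'x \<Rightarrow> 'x \<Rightarrow> real"
  assumes countable_X: "countable X"
    and sym: "x \<in> X \<Longrightarrow> y \<in> X \<Longrightarrow> k x y = k y x"
    and nonneg: "x \<in> X \<Longrightarrow> y \<in> X \<Longrightarrow> 0 \<le> k x y"
    and finite_row: "x \<in> X \<Longrightarrow> finite {y \<in> X. k x y \<noteq> 0}"
    and row_sum: "x \<in> X \<Longrightarrow> (\<Sum>y | y \<in> X \<and> k x y \<noteq> 0. k x y) \<le> 1"
begin

abbreviation T where "T \<equiv> kernel_op X k"

lemma kernel_op_finite:
  assumes "x \<in> X" "finite S" "{y \<in> X. k x y \<noteq> 0 \<and> f y \<noteq> 0} \<subseteq> S" "S \<subseteq> X"
  shows "T f x = (\<Sum>y\<in>S. of_real (k x y) * f y)"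
proof -
  have "T f x = (\<Sum>\<^sub>\<infinity>y\<in>X. of_real (k x y) * f y)" using assms by (simp add: kernel_op_def)
  also have "\<dots> = (\<Sum>\<^sub>\<infinity>y\<in>S. of_real (k x y) * f y)"
    by (rule infsum_cong_neutral) (use assms in auto)
  finally show ?thesis using assms by simp
qed

lemma kernel_op_row: "x \<in> X \<Longrightarrow> T f x = (\<Sum>y | y \<in> X \<and> k x y \<noteq> 0. of_real (k x y) * f y)"
  by (rule kernel_op_finite) (auto simp: finite_row)

lemma kernel_op_outside: "x \<notin> X \<Longrightarrow> T f x = 0"
  by (simp add: kernel_op_def)

lemma row_sum_le: "x \<in> X \<Longrightarrow> finite S \<Longrightarrow> S \<subseteq> X \<Longrightarrow> (\<Sum>y\<in>S. k x y) \<le> 1"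
proof -
  assume a: "x \<in> X" "finite S" "S \<subseteq> X"
  have "(\<Sum>y\<in>S. k x y) \<le> (\<Sum>y\<in>S \<union> {y \<in> X. k x y \<noteq> 0}. k x y)"
    using a by (intro sum_mono2) (auto simp: finite_row nonneg)
  also have "\<dots> = (\<Sum>y | y \<in> X \<and> k x y \<noteq> 0. k x y)"
    using a by (intro sum.mono_neutral_right) (auto simp: finite_row)
  finally show ?thesis using row_sum[OF a(1)] by linarith
qed

text \<open>Schur's test: Cauchy-Schwarz with \<open>k x y\<close> split into two square roots
  bounds the squared modulus of \<open>T f x\<close> by the sum of the squares of \<open>f\<close>
  weighted by row \<open>x\<close>. By symmetry the column sums are at most 1 as well, so summing
  over \<open>x\<close> gives a contraction.\<close>

lemma kernel_op_ell2:
  assumes f: "f \<in> ell2 X"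
  shows "T f \<in> ell2 X"
proof (rule ell2I_bounded(1)[where b="ell2_norm X f"])
  show "T f x = 0" if "x \<notin> X" for x using that by (rule kernel_op_outside)
  show "0 \<le> ell2_norm X f" by (rule ell2_norm_nonneg)
  fix S assume S: "finite S" "S \<subseteq> X"
  define S' where "S' = (\<Union>x\<in>S. {y \<in> X. k x y \<noteq> 0})"
  have S': "finite S'" "S' \<subseteq> X" using S finite_row by (auto simp: S'_def)
  have "(cmod (T f x))\<^sup>2 \<le> (\<Sum>y\<in>S'. k x y * (cmod (f y))\<^sup>2)" if x: "x \<in> S" for x
  proof -
    have xX: "x \<in> X" using x S by auto
    have nn: "k x y \<ge> 0" if "y \<in> S'" for y using nonneg that xX S' by auto
    have "T f x = (\<Sum>y\<in>S'. of_real (k x y) * f y)"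
      using x S S' by (intro kernel_op_finite) (auto simp: S'_def)
    then have "cmod (T f x) \<le> (\<Sum>y\<in>S'. cmod (of_real (k x y) * f y))" by (simp add: norm_sum)
    also have "\<dots> = (\<Sum>y\<in>S'. sqrt (k x y) * (sqrt (k x y) * cmod (f y)))"
      using nn by (intro sum.cong) (auto simp: norm_mult)
    finally have "(cmod (T f x))\<^sup>2 \<le> (\<Sum>y\<in>S'. sqrt (k x y) * (sqrt (k x y) * cmod (f y)))\<^sup>2"
      by (intro power_mono) auto
    also have "\<dots> \<le> (\<Sum>y\<in>S'. (sqrt (k x y))\<^sup>2) * (\<Sum>y\<in>S'. (sqrt (k x y) * cmod (f y))\<^sup>2)"
      by (rule Cauchy_Schwarz_ineq_sum)
    also have "\<dots> = (\<Sum>y\<in>S'. k x y) * (\<Sum>y\<in>S'. k x y * (cmod (f y))\<^sup>2)"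
      using nn by (simp add: power_mult_distrib)
    also have "\<dots> \<le> 1 * (\<Sum>y\<in>S'. k x y * (cmod (f y))\<^sup>2)"
      using nn row_sum_le[OF xX S'] by (intro mult_right_mono sum_nonneg) auto
    finally show ?thesis by simp
  qed
  then have "(\<Sum>x\<in>S. (cmod (T f x))\<^sup>2) \<le> (\<Sum>x\<in>S. \<Sum>y\<in>S'. k x y * (cmod (f y))\<^sup>2)"
    by (intro sum_mono)
  also have "\<dots> = (\<Sum>y\<in>S'. \<Sum>x\<in>S. k x y * (cmod (f y))\<^sup>2)" by (rule sum.swap)
  also have "\<dots> = (\<Sum>y\<in>S'. (\<Sum>x\<in>S. k y x) * (cmod (f y))\<^sup>2)"
    unfolding sum_distrib_right using sym S S' by (intro sum.cong refl) (metis subsetD)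
  also have "\<dots> \<le> (\<Sum>y\<in>S'. 1 * (cmod (f y))\<^sup>2)"
    using row_sum_le S S' by (intro sum_mono mult_right_mono) auto
  also have "\<dots> \<le> (ell2_norm X f)\<^sup>2" using ell2_finite_sum_le[OF f S'] by simp
  finally show "(\<Sum>x\<in>S. (cmod (T f x))\<^sup>2) \<le> (ell2_norm X f)\<^sup>2" .
qed

text \<open>\<open>T u\<close> lives on the finite neighbourhood \<open>S'\<close> of the support of
  \<open>u\<close>, so for every function \<open>f\<close> the claim is an exchange of two finite
  sums.\<close>

lemma kernel_op_symmetric:
  assumes u: "u \<in> finsupp X"
  shows "ell2_inner X (T f) u = ell2_inner X f (T u)"
proof -
  define S where "S = {x. u x \<noteq> 0}"
  have S: "finite S" "S \<subseteq> X" using u by (auto simp: S_def finsupp_def)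
  define S' where "S' = (\<Union>x\<in>S. {y \<in> X. k x y \<noteq> 0})"
  have S': "finite S'" "S' \<subseteq> X" using S finite_row by (auto simp: S'_def)
  have Tu: "T u y = (\<Sum>x\<in>S. of_real (k y x) * u x)" if "y \<in> X" for y
    using that S by (intro kernel_op_finite) (auto simp: S_def)
  have Tu0: "T u y = 0" if "y \<notin> S'" for y
  proof (cases "y \<in> X")
    case True
    then have "k y x = 0" if "x \<in> S" for x
      using that \<open>y \<notin> S'\<close> sym S by (auto simp: S'_def)
    then show ?thesis using True by (simp add: Tu)
  qed (simp add: kernel_op_outside)
  have "ell2_inner X (T f) u = (\<Sum>x\<in>S. T f x * cnj (u x))"
    using u by (simp add: ell2_inner_finsupp S_def)
  also have "\<dots> = (\<Sum>x\<in>S. (\<Sum>y\<in>S'. of_real (k x y) * f y) * cnj (u x))"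
  proof (intro sum.cong refl)
    fix x assume "x \<in> S"
    then have "T f x = (\<Sum>y\<in>S'. of_real (k x y) * f y)"
      using S S' by (intro kernel_op_finite) (auto simp: S'_def)
    then show "T f x * cnj (u x) = (\<Sum>y\<in>S'. of_real (k x y) * f y) * cnj (u x)" by simp
  qed
  also have "\<dots> = (\<Sum>y\<in>S'. \<Sum>x\<in>S. of_real (k x y) * f y * cnj (u x))"
    unfolding sum_distrib_right by (rule sum.swap)
  also have "\<dots> = (\<Sum>y\<in>S'. f y * cnj (T u y))"
  proof (intro sum.cong refl)
    fix y assume y: "y \<in> S'"
    then have "(\<Sum>x\<in>S. of_real (k x y) * f y * cnj (u x)) = (\<Sum>x\<in>S. of_real (k y x) * f y * cnj (u x))"
      using S S' by (intro sum.cong refl) (simp add: sym subset_iff)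
    also have "\<dots> = f y * cnj (T u y)"
      using y S' by (subst Tu) (auto simp: sum_distrib_left algebra_simps)
    finally show "(\<Sum>x\<in>S. of_real (k x y) * f y * cnj (u x)) = f y * cnj (T u y)" .
  qed
  also have "\<dots> = ell2_inner X f (T u)"
    using S' Tu0 by (subst ell2_inner_finite[of S']) auto
  finally show ?thesis .
qed

lemma kernel_op_diff_scale: "T (\<lambda>x. f x - c * g x) = (\<lambda>x. T f x - c * T g x)"
proof
  fix x show "T (\<lambda>x. f x - c * g x) x = T f x - c * T g x"
    by (cases "x \<in> X")
       (auto simp: kernel_op_row kernel_op_outside algebra_simps sum_subtractf sum_distrib_left)
qed

text \<open>Finite support is built in, since the final system must consist of such functions and
  inner products against them are finite sums.\<close>

definition eigenspace :: "complex \<Rightarrow> ('x \<Rightarrow> complex) set" where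
  "eigenspace c = {u \<in> finsupp X. T u = (\<lambda>x. c * u x)}"

lemma eigenspace_finsupp: "u \<in> eigenspace c \<Longrightarrow> u \<in> finsupp X"
  by (simp add: eigenspace_def)

lemma eigenfunction_iff_eigenspace:
  "u \<in> finsupp X \<Longrightarrow> eigenfunction X T c u \<longleftrightarrow> u \<in> eigenspace c \<and> u \<noteq> (\<lambda>x. 0)"
  by (auto simp: eigenfunction_def eigenspace_def finsupp_ell2)

lemma eigenspace_diff_scale:
  "u \<in> eigenspace c \<Longrightarrow> v \<in> eigenspace c \<Longrightarrow> (\<lambda>x. u x - a * v x) \<in> eigenspace c"
  by (auto simp: eigenspace_def finsupp_diff_scale kernel_op_diff_scale algebra_simps)

lemma eigenvalue_real:
  assumes "u \<in> eigenspace c" "u \<noteq> (\<lambda>x. 0)"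
  shows "cnj c = c"
proof -
  have u: "u \<in> finsupp X" "T u = (\<lambda>x. c * u x)" using assms by (auto simp: eigenspace_def)
  have "c * ell2_inner X u u = cnj c * ell2_inner X u u"
    using kernel_op_symmetric[OF u(1), of u] u
    by (simp add: ell2_inner_scale_left ell2_inner_scale_right)
  then show ?thesis using ell2_inner_self_eq_0[OF u(1)] assms by simp
qed

text \<open>On coefficients against eigenfunctions, \<open>T\<close> acts as multiplication by the
  eigenvalue. This drives both the orthogonality of eigenspaces and the inversion of
  \<open>T - c I\<close>.\<close>

lemma ell2_inner_kernel_op_eigen:
  assumes u: "u \<in> eigenspace c" "u \<noteq> (\<lambda>x. 0)"
  shows "ell2_inner X (T f) u = c * ell2_inner X f u"
proof -
  have u': "u \<in> finsupp X" "T u = (\<lambda>x. c * u x)" using u by (auto simp: eigenspace_def)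
  have "ell2_inner X (T f) u = cnj (ell2_inner X (\<lambda>x. c * u x) f)"
    using kernel_op_symmetric[OF u'(1), of f] u' ell2_inner_commute[of X f "\<lambda>x. c * u x"] by simp
  also have "ell2_inner X (\<lambda>x. c * u x) f = c * ell2_inner X u f"
    unfolding ell2_inner_def by (subst infsum_cmult_right'[symmetric]) (simp add: mult.assoc)
  also have "cnj (c * ell2_inner X u f) = cnj c * ell2_inner X f u"
    by (subst (2) ell2_inner_commute) simp
  finally show ?thesis using eigenvalue_real[OF u] by simp
qed

lemma eigenspaces_orthogonal:
  assumes "u \<in> eigenspace c" "v \<in> eigenspace d" "c \<noteq> d"
  shows "ell2_inner X u v = 0"
proof (cases "v = (\<lambda>x. 0)")
  case False
  have "c * ell2_inner X u v = d * ell2_inner X u v"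
    using ell2_inner_kernel_op_eigen[OF assms(2) False, of u] assms
    by (simp add: eigenspace_def ell2_inner_scale_left)
  then show ?thesis using assms(3) by simp
qed (simp add: ell2_inner_def)

end

section \<open>Orthonormal bases of finitely supported functions\<close>

text \<open>Restricting the support to the first \<open>n\<close> points of \<open>X\<close> filters \<open>V\<close> by subspaces each of
  codimension at most one in the next, and Gram-Schmidt adds at most one vector per step. A merely
  maximal orthonormal subset of \<open>V\<close> need not be total in \<open>V\<close>, as \<open>V\<close> is not complete.\<close>
lemma exists_orthonormal_basis:
  fixes V :: "('x \<Rightarrow> complex) set"
  assumes "countable X" and VX: "V \<subseteq> finsupp X" and V0: "(\<lambda>x. 0) \<in> V"
    and Vd: "\<And>u v a. u \<in> V \<Longrightarrow> v \<in> V \<Longrightarrow> (\<lambda>x. u x - a * v x) \<in> V"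
  shows "\<exists>U. U \<subseteq> V \<and> orthonormal X U \<and>
    (\<forall>f. (\<forall>u\<in>U. ell2_inner X f u = 0) \<longrightarrow> (\<forall>v\<in>V. ell2_inner X f v = 0))"
proof -
  define e where "e = to_nat_on X"
  have inj: "x = y" if "x \<in> X" "y \<in> X" "e x = e y" for x y
    using that assms(1) by (auto simp: e_def)
  define W where "W n = {v \<in> V. \<forall>x. v x \<noteq> 0 \<longrightarrow> e x < n}" for n
  have WV: "W n \<subseteq> V" for n by (auto simp: W_def)
  have W_mono: "W m \<subseteq> W n" if "m \<le> n" for m n using that by (auto simp: W_def intro: less_le_trans)
  have Wd: "(\<lambda>x. u x - a * v x) \<in> W n" if "u \<in> W n" "v \<in> W n" for u v a n
    using that Vd by (auto simp: W_def) (metis mult_zero_right diff_zero)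
  have Ws: "(\<lambda>x. a * v x) \<in> W n" if "v \<in> W n" for a v n
    using Wd[of "\<lambda>x. 0" n v "- a"] that V0 by (simp add: W_def)
  define Q where "Q n u \<longleftrightarrow> u \<in> W (Suc n) \<and> ell2_inner X u u = 1 \<and> (\<forall>v\<in>W n. ell2_inner X u v = 0)"
    for n u
  \<comment> \<open>\<open>e\<close> is injective on \<open>X\<close>, so supports in
    \<open>W (Suc n)\<close> have at most one point more than \<open>W n\<close> allows. The vector
    \<open>u\<close> is nonzero there, and a multiple of it clears that point.\<close>
  have decomp: "\<exists>a. (\<lambda>x. v x - a * u x) \<in> W n" if Q: "Q n u" and v: "v \<in> W (Suc n)" for n u v
  proof -
    have u: "u \<in> W (Suc n)" "u \<notin> W n" using Q by (auto simp: Q_def)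
    then obtain p where p: "u p \<noteq> 0" "\<not> e p < n" by (auto simp: W_def)
    then have ep: "e p = n" using u by (fastforce simp: W_def)
    let ?v = "\<lambda>x. v x - v p / u p * u x"
    have v': "?v \<in> W (Suc n)" using u v by (intro Wd)
    have supp: "x \<in> X" if "w x \<noteq> 0" "w \<in> W (Suc n)" for w x
      using that VX by (auto simp: W_def finsupp_def)
    have "e x < n" if x: "?v x \<noteq> 0" for x
    proof -
      have "e x < Suc n" using v' x by (auto simp: W_def)
      moreover have "e x \<noteq> n"
      proof
        assume "e x = n"
        then have "x = p" using inj ep supp[OF x v'] supp[OF p(1) u(1)] by auto
        then show False using x p by simp
      qed
      ultimately show ?thesis by simp
    qed
    then have "?v \<in> W n" using v' by (auto simp: W_def)
    then show ?thesis by blast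
  qed
  \<comment> \<open>Existence of the orthogonal projection onto \<open>W n\<close> is carried along
    the induction. The factor 1 gives the difference the shape \<open>f x - c * g x\<close> of the
    linearity lemmas.\<close>
  define proj where "proj n \<longleftrightarrow> (\<forall>w\<in>finsupp X. \<exists>v\<in>W n. \<forall>z\<in>W n. ell2_inner X (\<lambda>x. w x - 1 * v x) z = 0)" for n
  \<comment> \<open>The part of \<open>w\<close> orthogonal to \<open>W n\<close>, once normalised,
    would be a vector satisfying \<open>Q n\<close>.\<close>
  have stable: "W (Suc n) \<subseteq> W n" if P: "proj n" and nQ: "\<nexists>u. Q n u" for n
  proof (rule ccontr)
    assume "\<not> W (Suc n) \<subseteq> W n"
    then obtain w where w: "w \<in> W (Suc n)" "w \<notin> W n" by auto
    then have "w \<in> finsupp X" using WV VX by auto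
    then obtain v where v: "v \<in> W n" "\<forall>z\<in>W n. ell2_inner X (\<lambda>x. w x - 1 * v x) z = 0"
      using P unfolding proj_def by blast
    define d where "d = (\<lambda>x. w x - 1 * v x)"
    have d: "d \<in> W (Suc n)" unfolding d_def using w v W_mono[of n "Suc n"] by (intro Wd) auto
    then have dX: "d \<in> finsupp X" using WV VX by auto
    have d0: "d \<noteq> (\<lambda>x. 0)"
    proof
      assume "d = (\<lambda>x. 0)"
      then have "w = v" by (auto simp: d_def fun_eq_iff)
      then show False using v w by simp
    qed
    define r where "r = (\<Sum>x | d x \<noteq> 0. (cmod (d x))\<^sup>2)"
    have r: "ell2_inner X d d = of_real r" unfolding r_def by (rule ell2_inner_self_finsupp[OF dX])
    have "r \<noteq> 0" using r d0 ell2_inner_self_eq_0[OF dX] by auto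
    then have r0: "r > 0" by (simp add: r_def order_less_le sum_nonneg)
    define a where "a = complex_of_real (1 / sqrt r)"
    have aa: "a * cnj a * of_real r = 1"
      using r0 by (simp add: a_def flip: of_real_mult)
    let ?u = "\<lambda>x. a * d x"
    have uX: "?u \<in> finsupp X" using dX by (rule finsupp_scale)
    have "ell2_inner X ?u ?u = a * (cnj a * of_real r)"
      using uX dX by (simp add: ell2_inner_scale_left ell2_inner_scale_right r)
    moreover have "ell2_inner X ?u z = 0" if "z \<in> W n" for z
    proof -
      have "z \<in> finsupp X" using that WV VX by auto
      moreover have "ell2_inner X d z = 0" using v(2) that unfolding d_def by blast
      ultimately show ?thesis by (simp add: ell2_inner_scale_left)
    qed
    ultimately have "Q n ?u" using d aa by (auto simp: Q_def Ws mult.assoc)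
    then show False using nQ by blast
  qed
  have P: "proj n" for n
  proof (induction n)
    case 0
    show ?case unfolding proj_def
    proof (intro ballI bexI[of _ "\<lambda>x. 0"])
      fix z assume "z \<in> W 0"
      then have "z = (\<lambda>x. 0)" by (auto simp: W_def)
      then show "ell2_inner X (\<lambda>x. w x - 1 * 0) z = 0" for w by (simp add: ell2_inner_def)
    qed (simp add: W_def V0)
  next
    case (Suc n)
    show ?case
    proof (cases "\<exists>u. Q n u")
      case False
      then have "W (Suc n) = W n" using stable[OF Suc] W_mono[of n "Suc n"] by auto
      then show ?thesis using Suc by (simp add: proj_def)
    next
      case True
      then obtain u where u: "Q n u" by blast
      have uW: "u \<in> W (Suc n)" and uu: "ell2_inner X u u = 1"
        and un: "\<And>v. v \<in> W n \<Longrightarrow> ell2_inner X u v = 0" using u by (auto simp: Q_def)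
      have uX: "u \<in> finsupp X" using uW WV VX by auto
      show ?thesis unfolding proj_def
      proof
        fix w assume w: "w \<in> finsupp X"
        then obtain v where v: "v \<in> W n" "\<forall>z\<in>W n. ell2_inner X (\<lambda>x. w x - 1 * v x) z = 0"
          using Suc unfolding proj_def by blast
        define a where "a = ell2_inner X w u"
        \<comment> \<open>The projection onto the larger space adds the component along
          \<open>u\<close>. The double negation fits it to the closure property of
          \<open>V\<close>.\<close>
        define v' where "v' = (\<lambda>x. v x - (- a) * u x)"
        define h where "h = (\<lambda>x. w x - 1 * v x)"
        have v': "v' \<in> W (Suc n)" unfolding v'_def using v uW W_mono[of n "Suc n"] by (intro Wd) auto
        have h': "(\<lambda>x. w x - 1 * v' x) = (\<lambda>x. h x - a * u x)" by (auto simp: v'_def h_def)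
        have "ell2_inner X (\<lambda>x. h x - a * u x) z = 0" if z: "z \<in> W (Suc n)" for z
        proof -
          obtain b where b: "(\<lambda>x. z x - b * u x) \<in> W n" using decomp[OF u z] by blast
          define z0 where "z0 = (\<lambda>x. z x - b * u x)"
          have z0: "z0 \<in> W n" "z0 \<in> finsupp X" using b WV VX by (auto simp: z0_def)
          have z_eq: "z = (\<lambda>x. z0 x - (- b) * u x)" by (auto simp: z0_def)
          have "ell2_inner X v u = 0" using un[OF v(1)] ell2_inner_commute[of X v u] by simp
          then have 1: "ell2_inner X (\<lambda>x. h x - a * u x) u = 0"
            using uX unfolding h_def by (simp only: ell2_inner_diff_scale_left) (simp add: uu a_def)
          have 2: "ell2_inner X (\<lambda>x. h x - a * u x) z0 = 0"
          proof -
            have "ell2_inner X h z0 = 0" using z0 v(2) unfolding h_def by blast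
            then show ?thesis using z0(2) un[OF z0(1)] by (simp add: ell2_inner_diff_scale_left)
          qed
          show ?thesis
            unfolding z_eq by (subst ell2_inner_diff_scale_right[OF z0(2) uX]) (simp add: 1 2)
        qed
        then show "\<exists>v\<in>W (Suc n). \<forall>z\<in>W (Suc n). ell2_inner X (\<lambda>x. w x - 1 * v x) z = 0"
          using v' h' by (intro bexI[of _ v']) auto
      qed
    qed
  qed
  define b where "b n = (SOME u. Q n u)" for n
  define N where "N = {n. \<exists>u. Q n u}"
  have b: "Q n (b n)" if "n \<in> N" for n
    using that someI_ex[of "Q n"] by (auto simp: N_def b_def)
  have b_orth: "ell2_inner X (b n) (b m) = 0" if "m \<in> N" "n \<in> N" "m < n" for m n
    using b[OF that(1)] b[OF that(2)] W_mono[of "Suc m" n] that(3) by (auto simp: Q_def)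
  have b_orth': "ell2_inner X (b m) (b n) = (if m = n then 1 else 0)" if "m \<in> N" "n \<in> N" for m n
  proof (cases m n rule: linorder_cases)
    case less
    then show ?thesis using b_orth[OF that] ell2_inner_commute[of X "b m" "b n"] by simp
  next
    case equal
    then show ?thesis using b[OF that(1)] by (simp add: Q_def)
  next
    case greater
    then show ?thesis using b_orth[OF that(2,1)] by simp
  qed
  have bV: "b ` N \<subseteq> V" using b WV by (auto simp: Q_def)
  moreover have "orthonormal X (b ` N)"
    unfolding orthonormal_def
  proof (intro conjI ballI)
    show "b ` N \<subseteq> finsupp X" using bV VX by auto
    fix u v assume "u \<in> b ` N" "v \<in> b ` N"
    then obtain m n where mn: "m \<in> N" "n \<in> N" "u = b m" "v = b n" by auto
    have "m = n" if "b m = b n"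
      using b_orth'[OF mn(1,2)] b_orth'[OF mn(1,1)] that by (auto split: if_splits)
    then show "ell2_inner X u v = (if u = v then 1 else 0)"
      using mn b_orth'[OF mn(1,2)] by auto
  qed
  moreover have "\<forall>v\<in>V. ell2_inner X f v = 0" if f: "\<forall>u\<in>b ` N. ell2_inner X f u = 0" for f
  proof -
    have W0: "\<forall>v\<in>W n. ell2_inner X f v = 0" for n
    proof (induction n)
      case 0
      show ?case
      proof
        fix v assume "v \<in> W 0"
        then have "v = (\<lambda>x. 0)" by (auto simp: W_def)
        then show "ell2_inner X f v = 0" by (simp add: ell2_inner_def)
      qed
    next
      case (Suc n)
      show ?case
      proof (cases "n \<in> N")
        case False
        then show ?thesis using stable[OF P, of n] Suc by (auto simp: N_def)
      next
        case True
        show ?thesis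
        proof
          fix v assume v: "v \<in> W (Suc n)"
          obtain a where a: "(\<lambda>x. v x - a * b n x) \<in> W n" using decomp[OF b[OF True] v] by blast
          define z where "z = (\<lambda>x. v x - a * b n x)"
          have z: "z \<in> W n" "z \<in> finsupp X" using a WV VX by (auto simp: z_def)
          have v_eq: "v = (\<lambda>x. z x - (- a) * b n x)" by (auto simp: z_def)
          have "b n \<in> finsupp X" using bV VX True by auto
          then show "ell2_inner X f v = 0"
            unfolding v_eq using z Suc f True by (subst ell2_inner_diff_scale_right) auto
        qed
      qed
    qed
    show ?thesis
    proof
      fix v assume v: "v \<in> V"
      then have "finite (e ` {x. v x \<noteq> 0})" using VX by (auto simp: finsupp_def)
      then obtain n where "\<forall>i\<in>e ` {x. v x \<noteq> 0}. i < n" using finite_nat_set_iff_bounded by blast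
      then have "v \<in> W n" using v by (auto simp: W_def)
      then show "ell2_inner X f v = 0" using W0 by blast
    qed
  qed
  ultimately show ?thesis by blast
qed

section \<open>Total families of eigenfunctions and the spectrum\<close>

context symmetric_kernel
begin

text \<open>The first clause puts \<open>closure L\<close> into the spectrum, the second keeps
  everything else out of it.\<close>

definition eigen_total :: "complex set \<Rightarrow> bool" where
  "eigen_total L \<longleftrightarrow> (\<forall>c\<in>L. \<exists>u\<in>eigenspace c. u \<noteq> (\<lambda>x. 0)) \<and>
     (\<forall>f\<in>ell2 X. (\<forall>c\<in>L. \<forall>u\<in>eigenspace c. ell2_inner X f u = 0) \<longrightarrow> f = (\<lambda>x. 0))"

text \<open>Bases of distinct eigenspaces are mutually orthogonal, so their union is orthonormal. A
  function orthogonal to a basis is orthogonal to the whole eigenspace, hence completeness; for the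
  same reason a nontrivial eigenspace has a nonempty basis, so every element of \<open>L\<close> is
  represented.\<close>

lemma eigen_total_orthonormal_basis:
  assumes L: "eigen_total L"
  shows "\<exists>U. complete_orthonormal X U \<and> orthonormal X U \<and>
    (\<forall>u\<in>U. \<exists>c\<in>L. u \<in> eigenspace c \<and> u \<noteq> (\<lambda>x. 0)) \<and>
    (\<forall>c\<in>L. \<exists>u\<in>U. u \<in> eigenspace c \<and> u \<noteq> (\<lambda>x. 0))"
proof -
  have "\<exists>U. U \<subseteq> eigenspace c \<and> orthonormal X U \<and>
    (\<forall>f. (\<forall>u\<in>U. ell2_inner X f u = 0) \<longrightarrow> (\<forall>v\<in>eigenspace c. ell2_inner X f v = 0))" for c
    by (rule exists_orthonormal_basis)
       (auto simp: countable_X eigenspace_diff_scale eigenspace_finsupp,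
        auto simp: eigenspace_def finsupp_def kernel_op_def)
  then obtain U where U: "\<And>c. U c \<subseteq> eigenspace c" "\<And>c. orthonormal X (U c)"
    "\<And>c f v. (\<And>u. u \<in> U c \<Longrightarrow> ell2_inner X f u = 0) \<Longrightarrow> v \<in> eigenspace c \<Longrightarrow> ell2_inner X f v = 0"
    by metis
  define B where "B = (\<Union>c\<in>L. U c)"
  have nz: "u \<noteq> (\<lambda>x. 0)" if "u \<in> U c" for u c
  proof
    assume "u = (\<lambda>x. 0)"
    moreover have "ell2_inner X u u = 1" using U(2)[of c] that unfolding orthonormal_def by auto
    ultimately show False by (simp add: ell2_inner_def)
  qed
  have on: "orthonormal X B"
    unfolding orthonormal_def
  proof (intro conjI ballI)
    show "B \<subseteq> finsupp X" using U(1) eigenspace_finsupp by (auto simp: B_def)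
    fix u v assume "u \<in> B" "v \<in> B"
    then obtain c d where cd: "u \<in> U c" "v \<in> U d" by (auto simp: B_def)
    show "ell2_inner X u v = (if u = v then 1 else 0)"
    proof (cases "c = d")
      case True
      then show ?thesis using cd U(2)[of c] unfolding orthonormal_def by auto
    next
      case False
      have e: "u \<in> eigenspace c" "v \<in> eigenspace d" using U(1) cd by auto
      have "u \<noteq> v"
      proof
        assume "u = v"
        then have "ell2_inner X u u = 0" using eigenspaces_orthogonal[OF e False] by simp
        then show False using ell2_inner_self_eq_0[of u X] nz[OF cd(1)] e eigenspace_finsupp by auto
      qed
      then show ?thesis using eigenspaces_orthogonal[OF e False] by simp
    qed
  qed
  have compl: "f = (\<lambda>x. 0)" if "f \<in> ell2 X" "\<forall>u\<in>B. ell2_inner X f u = 0" for f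
  proof -
    have "\<forall>c\<in>L. \<forall>u\<in>eigenspace c. ell2_inner X f u = 0"
    proof (intro ballI)
      fix c u assume c: "c \<in> L" and u: "u \<in> eigenspace c"
      show "ell2_inner X f u = 0" using that(2) c by (intro U(3)[OF _ u]) (auto simp: B_def)
    qed
    then show ?thesis using L that(1) by (auto simp: eigen_total_def)
  qed
  have "complete_orthonormal X B"
    unfolding complete_orthonormal_def
  proof (intro conjI)
    show "B \<subseteq> ell2 X" using on finsupp_ell2 by (auto simp: orthonormal_def)
    show "\<forall>u\<in>B. \<forall>v\<in>B. ell2_inner X u v = (if u = v then 1 else 0)"
      using on unfolding orthonormal_def by blast
    show "\<forall>f\<in>ell2 X. (\<forall>u\<in>B. ell2_inner X f u = 0) \<longrightarrow> f = (\<lambda>x. 0)" using compl by blast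
  qed
  moreover have "\<forall>u\<in>B. \<exists>c\<in>L. u \<in> eigenspace c \<and> u \<noteq> (\<lambda>x. 0)" using U(1) nz by (auto simp: B_def)
  moreover have "\<exists>u\<in>B. u \<in> eigenspace c \<and> u \<noteq> (\<lambda>x. 0)" if c: "c \<in> L" for c
  proof -
    obtain v where v: "v \<in> eigenspace c" "v \<noteq> (\<lambda>x. 0)" using L c by (auto simp: eigen_total_def)
    have "U c \<noteq> {}"
    proof
      assume "U c = {}"
      then have "ell2_inner X v v = 0" using U(3)[of c v v] v by auto
      then show False using v ell2_inner_self_eq_0 eigenspace_finsupp by blast
    qed
    then show ?thesis using U(1)[of c] nz c by (auto simp: B_def)
  qed
  ultimately show ?thesis using on by blast
qed

text \<open>On an eigenfunction for \<open>l\<close> the operator \<open>T - c I\<close> is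
  multiplication by \<open>l - c\<close>, so a bounded inverse would keep \<open>c\<close> at a
  positive distance from \<open>L\<close>.\<close>

lemma eigen_total_subset_spectrum:
  assumes L: "eigen_total L"
  shows "closure L \<subseteq> op_spectrum X T"
proof
  fix c assume c: "c \<in> closure L"
  have False if B: "bounded_operator X B"
    "\<forall>f\<in>ell2 X. B (\<lambda>x. T f x - c * f x) = f \<and> (\<lambda>x. T (B f) x - c * B f x) = f" for B
  proof -
    obtain K where K: "\<forall>f\<in>ell2 X. ell2_norm X (B f) \<le> K * ell2_norm X f"
      using B(1) unfolding bounded_operator_def by blast
    \<comment> \<open>The bound \<open>K\<close> may be zero or negative, hence
      \<open>\<bar>K\<bar> + 1\<close>.\<close>
    have "1 / (\<bar>K\<bar> + 1) > 0" by simp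
    then obtain l where l: "l \<in> L" "dist l c < 1 / (\<bar>K\<bar> + 1)"
      using c closure_approachable by blast
    then obtain u where u: "u \<in> eigenspace l" "u \<noteq> (\<lambda>x. 0)" using L by (auto simp: eigen_total_def)
    have ue: "u \<in> ell2 X" using u eigenspace_finsupp finsupp_ell2 by blast
    have "(\<lambda>x. T u x - c * u x) = (\<lambda>x. (l - c) * u x)"
      using u by (auto simp: eigenspace_def algebra_simps)
    then have "u = B (\<lambda>x. (l - c) * u x)" using B(2) ue by metis
    also have "\<dots> = (\<lambda>x. (l - c) * B u x)" using B(1) ue unfolding bounded_operator_def by blast
    finally have u_eq: "u = (\<lambda>x. (l - c) * B u x)" .
    have "B u \<in> ell2 X" using B(1) ue unfolding bounded_operator_def by blast
    then have "ell2_norm X u = cmod (l - c) * ell2_norm X (B u)"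
      using ell2_scale(2)[of "B u" X "l - c"] u_eq by simp
    also have "\<dots> \<le> cmod (l - c) * (K * ell2_norm X u)"
      using K ue by (intro mult_left_mono) auto
    also have "\<dots> \<le> cmod (l - c) * ((\<bar>K\<bar> + 1) * ell2_norm X u)"
      by (intro mult_left_mono mult_right_mono) (auto simp: ell2_norm_nonneg)
    finally have le: "ell2_norm X u \<le> (cmod (l - c) * (\<bar>K\<bar> + 1)) * ell2_norm X u" by simp
    have "(ell2_norm X u)\<^sup>2 \<noteq> 0"
      using u ell2_inner_self_eq_0[of u X] ell2_inner_self_norm[of u X] eigenspace_finsupp[of u l]
      by (metis of_real_0)
    then have pos: "ell2_norm X u > 0" using ell2_norm_nonneg[of X u] by (simp add: order_less_le)
    have "cmod (l - c) * (\<bar>K\<bar> + 1) < 1"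
      using l(2) by (simp add: dist_norm pos_less_divide_eq add_nonneg_pos)
    then have "(cmod (l - c) * (\<bar>K\<bar> + 1)) * ell2_norm X u < 1 * ell2_norm X u"
      using pos by (intro mult_strict_right_mono)
    then show False using le by simp
  qed
  then show "c \<in> op_spectrum X T" unfolding op_spectrum_def by blast
qed

end

lemma infsum_finite_sum:
  fixes f :: "'i \<Rightarrow> 'u \<Rightarrow> complex"
  assumes "finite F" "\<And>i. i \<in> F \<Longrightarrow> f i summable_on U"
  shows "(\<Sum>\<^sub>\<infinity>u\<in>U. \<Sum>i\<in>F. f i u) = (\<Sum>i\<in>F. infsum (f i) U)"
proof -
  have "((\<lambda>u. \<Sum>i\<in>F. f i u) has_sum (\<Sum>i\<in>F. infsum (f i) U)) U"
    using assms by (induction F rule: finite_induct) (auto intro!: has_sum_add)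
  then show ?thesis by (rule infsumI)
qed

context symmetric_kernel
begin

text \<open>The resolvent at \<open>c\<close> is \<open>f \<mapsto> \<Sum>u. \<langle>f, u\<rangle> / (\<lambda>\<^sub>u - c) u\<close>, summed pointwise. As the \<open>u\<close> are
  finitely supported, its inner product with \<open>u\<close> is a finite sum of pointwise values, and all
  identities follow by comparing these coefficients.\<close>
lemma eigen_total_spectrum_subset:
  assumes L: "eigen_total L"
  shows "op_spectrum X T \<subseteq> closure L"
proof
  fix c assume c: "c \<in> op_spectrum X T"
  show "c \<in> closure L"
  proof (rule ccontr)
    assume "c \<notin> closure L"
    then obtain d where d: "d > 0" "\<And>l. l \<in> L \<Longrightarrow> d \<le> cmod (l - c)"
      unfolding closure_approachable dist_norm by (meson not_le)
    obtain U where U: "complete_orthonormal X U" "orthonormal X U"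
      "\<forall>u\<in>U. \<exists>c\<in>L. u \<in> eigenspace c \<and> u \<noteq> (\<lambda>x. 0)"
      using eigen_total_orthonormal_basis[OF L] by blast
    then obtain ev where ev: "\<And>u. u \<in> U \<Longrightarrow> ev u \<in> L"
      "\<And>u. u \<in> U \<Longrightarrow> u \<in> eigenspace (ev u)" "\<And>u. u \<in> U \<Longrightarrow> u \<noteq> (\<lambda>x. 0)"
      by metis
    have fin: "u \<in> finsupp X" if "u \<in> U" for u using U(2) that by (auto simp: orthonormal_def)
    have on: "ell2_inner X u v = (if u = v then 1 else 0)" if "u \<in> U" "v \<in> U" for u v
      using U(2) that by (auto simp: orthonormal_def)
    have evc: "d \<le> cmod (ev u - c)" if "u \<in> U" for u using d(2) ev(1) that by auto
    have evc0: "ev u - c \<noteq> 0" if "u \<in> U" for u using evc[OF that] d(1) by auto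
    \<comment> \<open>Square summable functions are determined by their coefficients; this turns
      operator identities into scalar ones.\<close>
    have ext: "f = g" if "f \<in> ell2 X" "g \<in> ell2 X" "\<And>u. u \<in> U \<Longrightarrow> ell2_inner X f u = ell2_inner X g u" for f g
    proof -
      have "(\<lambda>x. f x - 1 * g x) \<in> ell2 X" by (rule ell2_diff_scale[OF that(1,2)])
      moreover have "\<forall>u\<in>U. ell2_inner X (\<lambda>x. f x - 1 * g x) u = 0"
        using that(3) ell2_inner_diff_scale_left[OF fin, of _ f 1 g] by simp
      ultimately have "(\<lambda>x. f x - 1 * g x) = (\<lambda>x. 0)"
        using U(1) unfolding complete_orthonormal_def by blast
      then show ?thesis by (auto simp: fun_eq_iff)
    qed
    define a where "a f u = ell2_inner X f u / (ev u - c)" for f u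
    define B where "B f x = (\<Sum>\<^sub>\<infinity>u\<in>U. a f u * u x)" for f x
    have a_le: "cmod (a f u) \<le> cmod (ell2_inner X f u) / d" if "u \<in> U" for f u
      using evc[OF that] d(1) by (simp add: a_def norm_divide frac_le)
    have a_sq: "(\<Sum>u\<in>V. (cmod (a f u))\<^sup>2) \<le> (ell2_norm X f / d)\<^sup>2"
      if "f \<in> ell2 X" "finite V" "V \<subseteq> U" for f V
    proof -
      have "(\<Sum>u\<in>V. (cmod (a f u))\<^sup>2) \<le> (\<Sum>u\<in>V. (cmod (ell2_inner X f u) / d)\<^sup>2)"
        using a_le that by (intro sum_mono power_mono) auto
      also have "\<dots> = (\<Sum>u\<in>V. (cmod (ell2_inner X f u))\<^sup>2) / d\<^sup>2"
        by (simp add: power_divide sum_divide_distrib)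
      also have "\<dots> \<le> (ell2_norm X f)\<^sup>2 / d\<^sup>2"
        using bessel[OF U(2) that(2,3,1)] by (intro divide_right_mono) auto
      finally show ?thesis by (simp add: power_divide)
    qed
    \<comment> \<open>Bessel's inequality for the point mass at \<open>x\<close>. Combined with
      \<open>a_sq\<close> it makes the series for \<open>B f x\<close> absolutely summable.\<close>
    have u_sq: "(\<Sum>u\<in>V. (cmod (u x))\<^sup>2) \<le> 1" if "finite V" "V \<subseteq> U" for V x
    proof (cases "x \<in> X")
      case True
      let ?d = "\<lambda>y. of_bool (y = x) :: complex"
      have dX: "?d \<in> finsupp X" using True by (auto simp: finsupp_def)
      have "(\<Sum>u\<in>V. (cmod (u x))\<^sup>2) = (\<Sum>u\<in>V. (cmod (ell2_inner X ?d u))\<^sup>2)"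
        using fin that True by (intro sum.cong) (auto simp: ell2_inner_delta)
      also have "\<dots> \<le> (ell2_norm X ?d)\<^sup>2" using dX by (intro bessel[OF U(2) that] finsupp_ell2)
      also have "\<dots> = 1" by (simp add: ell2_norm_finsupp[OF dX])
      finally show ?thesis .
    next
      case False
      have "u x = 0" if "u \<in> V" for u using fin[of u] that \<open>V \<subseteq> U\<close> False by (auto simp: finsupp_def)
      then have "(\<Sum>u\<in>V. (cmod (u x))\<^sup>2) = 0" by (intro sum.neutral) simp
      then show ?thesis by simp
    qed
    have summ: "(\<lambda>u. a f u * u x) summable_on U" if f: "f \<in> ell2 X" for f x
    proof (rule abs_summable_summable, rule nonneg_bdd_above_summable_on)
      show "bdd_above (sum (\<lambda>u. norm (a f u * u x)) ` {F. F \<subseteq> U \<and> finite F})"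
      proof (rule bdd_aboveI2)
        fix V assume "V \<in> {F. F \<subseteq> U \<and> finite F}"
        then have V: "finite V" "V \<subseteq> U" by auto
        have "norm (a f u * u x) \<le> (cmod (a f u))\<^sup>2 + (cmod (u x))\<^sup>2" for u
        proof -
          have "2 * (cmod (a f u) * cmod (u x)) \<le> (cmod (a f u))\<^sup>2 + (cmod (u x))\<^sup>2"
            using sum_squares_bound[of "cmod (a f u)" "cmod (u x)"] by (simp add: mult.assoc)
          moreover have "0 \<le> cmod (a f u) * cmod (u x)" by simp
          ultimately show ?thesis unfolding norm_mult by linarith
        qed
        then have "(\<Sum>u\<in>V. norm (a f u * u x)) \<le> (\<Sum>u\<in>V. (cmod (a f u))\<^sup>2 + (cmod (u x))\<^sup>2)"
          by (intro sum_mono)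
        also have "\<dots> \<le> (ell2_norm X f / d)\<^sup>2 + 1"
          using a_sq[OF f V] u_sq[OF V, of x] by (simp add: sum.distrib)
        finally show "(\<Sum>u\<in>V. norm (a f u * u x)) \<le> (ell2_norm X f / d)\<^sup>2 + 1" .
      qed
    qed auto
    have B_outside: "B f x = 0" if "x \<notin> X" for f x
    proof -
      have "u x = 0" if "u \<in> U" for u using fin[OF that] \<open>x \<notin> X\<close> by (auto simp: finsupp_def)
      then show ?thesis unfolding B_def by (intro infsum_0) simp
    qed
    \<comment> \<open>Finite subsums satisfy the bound by Pythagoras. For a fixed finite
      \<open>S\<close> it passes to the limit, as only finitely many pointwise limits are
      involved.\<close>
    have B_bd: "(\<Sum>x\<in>S. (cmod (B f x))\<^sup>2) \<le> (ell2_norm X f / d)\<^sup>2"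
      if f: "f \<in> ell2 X" and S: "finite S" "S \<subseteq> X" for f S
    proof (rule tendsto_upperbound)
      show "((\<lambda>V. \<Sum>x\<in>S. (cmod (\<Sum>u\<in>V. a f u * u x))\<^sup>2) \<longlongrightarrow> (\<Sum>x\<in>S. (cmod (B f x))\<^sup>2))
          (finite_subsets_at_top U)"
        unfolding B_def by (intro tendsto_intros infsum_tendsto summ f)
      show "\<forall>\<^sub>F V in finite_subsets_at_top U.
          (\<Sum>x\<in>S. (cmod (\<Sum>u\<in>V. a f u * u x))\<^sup>2) \<le> (ell2_norm X f / d)\<^sup>2"
      proof (rule eventually_finite_subsets_at_top_weakI)
        fix V assume V: "finite V" "V \<subseteq> U"
        define S' where "S' = S \<union> (\<Union>u\<in>V. {x. u x \<noteq> 0})"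
        have S': "finite S'" "S' \<subseteq> X" using S V fin by (auto simp: S'_def finsupp_def)
        have "(\<Sum>x\<in>S. (cmod (\<Sum>u\<in>V. a f u * u x))\<^sup>2) \<le> (\<Sum>x\<in>S'. (cmod (\<Sum>u\<in>V. a f u * u x))\<^sup>2)"
          using S' by (intro sum_mono2) (auto simp: S'_def)
        also have "\<dots> = (\<Sum>u\<in>V. (cmod (a f u))\<^sup>2)"
          by (rule orthonormal_combination_norm[OF U(2) V S']) (auto simp: S'_def)
        also have "\<dots> \<le> (ell2_norm X f / d)\<^sup>2" by (rule a_sq[OF f V])
        finally show "(\<Sum>x\<in>S. (cmod (\<Sum>u\<in>V. a f u * u x))\<^sup>2) \<le> (ell2_norm X f / d)\<^sup>2" .
      qed
    qed simp
    have nn: "0 \<le> ell2_norm X f / d" for f using d(1) ell2_norm_nonneg by (intro divide_nonneg_pos)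
    have B_ell2: "B f \<in> ell2 X" "ell2_norm X (B f) \<le> ell2_norm X f / d" if "f \<in> ell2 X" for f
      using B_outside nn B_bd that by (auto intro!: ell2I_bounded[of X "B f" "ell2_norm X f / d"])
    have B_inner: "ell2_inner X (B f) v = a f v" if f: "f \<in> ell2 X" and v: "v \<in> U" for f v
    proof -
      have "ell2_inner X (B f) v = (\<Sum>x | v x \<noteq> 0. (\<Sum>\<^sub>\<infinity>u\<in>U. a f u * u x * cnj (v x)))"
        using fin[OF v] by (simp add: ell2_inner_finsupp B_def infsum_cmult_left')
      also have "\<dots> = (\<Sum>\<^sub>\<infinity>u\<in>U. \<Sum>x | v x \<noteq> 0. a f u * u x * cnj (v x))"
        by (rule infsum_finite_sum[symmetric])
           (use fin[OF v] in \<open>auto simp: finsupp_def intro!: summable_on_cmult_left summ f\<close>)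
      also have "\<dots> = (\<Sum>\<^sub>\<infinity>u\<in>U. a f u * ell2_inner X u v)"
        using fin[OF v] by (simp add: ell2_inner_finsupp sum_distrib_left mult.assoc)
      also have "\<dots> = (\<Sum>\<^sub>\<infinity>u\<in>{v}. a f u * ell2_inner X u v)"
        by (rule infsum_cong_neutral) (use v on in auto)
      also have "\<dots> = a f v" using on[OF v v] by simp
      finally show ?thesis .
    qed
    have "bounded_operator X B"
      unfolding bounded_operator_def
    proof (intro conjI ballI allI)
      show "B f \<in> ell2 X" if "f \<in> ell2 X" for f using that by (rule B_ell2)
      show "B (\<lambda>x. f x + g x) = (\<lambda>x. B f x + B g x)" if "f \<in> ell2 X" "g \<in> ell2 X" for f g
        using that fin
        by (intro ext ell2_add B_ell2)
           (auto simp: B_inner ell2_add ell2_inner_add_left a_def add_divide_distrib)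
      show "B (\<lambda>x. r * f x) = (\<lambda>x. r * B f x)" if "f \<in> ell2 X" for f r
        using that fin
        by (intro ext ell2_scale B_ell2) (auto simp: B_inner ell2_scale ell2_inner_scale_left a_def)
      show "\<exists>K. \<forall>f\<in>ell2 X. ell2_norm X (B f) \<le> K * ell2_norm X f"
        using B_ell2(2) by (intro exI[of _ "1 / d"]) auto
    qed
    moreover have "B (\<lambda>x. T f x - c * f x) = f" if f: "f \<in> ell2 X" for f
    proof (rule ext)
      have Tf: "(\<lambda>x. T f x - c * f x) \<in> ell2 X" using f by (intro ell2_diff_scale kernel_op_ell2)
      show "B (\<lambda>x. T f x - c * f x) \<in> ell2 X" by (rule B_ell2[OF Tf])
      show "f \<in> ell2 X" by (rule f)
      fix u assume u: "u \<in> U"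
      have "ell2_inner X (\<lambda>x. T f x - c * f x) u = (ev u - c) * ell2_inner X f u"
        using ell2_inner_kernel_op_eigen[OF ev(2,3)[OF u], of f] fin[OF u]
        by (simp add: ell2_inner_diff_scale_left algebra_simps)
      then show "ell2_inner X (B (\<lambda>x. T f x - c * f x)) u = ell2_inner X f u"
        using evc0[OF u] by (simp add: B_inner[OF Tf u] a_def)
    qed
    moreover have "(\<lambda>x. T (B f) x - c * B f x) = f" if f: "f \<in> ell2 X" for f
    proof (rule ext)
      show "(\<lambda>x. T (B f) x - c * B f x) \<in> ell2 X"
        using B_ell2[OF f] by (intro ell2_diff_scale kernel_op_ell2)
      show "f \<in> ell2 X" by (rule f)
      fix u assume u: "u \<in> U"
      have "ell2_inner X (\<lambda>x. T (B f) x - c * B f x) u = (ev u - c) * ell2_inner X (B f) u"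
        using ell2_inner_kernel_op_eigen[OF ev(2,3)[OF u], of "B f"] fin[OF u]
        by (simp add: ell2_inner_diff_scale_left algebra_simps)
      then show "ell2_inner X (\<lambda>x. T (B f) x - c * B f x) u = ell2_inner X f u"
        using evc0[OF u] by (simp add: B_inner[OF f u] a_def)
    qed
    ultimately show False using c unfolding op_spectrum_def by blast
  qed
qed

lemma eigen_total_spectrum: "eigen_total L \<Longrightarrow> op_spectrum X T = closure L"
  using eigen_total_subset_spectrum eigen_total_spectrum_subset by blast

text \<open>Eigenfunctions for nonzero eigenvalues live on \<open>A\<close>, so there are only finitely many of them up to
  linear dependence and the set of eigenvalues is closed.\<close>
lemma finite_rank_spectrum:
  assumes A: "finite A" "A \<subseteq> X" and k0: "\<And>x y. x \<notin> A \<Longrightarrow> k x y = 0"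
  shows "op_spectrum X T = {c. \<exists>u\<in>eigenspace c. u \<noteq> (\<lambda>x. 0)}"
proof -
  define L where "L = {c. \<exists>u\<in>eigenspace c. u \<noteq> (\<lambda>x. 0)}"
  have k0': "k x y = 0" if "y \<notin> A" "x \<in> X" "y \<in> X" for x y using k0[of y x] sym that by simp
  have T_A: "T f x = (if x \<in> A then \<Sum>y\<in>A. of_real (k x y) * f y else 0)" for f x
  proof (cases "x \<in> A")
    case True
    then show ?thesis using A k0' by (subst kernel_op_finite[of x A]) auto
  next
    case False
    then show ?thesis using k0 by (simp add: kernel_op_def)
  qed
  have total: "eigen_total L"
    unfolding eigen_total_def
  proof (intro conjI ballI impI)
    show "\<exists>u\<in>eigenspace c. u \<noteq> (\<lambda>x. 0)" if "c \<in> L" for c using that by (simp add: L_def)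
    fix f assume f: "f \<in> ell2 X" and orth: "\<forall>c\<in>L. \<forall>u\<in>eigenspace c. ell2_inner X f u = 0"
    have orth': "ell2_inner X f u = 0" if "u \<in> eigenspace c" for c u
    proof (cases "u = (\<lambda>x. 0)")
      case False
      then show ?thesis using orth that by (auto simp: L_def)
    qed (simp add: ell2_inner_def)
    show "f = (\<lambda>x. 0)"
    proof
      fix x
      show "f x = 0"
      proof (rule ccontr)
        assume fx: "f x \<noteq> 0"
        then have xX: "x \<in> X" using ell2_zero_outside[OF f] by auto
        show False
        proof (cases "x \<in> A")
          case False
          \<comment> \<open>Point masses off \<open>A\<close> lie in the kernel of \<open>T\<close>,
            so orthogonality to the eigenvalue 0 determines \<open>f\<close> there.\<close>
          let ?d = "\<lambda>y. of_bool (y = x) :: complex"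
          have dX: "?d \<in> finsupp X" using xX by (auto simp: finsupp_def)
          have "T ?d = (\<lambda>y. 0 * ?d y)" using False by (auto simp: T_A fun_eq_iff intro!: sum.neutral)
          then have "ell2_inner X f ?d = 0" using dX by (intro orth'[of _ 0]) (simp add: eigenspace_def)
          then show False
            using ell2_inner_commute[of X f ?d] fx ell2_inner_finsupp[OF dX, of f] by simp
        next
          case True
          have "\<exists>\<phi> c. (\<forall>x. x \<notin> A \<longrightarrow> \<phi> x = 0) \<and> (\<forall>x\<in>A. (\<Sum>y\<in>A. of_real (k x y) * \<phi> y) = c * \<phi> x) \<and>
              (\<Sum>x\<in>A. f x * cnj (\<phi> x)) \<noteq> 0"
            by (rule exists_nonorthogonal_eigenvector[where k=k and \<psi>=f, OF A(1) _ True])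
               (use fx A sym in auto)
          then obtain \<phi> c where phi: "\<And>x. x \<notin> A \<Longrightarrow> \<phi> x = 0"
            "\<And>x. x \<in> A \<Longrightarrow> (\<Sum>y\<in>A. of_real (k x y) * \<phi> y) = c * \<phi> x" "(\<Sum>x\<in>A. f x * cnj (\<phi> x)) \<noteq> 0"
            by blast
          have "\<phi> \<in> finsupp X"
            using phi(1) A by (auto simp: finsupp_def intro: finite_subset[of _ A])
          then have "\<phi> \<in> eigenspace c" using phi by (auto simp: eigenspace_def T_A fun_eq_iff)
          then have "ell2_inner X f \<phi> = 0" by (rule orth')
          then show False using phi A by (subst (asm) ell2_inner_finite[of A]) auto
        qed
      qed
    qed
  qed
  have "finite L"
  proof (rule ccontr)
    assume "infinite L"
    then have "infinite (L - {0})" by simp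
    then obtain I where I: "I \<subseteq> L - {0}" "finite I" "card I = Suc (card A)"
      using infinite_arbitrarily_large by metis
    then have "\<forall>c\<in>I. \<exists>u. u \<in> eigenspace c \<and> u \<noteq> (\<lambda>x. 0)" by (auto simp: L_def)
    then obtain w where w: "\<And>c. c \<in> I \<Longrightarrow> w c \<in> eigenspace c" "\<And>c. c \<in> I \<Longrightarrow> w c \<noteq> (\<lambda>x. 0)"
      by metis
    have wA: "w c x = 0" if "c \<in> I" "x \<notin> A" for c x
    proof -
      have "T (w c) x = c * w c x" using w(1)[OF that(1)] by (simp add: eigenspace_def)
      then show ?thesis using that I by (auto simp: T_A)
    qed
    have in_A: "ell2_inner X f (w c) = (\<Sum>x\<in>A. f x * cnj (w c x))" if "c \<in> I" for c f
      using A wA that by (intro ell2_inner_finite) auto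
    obtain a where a: "\<exists>c\<in>I. a c \<noteq> 0" "\<forall>x\<in>A. (\<Sum>c\<in>I. a c * w c x) = 0"
      using exists_linear_relation[OF A(1) I(2), of w] I(3) by auto
    then obtain c where c: "c \<in> I" "a c \<noteq> 0" by blast
    have "0 = (\<Sum>x\<in>A. (\<Sum>b\<in>I. a b * w b x) * cnj (w c x))" using a by simp
    also have "\<dots> = (\<Sum>b\<in>I. a b * ell2_inner X (w b) (w c))"
      by (simp add: in_A[OF c(1)] sum_distrib_left sum_distrib_right sum.swap[of _ A] mult.assoc)
    also have "\<dots> = (\<Sum>b\<in>I. if b = c then a b * ell2_inner X (w b) (w c) else 0)"
      using eigenspaces_orthogonal[OF w(1) w(1)] c by (intro sum.cong) auto
    also have "\<dots> = a c * ell2_inner X (w c) (w c)" using I c by simp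
    finally have "ell2_inner X (w c) (w c) = 0" using c by simp
    then show False
      using ell2_inner_self_eq_0[of "w c" X] w[OF c(1)] eigenspace_finsupp by blast
  qed
  then have "closed L" by (rule finite_imp_closed)
  then show ?thesis using eigen_total_spectrum[OF total] by (simp add: L_def)
qed

end

section \<open>The lamplighter group\<close>

lemma integral_pair_pmf_finite:
  fixes f :: "'a \<times> 'b \<Rightarrow> complex"
  assumes "finite (set_pmf a)" "finite (set_pmf b)"
  shows "measure_pmf.expectation (pair_pmf a b) f =
    measure_pmf.expectation a (\<lambda>x. measure_pmf.expectation b (\<lambda>y. f (x, y)))"
proof -
  have "measure_pmf.expectation (pair_pmf a b) f =
      (\<Sum>z\<in>set_pmf a \<times> set_pmf b. pmf (pair_pmf a b) z *\<^sub>R f z)"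
    using assms by (intro integral_measure_pmf) auto
  also have "\<dots> = (\<Sum>x\<in>set_pmf a. \<Sum>y\<in>set_pmf b. pmf (pair_pmf a b) (x, y) *\<^sub>R f (x, y))"
    by (subst sum.cartesian_product) simp
  also have "\<dots> = (\<Sum>x\<in>set_pmf a. pmf a x *\<^sub>R (\<Sum>y\<in>set_pmf b. pmf b y *\<^sub>R f (x, y)))"
    by (simp add: pmf_pair scaleR_sum_right)
  also have "\<dots> = measure_pmf.expectation a (\<lambda>x. measure_pmf.expectation b (\<lambda>y. f (x, y)))"
    using assms by (simp add: integral_measure_pmf[of "set_pmf a"] integral_measure_pmf[of "set_pmf b"])
  finally show ?thesis .
qed

lemma integral_conv_pmf_finite:
  fixes f :: "'a \<Rightarrow> complex"
  assumes "finite (set_pmf a)" "finite (set_pmf b)"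
  shows "measure_pmf.expectation (conv_pmf K a b) f =
    measure_pmf.expectation a (\<lambda>x. measure_pmf.expectation b (\<lambda>y. f (x \<otimes>\<^bsub>K\<^esub> y)))"
  by (simp add: conv_pmf_def integral_pair_pmf_finite[OF assms])

lemma expectation_pmf_of_set:
  fixes f :: "'a \<Rightarrow> complex"
  assumes "finite A" "A \<noteq> {}"
  shows "measure_pmf.expectation (pmf_of_set A) f = (\<Sum>x\<in>A. f x) / of_nat (card A)"
  using assms
  by (subst integral_measure_pmf[of A])
     (auto simp: scaleR_conv_of_real sum_divide_distrib)

lemma sum_mult_swap:
  fixes c :: "'b \<Rightarrow> complex"
  shows "(\<Sum>h\<in>A. \<Sum>g\<in>B. c g * f g h) / N = (\<Sum>g\<in>B. c g * ((\<Sum>h\<in>A. f g h) / N))"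
  by (subst sum.swap) (simp add: sum_distrib_left sum_divide_distrib)

context group
begin

lemma conv_pmf_carrier:
  "set_pmf a \<subseteq> carrier G \<Longrightarrow> set_pmf b \<subseteq> carrier G \<Longrightarrow> set_pmf (conv_pmf G a b) \<subseteq> carrier G"
  by (auto simp: conv_pmf_def)

lemma conv_pmf_assoc:
  assumes "set_pmf a \<subseteq> carrier G" "set_pmf b \<subseteq> carrier G" "set_pmf c \<subseteq> carrier G"
  shows "conv_pmf G (conv_pmf G a b) c = conv_pmf G a (conv_pmf G b c)"
proof -
  have "conv_pmf G (conv_pmf G a b) c =
      bind_pmf a (\<lambda>x. bind_pmf b (\<lambda>y. bind_pmf c (\<lambda>z. return_pmf ((x \<otimes> y) \<otimes> z))))"
    by (simp add: conv_pmf_def map_pmf_def pair_pmf_def bind_assoc_pmf bind_return_pmf)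
  also have "\<dots> = bind_pmf a (\<lambda>x. bind_pmf b (\<lambda>y. bind_pmf c (\<lambda>z. return_pmf (x \<otimes> (y \<otimes> z)))))"
    using assms by (intro bind_pmf_cong refl) (simp add: m_assoc subset_iff)
  also have "\<dots> = conv_pmf G a (conv_pmf G b c)"
    by (simp add: conv_pmf_def map_pmf_def pair_pmf_def bind_assoc_pmf bind_return_pmf)
  finally show ?thesis .
qed

lemma map_inv_conv_pmf:
  assumes "set_pmf a \<subseteq> carrier G" "set_pmf b \<subseteq> carrier G"
  shows "map_pmf (m_inv G) (conv_pmf G a b) = conv_pmf G (map_pmf (m_inv G) b) (map_pmf (m_inv G) a)"
proof -
  have "map_pmf (m_inv G) (conv_pmf G a b) =
      bind_pmf a (\<lambda>x. bind_pmf b (\<lambda>y. return_pmf (inv (x \<otimes> y))))"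
    by (simp add: conv_pmf_def map_pmf_def pair_pmf_def bind_assoc_pmf bind_return_pmf)
  also have "\<dots> = bind_pmf a (\<lambda>x. bind_pmf b (\<lambda>y. return_pmf (inv y \<otimes> inv x)))"
    using assms by (intro bind_pmf_cong refl) (simp add: inv_mult_group subset_iff)
  also have "\<dots> = bind_pmf b (\<lambda>y. bind_pmf a (\<lambda>x. return_pmf (inv y \<otimes> inv x)))"
    by (rule bind_commute_pmf)
  also have "\<dots> = conv_pmf G (map_pmf (m_inv G) b) (map_pmf (m_inv G) a)"
    by (simp add: conv_pmf_def map_pmf_def pair_pmf_def bind_assoc_pmf bind_return_pmf)
  finally show ?thesis .
qed

text \<open>Symmetry as invariance of the measure under inversion is the form compatible with
  convolution; the pointwise form is the one used for kernels.\<close>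

lemma symmetric_pmf_iff:
  assumes a: "set_pmf a \<subseteq> carrier G"
  shows "map_pmf (m_inv G) a = a \<longleftrightarrow> (\<forall>x\<in>carrier G. pmf a (inv x) = pmf a x)"
proof
  assume *: "map_pmf (m_inv G) a = a"
  have inj: "inj_on (m_inv G) (set_pmf a)" using a by (meson inj_on_subset inv_inj)
  have 1: "pmf a (inv x) = pmf a x" if "x \<in> set_pmf a" for x
    using pmf_map_inj[OF inj that] * by simp
  show "\<forall>x\<in>carrier G. pmf a (inv x) = pmf a x"
  proof
    fix x assume x: "x \<in> carrier G"
    show "pmf a (inv x) = pmf a x"
    proof (cases "inv x \<in> set_pmf a \<or> x \<in> set_pmf a")
      case True
      then show ?thesis using 1[of x] 1[of "inv x"] x by auto
    next
      case False
      then show ?thesis by (simp add: set_pmf_iff)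
    qed
  qed
next
  assume *: "\<forall>x\<in>carrier G. pmf a (inv x) = pmf a x"
  have inj: "inj_on (m_inv G) (set_pmf a)" using a by (meson inj_on_subset inv_inj)
  have inv: "inv x \<in> set_pmf a" if "x \<in> set_pmf a" for x
    using * a that by (auto simp: set_pmf_iff)
  show "map_pmf (m_inv G) a = a"
  proof (rule pmf_eqI)
    fix x
    show "pmf (map_pmf (m_inv G) a) x = pmf a x"
    proof (cases "x \<in> set_pmf a")
      case True
      then have "pmf (map_pmf (m_inv G) a) (inv (inv x)) = pmf a (inv x)"
        by (intro pmf_map_inj[OF inj] inv)
      then show ?thesis using * a True by (auto simp: subset_iff)
    next
      case False
      moreover have "x \<notin> m_inv G ` set_pmf a" using False inv a by auto
      ultimately show ?thesis by (metis pmf_eq_0_set_pmf set_map_pmf)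
    qed
  qed
qed

text \<open>The substitution \<open>y = w \<otimes> z\<close> leaves the weight at the inverse of
  \<open>z\<close>. Symmetry of the measure replaces it by the weight at \<open>z\<close>, and the
  convolution becomes the expectation after one step from \<open>w\<close>.\<close>

lemma right_conv_op_eq:
  assumes a: "set_pmf a \<subseteq> carrier G" "finite (set_pmf a)"
    and sym: "\<And>x. x \<in> carrier G \<Longrightarrow> pmf a (inv x) = pmf a x" and w: "w \<in> carrier G"
  shows "right_conv_op G a F w = measure_pmf.expectation a (\<lambda>z. F (w \<otimes> z))"
proof -
  have "right_conv_op G a F w = (\<Sum>\<^sub>\<infinity>y\<in>carrier G. F y * of_real (pmf a (inv y \<otimes> w)))"
    using w by (simp add: right_conv_op_def)
  also have "\<dots> = (\<Sum>\<^sub>\<infinity>z\<in>carrier G. F (w \<otimes> z) * of_real (pmf a z))"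
  proof (rule infsum_reindex_bij_betw[symmetric, of "\<lambda>z. w \<otimes> z", THEN trans])
    show "bij_betw (\<lambda>z. w \<otimes> z) (carrier G) (carrier G)"
      by (rule bij_betw_byWitness[of _ "\<lambda>y. inv w \<otimes> y"]) (use w in \<open>auto simp flip: m_assoc\<close>)
    have "pmf a (inv (w \<otimes> z) \<otimes> w) = pmf a z" if z: "z \<in> carrier G" for z
    proof -
      have "inv (w \<otimes> z) \<otimes> w = inv z" using w z by (simp add: inv_mult_group m_assoc)
      then show ?thesis using sym z by simp
    qed
    then show "(\<Sum>\<^sub>\<infinity>z\<in>carrier G. F (w \<otimes> z) * of_real (pmf a (inv (w \<otimes> z) \<otimes> w))) =
        (\<Sum>\<^sub>\<infinity>z\<in>carrier G. F (w \<otimes> z) * of_real (pmf a z))"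
      by (intro infsum_cong) simp
  qed
  also have "\<dots> = (\<Sum>\<^sub>\<infinity>z\<in>set_pmf a. F (w \<otimes> z) * of_real (pmf a z))"
    using a by (intro infsum_cong_neutral) (auto simp: set_pmf_iff)
  also have "\<dots> = measure_pmf.expectation a (\<lambda>z. F (w \<otimes> z))"
    using a by (simp add: integral_measure_pmf[of "set_pmf a"] scaleR_conv_of_real mult.commute)
  finally show ?thesis .
qed

lemma right_conv_symmetric_kernel:
  assumes a: "set_pmf a \<subseteq> carrier G" "finite (set_pmf a)" and "countable (carrier G)"
    and sym: "\<And>x. x \<in> carrier G \<Longrightarrow> pmf a (inv x) = pmf a x"
  shows "symmetric_kernel (carrier G) (\<lambda>x y. pmf a (inv y \<otimes> x))"
proof
  show "countable (carrier G)" by fact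
  show "pmf a (inv y \<otimes> x) = pmf a (inv x \<otimes> y)" if "x \<in> carrier G" "y \<in> carrier G" for x y
    using sym[of "inv y \<otimes> x"] that by (simp add: inv_mult_group)
  show fin: "finite {y \<in> carrier G. pmf a (inv y \<otimes> x) \<noteq> 0}" if x: "x \<in> carrier G" for x
  proof (rule finite_subset)
    show "{y \<in> carrier G. pmf a (inv y \<otimes> x) \<noteq> 0} \<subseteq> (\<lambda>z. x \<otimes> inv z) ` set_pmf a"
    proof
      fix y assume "y \<in> {y \<in> carrier G. pmf a (inv y \<otimes> x) \<noteq> 0}"
      then have y: "y \<in> carrier G" "inv y \<otimes> x \<in> set_pmf a" by (auto simp: set_pmf_iff)
      then have "y = x \<otimes> inv (inv y \<otimes> x)" using x by (simp add: inv_mult_group flip: m_assoc)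
      then show "y \<in> (\<lambda>z. x \<otimes> inv z) ` set_pmf a" using y by blast
    qed
  qed (use a in simp)
  show "(\<Sum>y | y \<in> carrier G \<and> pmf a (inv y \<otimes> x) \<noteq> 0. pmf a (inv y \<otimes> x)) \<le> 1" if x: "x \<in> carrier G" for x
  proof -
    let ?Y = "{y. y \<in> carrier G \<and> pmf a (inv y \<otimes> x) \<noteq> 0}"
    have "inj_on (\<lambda>y. inv y \<otimes> x) ?Y" using x by (auto simp: inj_on_def) (metis inv_inv)
    then have "(\<Sum>y\<in>?Y. pmf a (inv y \<otimes> x)) = (\<Sum>z\<in>(\<lambda>y. inv y \<otimes> x) ` ?Y. pmf a z)"
      by (simp add: sum.reindex)
    also have "\<dots> = measure (measure_pmf a) ((\<lambda>y. inv y \<otimes> x) ` ?Y)"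
      using fin[OF x] by (simp add: measure_measure_pmf_finite)
    finally show ?thesis by simp
  qed
qed simp

end

section \<open>The group law and the walk on the lamplighter group\<close>

locale lamplighter_walk = G: group G + H: group H
  for G :: "('g, 'm) monoid_scheme" and H :: "('h, 'n) monoid_scheme" +
  fixes \<mu> :: "'g pmf"
  assumes finite_H: "finite (carrier H)" and order_H: "order H \<ge> 2"
    and supp_G: "set_pmf \<mu> \<subseteq> carrier G" and finite_supp: "finite (set_pmf \<mu>)"
    and generates: "generate G (set_pmf \<mu>) = carrier G"
    and sym_mu: "\<And>x. x \<in> carrier G \<Longrightarrow> pmf \<mu> (inv\<^bsub>G\<^esub> x) = pmf \<mu> x"
begin

abbreviation configs where "configs \<equiv> carrier (lamp_configs H G)"
abbreviation K where "K \<equiv> lamplighter H G"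
abbreviation lamp where "lamp \<equiv> embed_lamp H G"
abbreviation base where "base \<equiv> embed_base H G"

lemma configs_iff:
  "\<eta> \<in> configs \<longleftrightarrow> \<eta> \<in> carrier G \<rightarrow>\<^sub>E carrier H \<and> finite {x \<in> carrier G. \<eta> x \<noteq> \<one>\<^bsub>H\<^esub>}"
  by (simp add: lamp_configs_def carrier_sum_group H.is_group)

lemma configs_closed: "\<eta> \<in> configs \<Longrightarrow> x \<in> carrier G \<Longrightarrow> \<eta> x \<in> carrier H"
  by (auto simp: configs_iff PiE_iff)

lemma configs_outside: "\<eta> \<in> configs \<Longrightarrow> x \<notin> carrier G \<Longrightarrow> \<eta> x = undefined"
  by (auto simp: configs_iff PiE_iff extensional_def)

lemma configs_update: "\<eta> \<in> configs \<Longrightarrow> x \<in> carrier G \<Longrightarrow> h \<in> carrier H \<Longrightarrow> \<eta>(x := h) \<in> configs"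
  by (auto simp: configs_iff PiE_iff extensional_def
      intro: finite_subset[of _ "insert x {x \<in> carrier G. \<eta> x \<noteq> \<one>\<^bsub>H\<^esub>}"])

lemma carrier_K: "carrier K = configs \<times> carrier G"
  by (simp add: lamplighter_def)

lemma mult_K: "(\<eta>, x) \<otimes>\<^bsub>K\<^esub> (\<zeta>, y) =
    ((\<lambda>z\<in>carrier G. \<eta> z \<otimes>\<^bsub>H\<^esub> \<zeta> (inv\<^bsub>G\<^esub> x \<otimes>\<^bsub>G\<^esub> z)), x \<otimes>\<^bsub>G\<^esub> y)"
  by (auto simp: lamplighter_def lamp_configs_def translate_def fun_eq_iff)

lemma one_K: "\<one>\<^bsub>K\<^esub> = ((\<lambda>z\<in>carrier G. \<one>\<^bsub>H\<^esub>), \<one>\<^bsub>G\<^esub>)"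
  by (simp add: lamplighter_def lamp_configs_def)

lemma finite_translate:
  assumes "x \<in> carrier G" "finite {z \<in> carrier G. P z}"
  shows "finite {z \<in> carrier G. P (inv\<^bsub>G\<^esub> x \<otimes>\<^bsub>G\<^esub> z)}"
proof (rule finite_subset)
  show "{z \<in> carrier G. P (inv\<^bsub>G\<^esub> x \<otimes>\<^bsub>G\<^esub> z)} \<subseteq> (\<lambda>z. x \<otimes>\<^bsub>G\<^esub> z) ` {z \<in> carrier G. P z}"
  proof
    fix z assume z: "z \<in> {z \<in> carrier G. P (inv\<^bsub>G\<^esub> x \<otimes>\<^bsub>G\<^esub> z)}"
    then have "z = x \<otimes>\<^bsub>G\<^esub> (inv\<^bsub>G\<^esub> x \<otimes>\<^bsub>G\<^esub> z)" using assms by (simp flip: G.m_assoc)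
    then show "z \<in> (\<lambda>z. x \<otimes>\<^bsub>G\<^esub> z) ` {z \<in> carrier G. P z}" using z assms by blast
  qed
qed (use assms in simp)

lemma group_K: "group K"
proof (rule groupI)
  fix w v assume "w \<in> carrier K" "v \<in> carrier K"
  then obtain \<eta> x \<zeta> y where w: "w = (\<eta>, x)" "\<eta> \<in> configs" "x \<in> carrier G"
    and v: "v = (\<zeta>, y)" "\<zeta> \<in> configs" "y \<in> carrier G" by (auto simp: carrier_K)
  have "finite ({z \<in> carrier G. \<eta> z \<noteq> \<one>\<^bsub>H\<^esub>} \<union> {z \<in> carrier G. \<zeta> (inv\<^bsub>G\<^esub> x \<otimes>\<^bsub>G\<^esub> z) \<noteq> \<one>\<^bsub>H\<^esub>})"
    using w v finite_translate[of x "\<lambda>z. \<zeta> z \<noteq> \<one>\<^bsub>H\<^esub>"] by (auto simp: configs_iff)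
  then have "finite {z \<in> carrier G. \<eta> z \<otimes>\<^bsub>H\<^esub> \<zeta> (inv\<^bsub>G\<^esub> x \<otimes>\<^bsub>G\<^esub> z) \<noteq> \<one>\<^bsub>H\<^esub>}"
    by (rule rev_finite_subset) auto
  then show "w \<otimes>\<^bsub>K\<^esub> v \<in> carrier K"
    using w v by (auto simp: mult_K carrier_K configs_iff[of "restrict _ _"] configs_closed cong: conj_cong)
next
  show "\<one>\<^bsub>K\<^esub> \<in> carrier K" by (auto simp: one_K carrier_K configs_iff cong: conj_cong)
next
  fix w v u assume "w \<in> carrier K" "v \<in> carrier K" "u \<in> carrier K"
  then show "(w \<otimes>\<^bsub>K\<^esub> v) \<otimes>\<^bsub>K\<^esub> u = w \<otimes>\<^bsub>K\<^esub> (v \<otimes>\<^bsub>K\<^esub> u)"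
    by (auto simp: carrier_K mult_K fun_eq_iff configs_closed H.m_assoc G.m_assoc G.inv_mult_group)
next
  fix w assume "w \<in> carrier K"
  then obtain \<eta> x where w: "w = (\<eta>, x)" "\<eta> \<in> configs" "x \<in> carrier G" by (auto simp: carrier_K)
  show "\<one>\<^bsub>K\<^esub> \<otimes>\<^bsub>K\<^esub> w = w"
    using w by (auto simp: one_K mult_K fun_eq_iff configs_closed configs_outside)
  \<comment> \<open>Translation by the inverse of \<open>x\<close> carries the lamp at
    \<open>x \<otimes> z\<close> to \<open>z\<close>, so the inverse must cancel it at
    \<open>z\<close>.\<close>
  let ?v = "(\<lambda>z\<in>carrier G. inv\<^bsub>H\<^esub> (\<eta> (x \<otimes>\<^bsub>G\<^esub> z)), inv\<^bsub>G\<^esub> x)"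
  have "finite {z \<in> carrier G. \<eta> (x \<otimes>\<^bsub>G\<^esub> z) \<noteq> \<one>\<^bsub>H\<^esub>}"
    using w finite_translate[of "inv\<^bsub>G\<^esub> x" "\<lambda>z. \<eta> z \<noteq> \<one>\<^bsub>H\<^esub>"] by (auto simp: configs_iff)
  then have "finite {z \<in> carrier G. inv\<^bsub>H\<^esub> (\<eta> (x \<otimes>\<^bsub>G\<^esub> z)) \<noteq> \<one>\<^bsub>H\<^esub>}"
    by (rule rev_finite_subset) auto
  then have "?v \<in> carrier K"
    using w by (auto simp: carrier_K configs_iff[of "restrict _ _"] configs_closed cong: conj_cong)
  moreover have "?v \<otimes>\<^bsub>K\<^esub> w = \<one>\<^bsub>K\<^esub>"
    using w by (auto simp: one_K mult_K fun_eq_iff configs_closed)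
  ultimately show "\<exists>v\<in>carrier K. v \<otimes>\<^bsub>K\<^esub> w = \<one>\<^bsub>K\<^esub>" by blast
qed

sublocale K: group K by (rule group_K)

lemma lamp_closed: "h \<in> carrier H \<Longrightarrow> lamp h \<in> carrier K"
  by (auto simp: embed_lamp_def carrier_K configs_iff intro: finite_subset[of _ "{\<one>\<^bsub>G\<^esub>}"])

lemma base_closed: "g \<in> carrier G \<Longrightarrow> base g \<in> carrier K"
  by (auto simp: embed_base_def carrier_K lamp_configs_def carrier_sum_group H.is_group cong: conj_cong)

text \<open>Translation by \<open>x\<close> moves the switched lamp from the identity to the
  position of the walker, so right multiplication acts on the lamp where the walker stands.\<close>

lemma mult_lamp:
  assumes "\<eta> \<in> configs" "x \<in> carrier G" "h \<in> carrier H"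
  shows "(\<eta>, x) \<otimes>\<^bsub>K\<^esub> lamp h = (\<eta>(x := \<eta> x \<otimes>\<^bsub>H\<^esub> h), x)"
proof -
  have "inv\<^bsub>G\<^esub> x \<otimes>\<^bsub>G\<^esub> z = \<one>\<^bsub>G\<^esub> \<longleftrightarrow> z = x" if "z \<in> carrier G" for z
    using that assms by (metis G.inv_inv G.inv_equality G.l_inv G.inv_closed)
  then show ?thesis
    using assms by (auto simp: embed_lamp_def mult_K fun_eq_iff configs_closed configs_outside)
qed

lemma mult_base:
  assumes "\<eta> \<in> configs" "x \<in> carrier G" "g \<in> carrier G"
  shows "(\<eta>, x) \<otimes>\<^bsub>K\<^esub> base g = (\<eta>, x \<otimes>\<^bsub>G\<^esub> g)"
  using assms
  by (auto simp: embed_base_def mult_K lamp_configs_def fun_eq_iff)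
     (auto simp: configs_closed[unfolded lamp_configs_def] configs_outside[unfolded lamp_configs_def])

lemma inv_lamp:
  assumes "h \<in> carrier H" shows "inv\<^bsub>K\<^esub> (lamp h) = lamp (inv\<^bsub>H\<^esub> h)"
proof (rule K.inv_equality)
  show "lamp (inv\<^bsub>H\<^esub> h) \<otimes>\<^bsub>K\<^esub> lamp h = \<one>\<^bsub>K\<^esub>"
    using assms by (auto simp: embed_lamp_def mult_K one_K fun_eq_iff)
qed (use assms in \<open>auto simp: lamp_closed\<close>)

lemma inv_base:
  assumes "g \<in> carrier G" shows "inv\<^bsub>K\<^esub> (base g) = base (inv\<^bsub>G\<^esub> g)"
proof (rule K.inv_equality)
  show "base (inv\<^bsub>G\<^esub> g) \<otimes>\<^bsub>K\<^esub> base g = \<one>\<^bsub>K\<^esub>"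
    using assms by (auto simp: embed_base_def lamp_configs_def mult_K one_K fun_eq_iff)
qed (use assms in \<open>auto simp: base_closed\<close>)

lemma carrier_H_ne: "carrier H \<noteq> {}" using H.one_closed by blast

definition "lamp_pmf = map_pmf lamp (pmf_of_set (carrier H))"
definition "base_pmf = map_pmf base \<mu>"

lemma sws_measure_eq:
  "sws_measure H G \<mu> = conv_pmf K (conv_pmf K lamp_pmf base_pmf) lamp_pmf"
  by (simp add: sws_measure_def Let_def lamp_pmf_def base_pmf_def)

lemma set_lamp_pmf: "set_pmf lamp_pmf \<subseteq> carrier K"
  using finite_H carrier_H_ne by (auto simp: lamp_pmf_def lamp_closed)

lemma set_base_pmf: "set_pmf base_pmf \<subseteq> carrier K"
  using supp_G by (auto simp: base_pmf_def base_closed)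

lemma set_sws: "set_pmf (sws_measure H G \<mu>) \<subseteq> carrier K"
  by (simp add: sws_measure_eq K.conv_pmf_carrier set_lamp_pmf set_base_pmf)

lemma finite_sws: "finite (set_pmf (sws_measure H G \<mu>))"
  using finite_H carrier_H_ne finite_supp
  by (simp add: sws_measure_eq conv_pmf_def lamp_pmf_def base_pmf_def)

text \<open>Inversion reverses convolutions, and lamp, base, lamp is a palindrome of symmetric
  measures, so it is reproduced up to associativity.\<close>

lemma sym_sws:
  assumes "w \<in> carrier K"
  shows "pmf (sws_measure H G \<mu>) (inv\<^bsub>K\<^esub> w) = pmf (sws_measure H G \<mu>) w"
proof -
  have l: "map_pmf (m_inv K) lamp_pmf = lamp_pmf"
  proof -
    have "map_pmf (m_inv K) lamp_pmf = map_pmf (\<lambda>h. lamp (inv\<^bsub>H\<^esub> h)) (pmf_of_set (carrier H))"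
      unfolding lamp_pmf_def map_pmf_comp
      using finite_H carrier_H_ne by (intro map_pmf_cong refl) (simp add: inv_lamp)
    also have "\<dots> = map_pmf lamp (map_pmf (m_inv H) (pmf_of_set (carrier H)))"
      by (simp add: map_pmf_comp)
    also have "map_pmf (m_inv H) (pmf_of_set (carrier H)) = pmf_of_set (carrier H)"
      using finite_H carrier_H_ne
      by (intro map_pmf_of_set_bij_betw) (auto intro!: bij_betw_byWitness[of _ "m_inv H"])
    finally show ?thesis by (simp add: lamp_pmf_def)
  qed
  have "map_pmf (m_inv G) \<mu> = \<mu>" using G.symmetric_pmf_iff[OF supp_G] sym_mu by blast
  then have b: "map_pmf (m_inv K) base_pmf = base_pmf"
  proof -
    have "map_pmf (m_inv K) base_pmf = map_pmf (\<lambda>g. base (inv\<^bsub>G\<^esub> g)) \<mu>"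
      unfolding base_pmf_def map_pmf_comp
      using supp_G by (intro map_pmf_cong refl) (auto simp: inv_base)
    also have "\<dots> = map_pmf base (map_pmf (m_inv G) \<mu>)" by (simp add: map_pmf_comp)
    finally show ?thesis using \<open>map_pmf (m_inv G) \<mu> = \<mu>\<close> by (simp add: base_pmf_def)
  qed
  have "map_pmf (m_inv K) (sws_measure H G \<mu>) = sws_measure H G \<mu>"
    unfolding sws_measure_eq
    by (simp add: K.map_inv_conv_pmf K.conv_pmf_carrier K.conv_pmf_assoc set_lamp_pmf set_base_pmf l b)
  then show ?thesis using K.symmetric_pmf_iff[OF set_sws] assms by blast
qed

text \<open>The projection \<open>Q\<^sub>x\<close>: conditional expectation given all lamps except
  the one at \<open>x\<close>.\<close>

definition average :: "'g \<Rightarrow> (('g \<Rightarrow> 'h) \<Rightarrow> complex) \<Rightarrow> ('g \<Rightarrow> 'h) \<Rightarrow> complex" where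
  "average x f \<eta> = (\<Sum>h\<in>carrier H. f (\<eta>(x := h))) / of_nat (order H)"

text \<open>Multiplying a lamp by a uniform element amounts to overwriting it by one, since left
  multiplication permutes \<open>H\<close>.\<close>

lemma average_mult:
  assumes "\<eta> \<in> configs" "x \<in> carrier G"
  shows "(\<Sum>h\<in>carrier H. f (\<eta>(x := \<eta> x \<otimes>\<^bsub>H\<^esub> h))) / of_nat (order H) = average x f \<eta>"
proof -
  have "bij_betw (\<lambda>h. \<eta> x \<otimes>\<^bsub>H\<^esub> h) (carrier H) (carrier H)"
    by (rule bij_betw_byWitness[of _ "\<lambda>h. inv\<^bsub>H\<^esub> \<eta> x \<otimes>\<^bsub>H\<^esub> h"])
       (use assms in \<open>auto simp: configs_closed simp flip: H.m_assoc\<close>)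
  then show ?thesis
    unfolding average_def by (simp add: sum.reindex_bij_betw[of _ _ _ "\<lambda>h. f (\<eta>(x := h))"])
qed

text \<open>The increment is read from left to right: switch at \<open>x\<close>, walk by
  \<open>g\<close>, switch at \<open>x \<otimes> g\<close>. The last switch acts directly on
  \<open>F\<close> and becomes the inner average.\<close>

lemma sws_operator_eq:
  assumes w: "\<eta> \<in> configs" "x \<in> carrier G"
  shows "sws_operator H G \<mu> F (\<eta>, x) = (\<Sum>g\<in>set_pmf \<mu>. of_real (pmf \<mu> g) *
      average x (average (x \<otimes>\<^bsub>G\<^esub> g) (\<lambda>\<zeta>. F (\<zeta>, x \<otimes>\<^bsub>G\<^esub> g))) \<eta>)"
proof -
  have fin: "finite (set_pmf lamp_pmf)" "finite (set_pmf base_pmf)"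
    "finite (set_pmf (conv_pmf K lamp_pmf base_pmf))"
    using finite_H carrier_H_ne finite_supp by (auto simp: conv_pmf_def lamp_pmf_def base_pmf_def)
  have E: "measure_pmf.expectation (pmf_of_set (carrier H)) f = (\<Sum>h\<in>carrier H. f h) / of_nat (order H)"
    for f :: "'h \<Rightarrow> complex"
    using finite_H carrier_H_ne by (simp add: expectation_pmf_of_set order_def)
  have Emu: "measure_pmf.expectation \<mu> f = (\<Sum>g\<in>set_pmf \<mu>. of_real (pmf \<mu> g) * f g)"
    for f :: "'g \<Rightarrow> complex"
    using finite_supp by (subst integral_measure_pmf[of "set_pmf \<mu>"]) (auto simp: scaleR_conv_of_real)
  have xw: "(\<eta>, x) \<in> carrier K" using w by (simp add: carrier_K)
  have "sws_operator H G \<mu> F (\<eta>, x) =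
      measure_pmf.expectation (sws_measure H G \<mu>) (\<lambda>z. F ((\<eta>, x) \<otimes>\<^bsub>K\<^esub> z))"
    unfolding sws_operator_def using K.right_conv_op_eq[OF set_sws finite_sws sym_sws xw] .
  also have "\<dots> = (\<Sum>h\<in>carrier H. \<Sum>g\<in>set_pmf \<mu>. of_real (pmf \<mu> g) * ((\<Sum>h'\<in>carrier H.
      F ((\<eta>, x) \<otimes>\<^bsub>K\<^esub> ((lamp h \<otimes>\<^bsub>K\<^esub> base g) \<otimes>\<^bsub>K\<^esub> lamp h'))) / of_nat (order H))) / of_nat (order H)"
    unfolding sws_measure_eq integral_conv_pmf_finite[OF fin(3,1)] integral_conv_pmf_finite[OF fin(1,2)]
    unfolding lamp_pmf_def base_pmf_def integral_map_pmf E Emu ..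
  also have "\<dots> = (\<Sum>h\<in>carrier H. \<Sum>g\<in>set_pmf \<mu>. of_real (pmf \<mu> g) *
      average (x \<otimes>\<^bsub>G\<^esub> g) (\<lambda>\<zeta>. F (\<zeta>, x \<otimes>\<^bsub>G\<^esub> g)) (\<eta>(x := \<eta> x \<otimes>\<^bsub>H\<^esub> h))) / of_nat (order H)"
  proof (intro arg_cong2[where f="(/)"] arg_cong2[where f="(*)"] sum.cong refl)
    fix h g assume h: "h \<in> carrier H" and "g \<in> set_pmf \<mu>"
    then have g: "g \<in> carrier G" using supp_G by auto
    have \<zeta>: "\<eta>(x := \<eta> x \<otimes>\<^bsub>H\<^esub> h) \<in> configs" using w h by (intro configs_update) (auto simp: configs_closed)
    have "F ((\<eta>, x) \<otimes>\<^bsub>K\<^esub> ((lamp h \<otimes>\<^bsub>K\<^esub> base g) \<otimes>\<^bsub>K\<^esub> lamp h')) =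
      F ((\<eta>(x := \<eta> x \<otimes>\<^bsub>H\<^esub> h))(x \<otimes>\<^bsub>G\<^esub> g := (\<eta>(x := \<eta> x \<otimes>\<^bsub>H\<^esub> h)) (x \<otimes>\<^bsub>G\<^esub> g) \<otimes>\<^bsub>H\<^esub> h'), x \<otimes>\<^bsub>G\<^esub> g)"
      if h': "h' \<in> carrier H" for h'
    proof -
      have "(\<eta>, x) \<otimes>\<^bsub>K\<^esub> ((lamp h \<otimes>\<^bsub>K\<^esub> base g) \<otimes>\<^bsub>K\<^esub> lamp h')
          = (((\<eta>, x) \<otimes>\<^bsub>K\<^esub> lamp h) \<otimes>\<^bsub>K\<^esub> base g) \<otimes>\<^bsub>K\<^esub> lamp h'"
        using xw h h' g by (simp add: K.m_assoc lamp_closed base_closed)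
      then show ?thesis
        using w h h' g \<zeta> by (simp add: mult_lamp mult_base del: fun_upd_apply)
    qed
    then show "(\<Sum>h'\<in>carrier H. F ((\<eta>, x) \<otimes>\<^bsub>K\<^esub> ((lamp h \<otimes>\<^bsub>K\<^esub> base g) \<otimes>\<^bsub>K\<^esub> lamp h'))) / of_nat (order H)
        = average (x \<otimes>\<^bsub>G\<^esub> g) (\<lambda>\<zeta>. F (\<zeta>, x \<otimes>\<^bsub>G\<^esub> g)) (\<eta>(x := \<eta> x \<otimes>\<^bsub>H\<^esub> h))"
      using average_mult[OF \<zeta>, of "x \<otimes>\<^bsub>G\<^esub> g" "\<lambda>\<zeta>. F (\<zeta>, x \<otimes>\<^bsub>G\<^esub> g)"] w g
      by (simp del: fun_upd_apply)
  qed
  also have "\<dots> = (\<Sum>g\<in>set_pmf \<mu>. of_real (pmf \<mu> g) * ((\<Sum>h\<in>carrier H.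
      average (x \<otimes>\<^bsub>G\<^esub> g) (\<lambda>\<zeta>. F (\<zeta>, x \<otimes>\<^bsub>G\<^esub> g)) (\<eta>(x := \<eta> x \<otimes>\<^bsub>H\<^esub> h))) / of_nat (order H)))"
    by (rule sum_mult_swap)
  finally show ?thesis unfolding average_mult[OF w] .
qed

end

section \<open>Eigenfunctions from finite clusters\<close>

lemma (in group) countable_generate:
  assumes "countable S" "S \<subseteq> carrier G"
  shows "countable (generate G S)"
proof -
  define S' where "S' = S \<union> m_inv G ` S"
  define w where "w xs = foldr (\<otimes>) xs \<one>" for xs
  have S': "S' \<subseteq> carrier G" using assms by (auto simp: S'_def)
  have w_closed: "w xs \<in> carrier G" if "xs \<in> lists S'" for xs
    using that S' by (induction xs) (auto simp: w_def)
  have w_append: "w (xs @ ys) = w xs \<otimes> w ys" if "xs \<in> lists S'" "ys \<in> lists S'" for xs ys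
    using that S' w_closed by (induction xs) (auto simp: w_def m_assoc subset_iff)
  have "generate G S \<subseteq> w ` lists S'"
  proof
    fix x assume "x \<in> generate G S"
    then show "x \<in> w ` lists S'"
    proof induction
      case one
      show ?case by (rule image_eqI[of _ _ "[]"]) (auto simp: w_def)
    next
      case (incl h)
      then show ?case using assms by (intro image_eqI[of _ _ "[h]"]) (auto simp: w_def S'_def)
    next
      case (inv h)
      then show ?case using assms by (intro image_eqI[of _ _ "[inv h]"]) (auto simp: w_def S'_def)
    next
      case (eng h1 h2)
      then obtain xs ys where "xs \<in> lists S'" "h1 = w xs" "ys \<in> lists S'" "h2 = w ys" by blast
      then show ?case by (intro image_eqI[of _ _ "xs @ ys"]) (auto simp: w_append)
    qed
  qed
  moreover have "countable (lists S')" using assms by (simp add: S'_def)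
  ultimately show ?thesis by (meson countable_image countable_subset)
qed

context lamplighter_walk
begin

text \<open>Countability is used twice: for the enumeration of points behind Gram-Schmidt, and for
  the countable union over cluster shapes.\<close>

lemma countable_G: "countable (carrier G)"
  using G.countable_generate[OF countable_finite[OF finite_supp] supp_G] generates by simp

lemma countable_H: "countable (carrier H)"
  by (rule countable_finite[OF finite_H])

lemma countable_configs: "countable configs"
proof (rule countable_subset)
  let ?C = "\<lambda>D. {\<eta> \<in> configs. \<forall>x\<in>carrier G - D. \<eta> x = \<one>\<^bsub>H\<^esub>}"
  show "configs \<subseteq> (\<Union>D\<in>{D. finite D \<and> D \<subseteq> carrier G}. ?C D)"
  proof
    fix \<eta> assume "\<eta> \<in> configs"
    then show "\<eta> \<in> (\<Union>D\<in>{D. finite D \<and> D \<subseteq> carrier G}. ?C D)"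
      by (intro UN_I[of "{x \<in> carrier G. \<eta> x \<noteq> \<one>\<^bsub>H\<^esub>}"]) (auto simp: configs_iff)
  qed
  show "countable (\<Union>D\<in>{D. finite D \<and> D \<subseteq> carrier G}. ?C D)"
  proof (rule countable_UN)
    show "countable {D. finite D \<and> D \<subseteq> carrier G}"
      using countable_Collect_finite_subset[OF countable_G] by (simp add: conj_commute)
    fix D assume D: "D \<in> {D. finite D \<and> D \<subseteq> carrier G}"
    have "inj_on (\<lambda>\<eta>. restrict \<eta> D) (?C D)"
    proof (rule inj_onI, rule ext)
      fix \<eta> \<zeta> x assume *: "\<eta> \<in> ?C D" "\<zeta> \<in> ?C D" "restrict \<eta> D = restrict \<zeta> D"
      show "\<eta> x = \<zeta> x"
      proof (cases "x \<in> D")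
        case True
        then show ?thesis using fun_cong[OF *(3), of x] by simp
      next
        case False
        then show ?thesis using *(1,2) configs_outside[of \<eta> x] configs_outside[of \<zeta> x]
          by (cases "x \<in> carrier G") auto
      qed
    qed
    moreover have "(\<lambda>\<eta>. restrict \<eta> D) ` ?C D \<subseteq> (D \<rightarrow>\<^sub>E carrier H)"
      using D configs_closed by auto
    then have "countable ((\<lambda>\<eta>. restrict \<eta> D) ` ?C D)"
      using D countable_H by (intro countable_subset[OF _ countable_PiE]) auto
    ultimately show "countable (?C D)" using countable_image_inj_on by blast
  qed
qed

lemma countable_K: "countable (carrier K)"
  by (simp add: carrier_K countable_configs countable_G)

sublocale R: symmetric_kernel "carrier K" "\<lambda>w v. pmf (sws_measure H G \<mu>) (inv\<^bsub>K\<^esub> v \<otimes>\<^bsub>K\<^esub> w)"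
  by (rule K.right_conv_symmetric_kernel[OF set_sws finite_sws countable_K sym_sws])

lemma sws_operator_kernel: "R.T = sws_operator H G \<mu>"
  by (intro ext) (simp add: kernel_op_def sws_operator_def right_conv_op_def mult.commute)

section \<open>Projected point masses on lamp configurations\<close>

definition agree_off :: "'g set \<Rightarrow> ('g \<Rightarrow> 'h) \<Rightarrow> ('g \<Rightarrow> 'h) set" where
  "agree_off D \<zeta> = {\<eta> \<in> configs. \<forall>x. x \<notin> D \<longrightarrow> \<eta> x = \<zeta> x}"

text \<open>For finite \<open>D\<close> the configurations agreeing with \<zeta> off
  \<open>D\<close> are a copy of a finite power of \<open>H\<close>, on which sums of products
  factor over the sites.\<close>

lemma agree_off_bij:
  assumes "\<zeta> \<in> configs" "finite D" "D \<subseteq> carrier G"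
  shows "bij_betw (\<lambda>\<sigma> x. if x \<in> D then \<sigma> x else \<zeta> x) (D \<rightarrow>\<^sub>E carrier H) (agree_off D \<zeta>)"
proof (rule bij_betw_byWitness[where f' = "\<lambda>\<eta>. restrict \<eta> D"])
  show "(\<lambda>\<sigma> x. if x \<in> D then \<sigma> x else \<zeta> x) ` (D \<rightarrow>\<^sub>E carrier H) \<subseteq> agree_off D \<zeta>"
  proof
    fix \<eta> assume "\<eta> \<in> (\<lambda>\<sigma> x. if x \<in> D then \<sigma> x else \<zeta> x) ` (D \<rightarrow>\<^sub>E carrier H)"
    then obtain \<sigma> where s: "\<sigma> \<in> D \<rightarrow>\<^sub>E carrier H" "\<eta> = (\<lambda>x. if x \<in> D then \<sigma> x else \<zeta> x)" by auto
    have "finite (D \<union> {x \<in> carrier G. \<zeta> x \<noteq> \<one>\<^bsub>H\<^esub>})" using assms by (auto simp: configs_iff)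
    then have "finite {x \<in> carrier G. \<eta> x \<noteq> \<one>\<^bsub>H\<^esub>}" by (rule rev_finite_subset) (auto simp: s)
    then have "\<eta> \<in> configs"
      using assms s by (auto simp: configs_iff PiE_iff extensional_def)
    then show "\<eta> \<in> agree_off D \<zeta>" by (auto simp: agree_off_def s)
  qed
  show "(\<lambda>\<eta>. restrict \<eta> D) ` agree_off D \<zeta> \<subseteq> D \<rightarrow>\<^sub>E carrier H"
    using assms by (auto simp: agree_off_def configs_closed)
qed (auto simp: agree_off_def PiE_iff extensional_def fun_eq_iff)

lemma finite_agree_off:
  assumes "\<zeta> \<in> configs" "finite D" "D \<subseteq> carrier G"
  shows "finite (agree_off D \<zeta>)"
  using bij_betw_finite[OF agree_off_bij[OF assms]] assms finite_H by (simp add: finite_PiE)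

lemma sum_agree_off_prod:
  fixes g :: "'g \<Rightarrow> 'h \<Rightarrow> real"
  assumes "\<zeta> \<in> configs" "finite D" "D \<subseteq> carrier G"
  shows "(\<Sum>\<eta>\<in>agree_off D \<zeta>. \<Prod>x\<in>D. g x (\<eta> x)) = (\<Prod>x\<in>D. \<Sum>h\<in>carrier H. g x h)"
proof -
  have "(\<Sum>\<eta>\<in>agree_off D \<zeta>. \<Prod>x\<in>D. g x (\<eta> x)) = (\<Sum>\<sigma>\<in>D \<rightarrow>\<^sub>E carrier H. \<Prod>x\<in>D. g x (\<sigma> x))"
    by (subst sum.reindex_bij_betw[OF agree_off_bij[OF assms], symmetric]) simp
  then show ?thesis using assms(2) finite_H by (simp add: prod_sum_PiE)
qed

text \<open>\<open>wave A B \<zeta>\<close> is the image of the indicator of \<open>\<zeta>\<close> under the projection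
  \<open>\<Prod>x\<in>A. Q\<^sub>x \<cdot> \<Prod>x\<in>B. (1 - Q\<^sub>x)\<close>, where \<open>Q\<^sub>x\<close> averages over the lamp at \<open>x\<close>.\<close>
definition factor :: "'g set \<Rightarrow> 'g set \<Rightarrow> ('g \<Rightarrow> 'h) \<Rightarrow> 'g \<Rightarrow> 'h \<Rightarrow> real" where
  "factor A B \<zeta> x h = (if x \<in> A then 1 / real (order H)
     else if x \<in> B then of_bool (h = \<zeta> x) - 1 / real (order H) else of_bool (h = \<zeta> x))"

definition wave :: "'g set \<Rightarrow> 'g set \<Rightarrow> ('g \<Rightarrow> 'h) \<Rightarrow> ('g \<Rightarrow> 'h) \<Rightarrow> real" where
  "wave A B \<zeta> \<eta> =
     (if \<eta> \<in> agree_off (A \<union> B) \<zeta> then \<Prod>x\<in>A \<union> B. factor A B \<zeta> x (\<eta> x) else 0)"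

text \<open>Off \<open>A \<union> B\<close> a factor is the indicator of the lamp value of \<zeta>,
  so waves of different clusters can be written as products over one common
  \<open>D\<close>.\<close>

lemma wave_extend:
  assumes D: "finite D" "A \<union> B \<subseteq> D"
  shows "wave A B \<zeta> \<eta> = (if \<eta> \<in> agree_off D \<zeta> then \<Prod>x\<in>D. factor A B \<zeta> x (\<eta> x) else 0)"
proof (cases "\<eta> \<in> agree_off (A \<union> B) \<zeta>")
  case True
  then have "\<eta> \<in> agree_off D \<zeta>" using D by (auto simp: agree_off_def)
  moreover have "(\<Prod>x\<in>A \<union> B. factor A B \<zeta> x (\<eta> x)) = (\<Prod>x\<in>D. factor A B \<zeta> x (\<eta> x))"
    using D True by (intro prod.mono_neutral_left) (auto simp: factor_def agree_off_def)
  ultimately show ?thesis using True by (simp add: wave_def)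
next
  case False
  have "(\<Prod>x\<in>D. factor A B \<zeta> x (\<eta> x)) = 0" if a: "\<eta> \<in> agree_off D \<zeta>"
  proof -
    obtain x where "x \<notin> A \<union> B" "\<eta> x \<noteq> \<zeta> x" using False a by (auto simp: agree_off_def)
    moreover from this have "x \<in> D" using a by (auto simp: agree_off_def)
    ultimately show ?thesis using D by (auto simp: factor_def intro!: prod_zero bexI[of _ x])
  qed
  then show ?thesis using False by (simp add: wave_def)
qed

lemma wave_outside: "\<eta> \<notin> agree_off (A \<union> B) \<zeta> \<Longrightarrow> wave A B \<zeta> \<eta> = 0"
  by (simp add: wave_def)

lemma order_pos: "real (order H) > 0"
  using order_H by simp

lemma average_cong:
  "(\<And>\<eta>. \<eta> \<in> configs \<Longrightarrow> f \<eta> = g \<eta>) \<Longrightarrow> \<eta> \<in> configs \<Longrightarrow> x \<in> carrier G \<Longrightarrow> average x f \<eta> = average x g \<eta>"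
  unfolding average_def by (simp add: configs_update)

lemma average_scale: "average x (\<lambda>\<eta>. c * f \<eta>) \<eta> = c * average x f \<eta>"
  by (simp add: average_def sum_distrib_left mult.assoc)

lemma average_zero: "average x (\<lambda>\<eta>. 0) \<eta> = 0"
  by (simp add: average_def)

lemma agree_off_update:
  assumes "\<eta> \<in> configs" "y \<in> carrier G" "h \<in> carrier H" "y \<in> D"
  shows "\<eta>(y := h) \<in> agree_off D \<zeta> \<longleftrightarrow> \<eta> \<in> agree_off D \<zeta>"
  using assms configs_update[OF assms(1-3)] unfolding agree_off_def by (auto split: if_splits)

lemma wave_update:
  assumes "\<eta> \<in> configs" "finite A" "finite B" "A \<union> B \<subseteq> carrier G" "y \<in> A \<union> B" "h \<in> carrier H"
  shows "wave A B \<zeta> (\<eta>(y := h)) = (if \<eta> \<in> agree_off (A \<union> B) \<zeta>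
    then factor A B \<zeta> y h * (\<Prod>x\<in>A \<union> B - {y}. factor A B \<zeta> x (\<eta> x)) else 0)"
proof -
  have "(\<Prod>x\<in>A \<union> B. factor A B \<zeta> x ((\<eta>(y := h)) x)) =
      factor A B \<zeta> y h * (\<Prod>x\<in>A \<union> B - {y}. factor A B \<zeta> x ((\<eta>(y := h)) x))"
    using assms by (subst prod.remove[of _ y]) auto
  also have "(\<Prod>x\<in>A \<union> B - {y}. factor A B \<zeta> x ((\<eta>(y := h)) x)) =
      (\<Prod>x\<in>A \<union> B - {y}. factor A B \<zeta> x (\<eta> x))"
    by (intro prod.cong) auto
  finally show ?thesis
    using assms agree_off_update[of \<eta> y h "A \<union> B" \<zeta>] by (auto simp: wave_def)
qed

text \<open>On \<open>A\<close> the factor is constant in the lamp and averaging fixes it. On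
  \<open>B\<close> it has mean zero: the indicator sums to 1, as do the subtracted constants
  \<open>1 / |H|\<close>.\<close>

lemma average_wave:
  assumes "\<eta> \<in> configs" "\<zeta> \<in> configs" "finite A" "finite B" "A \<union> B \<subseteq> carrier G" "y \<in> A \<union> B"
  shows "average y (\<lambda>\<eta>. of_real (wave A B \<zeta> \<eta>)) \<eta> = (if y \<in> A then of_real (wave A B \<zeta> \<eta>) else 0)"
proof -
  define P where "P = (\<Prod>x\<in>A \<union> B - {y}. factor A B \<zeta> x (\<eta> x))"
  have yG: "y \<in> carrier G" using assms by auto
  have "(\<Sum>h\<in>carrier H. wave A B \<zeta> (\<eta>(y := h))) = (\<Sum>h\<in>carrier H. if \<eta> \<in> agree_off (A \<union> B) \<zeta>
      then factor A B \<zeta> y h * P else 0)"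
    using assms by (intro sum.cong refl) (simp add: wave_update P_def)
  also have "\<dots> = (if \<eta> \<in> agree_off (A \<union> B) \<zeta> then (\<Sum>h\<in>carrier H. factor A B \<zeta> y h) * P else 0)"
    by (simp add: sum_distrib_right)
  also have "\<dots> = (if y \<in> A then real (order H) * wave A B \<zeta> \<eta> else 0)"
  proof (cases "y \<in> A")
    case True
    have "wave A B \<zeta> (\<eta>(y := \<eta> y)) = (if \<eta> \<in> agree_off (A \<union> B) \<zeta> then factor A B \<zeta> y (\<eta> y) * P else 0)"
      unfolding P_def using assms configs_closed[OF assms(1) yG] by (intro wave_update) auto
    then show ?thesis using True order_pos by (simp add: factor_def order_def)
  next
    case False
    then have "(\<Sum>h\<in>carrier H. factor A B \<zeta> y h) = 0"
      using assms yG configs_closed[OF assms(2) yG] finite_H order_pos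
      by (auto simp: factor_def sum_subtractf order_def of_bool_def)
    then show ?thesis using False by simp
  qed
  finally have *: "(\<Sum>h\<in>carrier H. wave A B \<zeta> (\<eta>(y := h))) = \<dots>" .
  show ?thesis
    unfolding average_def of_real_sum[symmetric] * using order_pos by auto
qed

section \<open>Eigenfunctions on the lamplighter group\<close>

definition tensor :: "('g \<Rightarrow> complex) \<Rightarrow> (('g \<Rightarrow> 'h) \<Rightarrow> real) \<Rightarrow> ('g \<Rightarrow> 'h) \<times> 'g \<Rightarrow> complex" where
  "tensor \<phi> f = (\<lambda>(\<eta>, y). \<phi> y * of_real (f \<eta>))"

lemma tensor_finsupp:
  assumes "\<And>y. y \<notin> C \<Longrightarrow> \<phi> y = 0" "finite C" "C \<subseteq> carrier G"
    and "finite A" "finite B" "A \<union> B \<subseteq> carrier G" "\<zeta> \<in> configs"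
  shows "tensor \<phi> (wave A B \<zeta>) \<in> finsupp (carrier K)"
proof -
  have "{w. tensor \<phi> (wave A B \<zeta>) w \<noteq> 0} \<subseteq> agree_off (A \<union> B) \<zeta> \<times> C"
  proof -
    have "y \<in> C" if "\<phi> y \<noteq> 0" for y using assms(1) that by blast
    then show ?thesis by (auto simp: tensor_def wave_def split: if_splits)
  qed
  moreover have "finite (agree_off (A \<union> B) \<zeta> \<times> C)" using assms by (intro finite_cartesian_product finite_agree_off) auto
  moreover have "agree_off (A \<union> B) \<zeta> \<times> C \<subseteq> carrier K"
    using assms by (auto simp: carrier_K agree_off_def)
  ultimately show ?thesis by (auto simp: finsupp_def intro: finite_subset)
qed

lemma walk_sum:
  assumes A: "finite A" "A \<subseteq> carrier G" "\<And>y. y \<notin> A \<Longrightarrow> \<phi> y = 0" and x: "x \<in> carrier G"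
  shows "(\<Sum>g\<in>set_pmf \<mu>. of_real (pmf \<mu> g) * \<phi> (x \<otimes>\<^bsub>G\<^esub> g)) =
    (\<Sum>y\<in>A. of_real (transition G \<mu> x y) * (\<phi> y :: complex))"
proof -
  let ?f = "\<lambda>y. inv\<^bsub>G\<^esub> x \<otimes>\<^bsub>G\<^esub> y"
  have f: "x \<otimes>\<^bsub>G\<^esub> ?f y = y" if "y \<in> carrier G" for y using that x by (simp flip: G.m_assoc)
  have f': "?f (x \<otimes>\<^bsub>G\<^esub> y) = y" if "y \<in> carrier G" for y using that x by (simp flip: G.m_assoc)
  have inj: "inj_on ?f A" 
    by (rule inj_on_inverseI[of _ "\<lambda>y. x \<otimes>\<^bsub>G\<^esub> y"]) (use f A in auto)
  have "(\<Sum>g\<in>set_pmf \<mu>. of_real (pmf \<mu> g) * \<phi> (x \<otimes>\<^bsub>G\<^esub> g)) =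
      (\<Sum>g\<in>set_pmf \<mu> \<union> ?f ` A. of_real (pmf \<mu> g) * \<phi> (x \<otimes>\<^bsub>G\<^esub> g))"
    using A finite_supp by (intro sum.mono_neutral_left) (auto simp: set_pmf_iff)
  also have "\<dots> = (\<Sum>g\<in>?f ` A. of_real (pmf \<mu> g) * \<phi> (x \<otimes>\<^bsub>G\<^esub> g))"
  proof (rule sum.mono_neutral_right)
    show "\<forall>g\<in>set_pmf \<mu> \<union> ?f ` A - ?f ` A. of_real (pmf \<mu> g) * \<phi> (x \<otimes>\<^bsub>G\<^esub> g) = 0"
    proof
      fix g assume g: "g \<in> set_pmf \<mu> \<union> ?f ` A - ?f ` A"
      then have "g \<in> carrier G" using supp_G by auto
      then have "x \<otimes>\<^bsub>G\<^esub> g \<notin> A" using g f' by (metis Diff_iff image_eqI)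
      then show "of_real (pmf \<mu> g) * \<phi> (x \<otimes>\<^bsub>G\<^esub> g) = 0" using A(3) by simp
    qed
  qed (use A finite_supp in auto)
  also have "\<dots> = (\<Sum>y\<in>A. of_real (pmf \<mu> (?f y)) * \<phi> y)"
    using A f by (subst sum.reindex[OF inj]) (auto intro!: sum.cong)
  finally show ?thesis by (simp add: transition_def)
qed

text \<open>For \<open>x\<close> in \<open>A\<close> both averages fix the wave and the truncated
  walk on \<phi> remains. For \<open>x\<close> in \<open>B\<close> steps into \<open>A\<close> are
  possible, but the outer average kills the wave. From any other \<open>x\<close> no step leads into
  \<open>A\<close>.\<close>

lemma cluster_eigenfunction:
  assumes A: "finite A" "A \<subseteq> carrier G" "\<And>y. y \<notin> A \<Longrightarrow> \<phi> y = 0"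
    and B: "finite B" "B \<subseteq> carrier G" "A \<inter> B = {}" and \<zeta>: "\<zeta> \<in> configs"
    and eig: "\<And>x. x \<in> A \<Longrightarrow> (\<Sum>y\<in>A. of_real (transition G \<mu> x y) * \<phi> y) = c * \<phi> x"
    and bd: "\<And>x y. x \<in> carrier G - A - B \<Longrightarrow> y \<in> A \<Longrightarrow> transition G \<mu> x y = 0"
  shows "tensor \<phi> (wave A B \<zeta>) \<in> R.eigenspace c"
proof -
  let ?F = "tensor \<phi> (wave A B \<zeta>)"
  have fin: "?F \<in> finsupp (carrier K)" by (rule tensor_finsupp[of A]) (use A B \<zeta> in auto)
  have "sws_operator H G \<mu> ?F w = c * ?F w" for w
  proof (cases "w \<in> carrier K")
    case False
    then have "?F w = 0" using fin by (auto simp: finsupp_def)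
    then show ?thesis using R.kernel_op_outside[OF False] by (simp add: sws_operator_kernel)
  next
    case True
    then obtain \<eta> x where w: "w = (\<eta>, x)" "\<eta> \<in> configs" "x \<in> carrier G" by (auto simp: carrier_K)
    let ?v = "\<lambda>\<eta>. complex_of_real (wave A B \<zeta> \<eta>)"
    have av: "average y ?v \<eta> = (if y \<in> A then ?v \<eta> else 0)" if "y \<in> A \<union> B" "\<eta> \<in> configs" for y \<eta>
      using that A B \<zeta> by (intro average_wave) auto
    have "sws_operator H G \<mu> ?F w = (\<Sum>g\<in>set_pmf \<mu>. of_real (pmf \<mu> g) *
        average x (average (x \<otimes>\<^bsub>G\<^esub> g) (\<lambda>\<eta>. \<phi> (x \<otimes>\<^bsub>G\<^esub> g) * ?v \<eta>)) \<eta>)"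
      using w by (simp add: sws_operator_eq tensor_def)
    also have "\<dots> = (\<Sum>g\<in>set_pmf \<mu>. of_real (pmf \<mu> g) * (\<phi> (x \<otimes>\<^bsub>G\<^esub> g) * average x ?v \<eta>))"
    proof (intro sum.cong refl arg_cong2[where f="(*)"])
      fix g
      \<comment> \<open>The inner average acts trivially in both cases: at a site of
        \<open>A\<close> it fixes the wave, and elsewhere the coefficient \<phi> vanishes.\<close>
      have "average x (average (x \<otimes>\<^bsub>G\<^esub> g) (\<lambda>\<eta>. \<phi> (x \<otimes>\<^bsub>G\<^esub> g) * ?v \<eta>)) \<eta> =
          average x (\<lambda>\<eta>. \<phi> (x \<otimes>\<^bsub>G\<^esub> g) * ?v \<eta>) \<eta>"
        using w av[of "x \<otimes>\<^bsub>G\<^esub> g"] A(3)[of "x \<otimes>\<^bsub>G\<^esub> g"]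
        by (cases "x \<otimes>\<^bsub>G\<^esub> g \<in> A"; intro average_cong) (simp_all add: average_scale average_zero)
      then show "average x (average (x \<otimes>\<^bsub>G\<^esub> g) (\<lambda>\<eta>. \<phi> (x \<otimes>\<^bsub>G\<^esub> g) * ?v \<eta>)) \<eta> =
          \<phi> (x \<otimes>\<^bsub>G\<^esub> g) * average x ?v \<eta>"
        by (simp add: average_scale)
    qed
    also have "\<dots> = (\<Sum>g\<in>set_pmf \<mu>. of_real (pmf \<mu> g) * \<phi> (x \<otimes>\<^bsub>G\<^esub> g)) * average x ?v \<eta>"
      by (simp add: sum_distrib_right mult.assoc)
    also have "\<dots> = (\<Sum>y\<in>A. of_real (transition G \<mu> x y) * \<phi> y) * average x ?v \<eta>"
      using walk_sum[OF A(1,2), of \<phi> x] A(3) w by simp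
    also have "\<dots> = c * ?F w"
    proof (cases "x \<in> A \<union> B")
      case True
      then show ?thesis using av[OF True w(2)] eig A(3) B(3) w by (auto simp: tensor_def)
    next
      case False
      then show ?thesis using bd[of x] A(3) w by (simp add: tensor_def)
    qed
    finally show ?thesis .
  qed
  then show ?thesis using fin by (auto simp: R.eigenspace_def sws_operator_kernel)
qed

text \<open>Only steps ending at \<open>x\<close> could contribute, and on arrival the lamp at
  \<open>x\<close> is averaged, where the wave has mean zero.\<close>

lemma closed_site_eigenfunction:
  assumes x: "x \<in> carrier G" and \<zeta>: "\<zeta> \<in> configs"
  shows "tensor (\<lambda>y. of_bool (y = x)) (wave {} {x} \<zeta>) \<in> R.eigenspace 0"
proof -
  let ?F = "tensor (\<lambda>y. of_bool (y = x)) (wave {} {x} \<zeta>)"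
  have fin: "?F \<in> finsupp (carrier K)" by (rule tensor_finsupp[of "{x}"]) (use x \<zeta> in auto)
  have "sws_operator H G \<mu> ?F w = 0" for w
  proof (cases "w \<in> carrier K")
    case False
    then show ?thesis using R.kernel_op_outside[OF False] by (simp add: sws_operator_kernel)
  next
    case True
    then obtain \<eta> z where w: "w = (\<eta>, z)" "\<eta> \<in> configs" "z \<in> carrier G" by (auto simp: carrier_K)
    have "average y (\<lambda>\<eta>. ?F (\<eta>, y)) \<eta> = 0" if "\<eta> \<in> configs" for \<eta> y
      using that average_wave[of \<eta> \<zeta> "{}" "{x}" x] x \<zeta> by (cases "y = x") (auto simp: tensor_def average_zero)
    then have "average z (average y (\<lambda>\<eta>. ?F (\<eta>, y))) \<eta> = average z (\<lambda>_. 0) \<eta>" for y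
      using w by (intro average_cong) auto
    then show ?thesis using w by (simp add: sws_operator_eq average_zero)
  qed
  then show ?thesis using fin by (auto simp: R.eigenspace_def sws_operator_kernel)
qed

section \<open>Orthogonality and norms of projected point masses\<close>

lemma inner_tensor:
  assumes D: "\<And>\<eta>. \<eta> \<notin> agree_off D \<zeta> \<Longrightarrow> f \<eta> = 0" "finite D" "D \<subseteq> carrier G" "\<zeta> \<in> configs"
    and C: "\<And>y. y \<notin> C \<Longrightarrow> \<phi> y = 0" "finite C" "C \<subseteq> carrier G"
  shows "ell2_inner (carrier K) F (tensor \<phi> f) =
    (\<Sum>y\<in>C. (\<Sum>\<eta>\<in>agree_off D \<zeta>. F (\<eta>, y) * of_real (f \<eta>)) * cnj (\<phi> y))"
proof -
  have "ell2_inner (carrier K) F (tensor \<phi> f) =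
      (\<Sum>w\<in>agree_off D \<zeta> \<times> C. F w * cnj (tensor \<phi> f w))"
    using assms finite_agree_off[of \<zeta> D]
    by (intro ell2_inner_finite) (auto simp: carrier_K tensor_def, auto simp: agree_off_def)
  also have "\<dots> = (\<Sum>\<eta>\<in>agree_off D \<zeta>. \<Sum>y\<in>C. F (\<eta>, y) * of_real (f \<eta>) * cnj (\<phi> y))"
    by (simp add: sum.cartesian_product' tensor_def mult_ac)
  also have "\<dots> = (\<Sum>y\<in>C. \<Sum>\<eta>\<in>agree_off D \<zeta>. F (\<eta>, y) * of_real (f \<eta>) * cnj (\<phi> y))"
    by (rule sum.swap)
  finally show ?thesis by (simp add: sum_distrib_right)
qed

lemma wave_inner:
  assumes "\<zeta> \<in> configs" "finite D" "D \<subseteq> carrier G" "A \<union> B \<subseteq> D" "A' \<union> B' \<subseteq> D"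
  shows "(\<Sum>\<eta>\<in>agree_off D \<zeta>. wave A B \<zeta> \<eta> * wave A' B' \<zeta> \<eta>) =
    (\<Prod>x\<in>D. \<Sum>h\<in>carrier H. factor A B \<zeta> x h * factor A' B' \<zeta> x h)"
proof -
  have "(\<Sum>\<eta>\<in>agree_off D \<zeta>. wave A B \<zeta> \<eta> * wave A' B' \<zeta> \<eta>) =
      (\<Sum>\<eta>\<in>agree_off D \<zeta>. \<Prod>x\<in>D. factor A B \<zeta> x (\<eta> x) * factor A' B' \<zeta> x (\<eta> x))"
    using assms by (intro sum.cong refl) (simp add: wave_extend[of D] prod.distrib)
  also have "\<dots> = (\<Prod>x\<in>D. \<Sum>h\<in>carrier H. factor A B \<zeta> x h * factor A' B' \<zeta> x h)"
    by (rule sum_agree_off_prod) (use assms in auto)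
  finally show ?thesis .
qed

text \<open>At a common site of \<open>A\<close> and \<open>B'\<close> a constant factor meets one
  of mean zero, and this single site annihilates the product.\<close>

lemma wave_inner_conflict:
  assumes "\<zeta> \<in> configs" "finite D" "D \<subseteq> carrier G" "A \<union> B \<subseteq> D" "A' \<union> B' \<subseteq> D"
    and "A' \<inter> B' = {}" "A \<inter> B' \<noteq> {}"
  shows "(\<Sum>\<eta>\<in>agree_off D \<zeta>. wave A B \<zeta> \<eta> * wave A' B' \<zeta> \<eta>) = 0"
proof -
  obtain x where x: "x \<in> A" "x \<in> B'" "x \<notin> A'" using assms by auto
  have "\<zeta> x \<in> carrier H" using x assms by (intro configs_closed) auto
  then have "(\<Sum>h\<in>carrier H. factor A B \<zeta> x h * factor A' B' \<zeta> x h) = 0"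
    using x order_pos finite_H
    by (auto simp: factor_def order_def of_bool_def sum_subtractf simp flip: sum_divide_distrib)
  then show ?thesis
    using assms(2) x assms(4) by (subst wave_inner[OF assms(1-5)]) (auto intro!: prod_zero bexI[of _ x])
qed

text \<open>For disjoint \<open>A\<close> and \<open>B\<close>, the probability that independent
  sites, each open with probability \<open>1 / |H|\<close>, are open on \<open>A\<close> and closed
  on \<open>B\<close>.\<close>

definition weight :: "'g set \<Rightarrow> 'g set \<Rightarrow> real" where
  "weight A B = (1 / real (order H)) ^ card A * (1 - 1 / real (order H)) ^ card B"

lemma prod_weight:
  assumes "finite D" "A \<union> B \<subseteq> D" "A \<inter> B = {}"
  shows "(\<Prod>x\<in>D. if x \<in> A then 1 / real (order H) else if x \<in> B then 1 - 1 / real (order H) else 1) = weight A B"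
    (is "prod ?f D = _")
proof -
  have fin: "finite A" "finite B" using assms finite_subset by auto
  have "prod ?f D = prod ?f (A \<union> B)" using assms by (intro prod.mono_neutral_right) auto
  also have "\<dots> = prod ?f A * prod ?f B" using fin assms by (simp add: prod.union_disjoint)
  also have "prod ?f A = (1 / real (order H)) ^ card A" by simp
  also have "prod ?f B = (\<Prod>x\<in>B. 1 - 1 / real (order H))"
    using assms by (intro prod.cong) auto
  also have "\<dots> = (1 - 1 / real (order H)) ^ card B" by simp
  finally show ?thesis by (simp add: weight_def)
qed

text \<open>Site by site, a unit point mass on \<open>H\<close> is projected to the constants, to
  their complement, or left alone, with squared norms \<open>1 / |H|\<close>,
  \<open>1 - 1 / |H|\<close> and 1.\<close>

lemma wave_norm:
  assumes "\<zeta> \<in> configs" "finite D" "D \<subseteq> carrier G" "A \<union> B \<subseteq> D" "A \<inter> B = {}"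
  shows "(\<Sum>\<eta>\<in>agree_off D \<zeta>. wave A B \<zeta> \<eta> * wave A B \<zeta> \<eta>) = weight A B"
proof -
  have "(\<Sum>h\<in>carrier H. factor A B \<zeta> x h * factor A B \<zeta> x h) =
      (if x \<in> A then 1 / real (order H) else if x \<in> B then 1 - 1 / real (order H) else 1)"
    if x: "x \<in> D" for x
  proof -
    have \<zeta>: "\<zeta> x \<in> carrier H" using x assms by (intro configs_closed) auto
    show ?thesis
    proof (cases "x \<in> A")
      case True
      then show ?thesis using order_pos by (simp add: factor_def order_def)
    next
      case nA: False
      show ?thesis
      proof (cases "x \<in> B")
        case True
        let ?q = "1 / real (order H)"
        have "(\<Sum>h\<in>carrier H. factor A B \<zeta> x h * factor A B \<zeta> x h) =
            (\<Sum>h\<in>carrier H. (if h = \<zeta> x then 1 - 2 * ?q else 0) + ?q * ?q)"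
          using nA True by (intro sum.cong) (auto simp: factor_def algebra_simps)
        also have "\<dots> = 1 - 2 * ?q + real (order H) * (?q * ?q)"
          using \<zeta> finite_H by (simp add: sum.distrib order_def)
        finally show ?thesis using nA True order_pos by simp
      next
        case False
        then have "(\<Sum>h\<in>carrier H. factor A B \<zeta> x h * factor A B \<zeta> x h) =
            (\<Sum>h\<in>carrier H. if h = \<zeta> x then 1 else 0)"
          using nA by (intro sum.cong) (auto simp: factor_def)
        then show ?thesis using nA False \<zeta> finite_H by simp
      qed
    qed
  qed
  then show ?thesis
    using assms by (simp add: wave_inner prod_weight cong: prod.cong)
qed

lemma wave_self:
  assumes "\<zeta> \<in> configs" "finite A" "finite B" "A \<inter> B = {}"
  shows "wave A B \<zeta> \<zeta> = weight A B"
proof -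
  have "wave A B \<zeta> \<zeta> = (\<Prod>x\<in>A \<union> B. factor A B \<zeta> x (\<zeta> x))"
    using assms by (simp add: wave_def agree_off_def)
  also have "\<dots> = (\<Prod>x\<in>A \<union> B. if x \<in> A then 1 / real (order H) else if x \<in> B then 1 - 1 / real (order H) else 1)"
    by (intro prod.cong) (auto simp: factor_def)
  finally show ?thesis using assms by (simp add: prod_weight)
qed

text \<open>Two lamp states are essential here: on a one-element \<open>H\<close> a function of mean
  zero vanishes, and so would every wave with nonempty \<open>B\<close>.\<close>

lemma weight_pos: "weight A B > 0"
  using order_H by (simp add: weight_def)

text \<open>\<open>F (\<zeta>, x)\<close> is the pairing of \<open>F\<close> with the point mass at
  \<open>(\<zeta>, x)\<close>. The waves are mutually orthogonal and orthogonal to \<open>F\<close>,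
  so subtracting them from the point mass does not change the pairing. The remainder
  \<open>r\<close> has squared norm \<open>1 - W\<close>, and Cauchy-Schwarz concludes.\<close>

lemma value_bound:
  fixes A B :: "'i \<Rightarrow> 'g set"
  assumes F: "F \<in> ell2 (carrier K)" and x: "x \<in> carrier G" and \<zeta>: "\<zeta> \<in> configs" and I: "finite I"
    and AB: "\<And>i. i \<in> I \<Longrightarrow> finite (A i) \<and> finite (B i) \<and> A i \<union> B i \<subseteq> carrier G \<and> A i \<inter> B i = {}"
    and conflict: "\<And>i j. i \<in> I \<Longrightarrow> j \<in> I \<Longrightarrow> i \<noteq> j \<Longrightarrow> A i \<inter> B j \<noteq> {} \<or> A j \<inter> B i \<noteq> {}"
    and orth: "\<And>i. i \<in> I \<Longrightarrow>
      ell2_inner (carrier K) F (tensor (\<lambda>y. of_bool (y = x)) (wave (A i) (B i) \<zeta>)) = 0"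
  shows "(cmod (F (\<zeta>, x)))\<^sup>2 \<le> (ell2_norm (carrier K) F)\<^sup>2 * (1 - (\<Sum>i\<in>I. weight (A i) (B i)))"
proof -
  define D where "D = (\<Union>i\<in>I. A i \<union> B i)"
  have D: "finite D" "D \<subseteq> carrier G" using I AB by (auto simp: D_def)
  have ABD: "A i \<union> B i \<subseteq> D" if "i \<in> I" for i using that by (auto simp: D_def)
  define Z where "Z = agree_off D \<zeta>"
  have Z: "finite Z" "Z \<subseteq> configs" "\<zeta> \<in> Z"
    using finite_agree_off[OF \<zeta> D] \<zeta> by (auto simp: Z_def agree_off_def)
  define v where "v i = wave (A i) (B i) \<zeta>" for i
  have v0: "v i \<eta> = 0" if "i \<in> I" "\<eta> \<notin> Z" for i \<eta>
    using that ABD[OF that(1)] D by (auto simp: v_def Z_def wave_extend[of D])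
  have Fv: "(\<Sum>\<eta>\<in>Z. F (\<eta>, x) * of_real (v i \<eta>)) = 0" if i: "i \<in> I" for i
    using orth[OF i] v0[OF i] D \<zeta> x
    by (subst (asm) inner_tensor[of D \<zeta> _ "{x}"]) (auto simp: v_def Z_def)
  have vv: "(\<Sum>\<eta>\<in>Z. v i \<eta> * v j \<eta>) = (if i = j then weight (A i) (B i) else 0)"
    if "i \<in> I" "j \<in> I" for i j
  proof (cases "i = j")
    case True
    then show ?thesis using that AB ABD wave_norm[OF \<zeta> D, of "A i" "B i"] by (simp add: v_def Z_def)
  next
    case False
    from conflict[OF that this] show ?thesis
    proof
      assume "A i \<inter> B j \<noteq> {}"
      then show ?thesis
        using that AB ABD False wave_inner_conflict[OF \<zeta> D, of "A i" "B i" "A j" "B j"]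
        by (simp add: v_def Z_def)
    next
      assume "A j \<inter> B i \<noteq> {}"
      then show ?thesis
        using that AB ABD False wave_inner_conflict[OF \<zeta> D, of "A j" "B j" "A i" "B i"]
        by (simp add: v_def Z_def mult.commute)
    qed
  qed
  define s where "s \<eta> = (\<Sum>i\<in>I. v i \<eta>)" for \<eta>
  define r where "r \<eta> = of_bool (\<eta> = \<zeta>) - s \<eta>" for \<eta>
  define W where "W = (\<Sum>i\<in>I. weight (A i) (B i))"
  have s\<zeta>: "s \<zeta> = W"
    using AB \<zeta> by (auto simp: s_def W_def v_def intro!: sum.cong wave_self)
  have ss: "(\<Sum>\<eta>\<in>Z. s \<eta> * s \<eta>) = W"
  proof -
    have "(\<Sum>\<eta>\<in>Z. s \<eta> * s \<eta>) = (\<Sum>i\<in>I. \<Sum>j\<in>I. \<Sum>\<eta>\<in>Z. v i \<eta> * v j \<eta>)"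
      by (simp add: s_def sum_product sum.swap[of _ Z])
    also have "\<dots> = (\<Sum>i\<in>I. \<Sum>j\<in>I. if i = j then weight (A i) (B i) else 0)"
      by (intro sum.cong refl vv)
    finally show ?thesis using I by (simp add: W_def)
  qed
  \<comment> \<open>Both \<open>s \<zeta>\<close> and the squared norm of \<open>s\<close> equal
    \<open>W\<close>, as for any projection of a unit vector; \<open>1 - 2 * W + W\<close>
    remains.\<close>
  have "(\<Sum>\<eta>\<in>Z. (r \<eta>)\<^sup>2) = (\<Sum>\<eta>\<in>Z. (if \<eta> = \<zeta> then 1 - 2 * s \<eta> else 0) + s \<eta> * s \<eta>)"
    by (intro sum.cong) (auto simp: r_def power2_eq_square algebra_simps)
  also have "\<dots> = 1 - W" using Z by (simp add: sum.distrib ss s\<zeta>)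
  finally have rr: "(\<Sum>\<eta>\<in>Z. (r \<eta>)\<^sup>2) = 1 - W" .
  have "(\<Sum>\<eta>\<in>Z. F (\<eta>, x) * of_real (s \<eta>)) = (\<Sum>i\<in>I. \<Sum>\<eta>\<in>Z. F (\<eta>, x) * of_real (v i \<eta>))"
    by (simp add: s_def sum_distrib_left sum.swap[of _ Z])
  then have "(\<Sum>\<eta>\<in>Z. F (\<eta>, x) * of_real (s \<eta>)) = 0" by (simp add: Fv)
  moreover have "(\<Sum>\<eta>\<in>Z. F (\<eta>, x) * of_real (r \<eta>)) =
      (\<Sum>\<eta>\<in>Z. if \<eta> = \<zeta> then F (\<eta>, x) else 0) - (\<Sum>\<eta>\<in>Z. F (\<eta>, x) * of_real (s \<eta>))"
    by (subst sum_subtractf[symmetric], intro sum.cong) (auto simp: r_def algebra_simps)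
  ultimately have "F (\<zeta>, x) = (\<Sum>\<eta>\<in>Z. F (\<eta>, x) * of_real (r \<eta>))" using Z by simp
  then have "cmod (F (\<zeta>, x)) \<le> (\<Sum>\<eta>\<in>Z. cmod (F (\<eta>, x) * of_real (r \<eta>)))" by (simp add: norm_sum)
  then have "(cmod (F (\<zeta>, x)))\<^sup>2 \<le> (\<Sum>\<eta>\<in>Z. cmod (F (\<eta>, x)) * \<bar>r \<eta>\<bar>)\<^sup>2"
    by (intro power_mono) (auto simp: norm_mult)
  also have "\<dots> \<le> (\<Sum>\<eta>\<in>Z. (cmod (F (\<eta>, x)))\<^sup>2) * (\<Sum>\<eta>\<in>Z. \<bar>r \<eta>\<bar>\<^sup>2)"
    by (rule Cauchy_Schwarz_ineq_sum)
  also have "\<dots> = (\<Sum>w\<in>Z \<times> {x}. (cmod (F w))\<^sup>2) * (1 - W)"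
    by (simp add: rr sum.cartesian_product')
  also have "\<dots> \<le> (ell2_norm (carrier K) F)\<^sup>2 * (1 - W)"
  proof (rule mult_right_mono)
    show "(\<Sum>w\<in>Z \<times> {x}. (cmod (F w))\<^sup>2) \<le> (ell2_norm (carrier K) F)\<^sup>2"
      using Z x by (intro ell2_finite_sum_le[OF F]) (auto simp: carrier_K)
    have "0 \<le> (\<Sum>\<eta>\<in>Z. (r \<eta>)\<^sup>2)" by (intro sum_nonneg) auto
    then show "0 \<le> 1 - W" by (simp add: rr)
  qed
  finally show ?thesis by (simp add: W_def)
qed

end

section \<open>Finite percolation clusters\<close>

context lamplighter_walk
begin

abbreviation edges where "edges \<equiv> cayley_edges G (set_pmf \<mu>)"
abbreviation shapes where "shapes \<equiv> cluster_shapes G (set_pmf \<mu>)"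

lemma supp_inv: "s \<in> set_pmf \<mu> \<Longrightarrow> inv\<^bsub>G\<^esub> s \<in> set_pmf \<mu>"
  using sym_mu supp_G by (auto simp: set_pmf_iff)

text \<open>Edges are unoriented; symmetry of the support allows an edge to be tested from either
  endpoint.\<close>

lemma edge_iff:
  assumes "x \<in> carrier G" "y \<in> carrier G"
  shows "{x, y} \<in> edges \<longleftrightarrow> inv\<^bsub>G\<^esub> x \<otimes>\<^bsub>G\<^esub> y \<in> set_pmf \<mu>"
proof
  assume "{x, y} \<in> edges"
  then obtain u s where u: "{x, y} = {u, u \<otimes>\<^bsub>G\<^esub> s}" "u \<in> carrier G" "s \<in> set_pmf \<mu>"
    by (auto simp: cayley_edges_def)
  then have s: "s \<in> carrier G" using supp_G by auto
  have 1: "inv\<^bsub>G\<^esub> u \<otimes>\<^bsub>G\<^esub> (u \<otimes>\<^bsub>G\<^esub> s) = s" using u s by (simp flip: G.m_assoc)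
  have 2: "inv\<^bsub>G\<^esub> (u \<otimes>\<^bsub>G\<^esub> s) \<otimes>\<^bsub>G\<^esub> u = inv\<^bsub>G\<^esub> s" using u s by (simp add: G.inv_mult_group G.m_assoc)
  from u(1) have "x = u \<and> y = u \<otimes>\<^bsub>G\<^esub> s \<or> y = u \<and> x = u \<otimes>\<^bsub>G\<^esub> s"
    by (auto simp: doubleton_eq_iff)
  then show "inv\<^bsub>G\<^esub> x \<otimes>\<^bsub>G\<^esub> y \<in> set_pmf \<mu>" using 1 2 u supp_inv by auto
next
  assume s: "inv\<^bsub>G\<^esub> x \<otimes>\<^bsub>G\<^esub> y \<in> set_pmf \<mu>"
  have "x \<otimes>\<^bsub>G\<^esub> (inv\<^bsub>G\<^esub> x \<otimes>\<^bsub>G\<^esub> y) = y" using assms by (simp flip: G.m_assoc)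
  then show "{x, y} \<in> edges"
    using s assms unfolding cayley_edges_def by (intro CollectI exI[of _ x] exI[of _ "inv\<^bsub>G\<^esub> x \<otimes>\<^bsub>G\<^esub> y"]) auto
qed

text \<open>Determining that the cluster is empty requires \<open>\<one>\<^bsub>G\<^esub>\<close> to be closed.\<close>
definition boundary :: "'g set \<Rightarrow> 'g set" where
  "boundary A = (if A = {} then {\<one>\<^bsub>G\<^esub>}
     else {x \<in> carrier G - A. \<exists>y\<in>A. inv\<^bsub>G\<^esub> y \<otimes>\<^bsub>G\<^esub> x \<in> set_pmf \<mu>})"

lemma boundary_carrier: "boundary A \<subseteq> carrier G"
  by (auto simp: boundary_def)

lemma boundary_disjoint: "A \<inter> boundary A = {}"
  by (auto simp: boundary_def)

lemma finite_boundary: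
  assumes "finite A" "A \<subseteq> carrier G"
  shows "finite (boundary A)"
proof (cases "A = {}")
  case False
  have "boundary A \<subseteq> (\<lambda>(y, s). y \<otimes>\<^bsub>G\<^esub> s) ` (A \<times> set_pmf \<mu>)"
  proof
    fix x assume "x \<in> boundary A"
    then obtain y where y: "x \<in> carrier G" "y \<in> A" "inv\<^bsub>G\<^esub> y \<otimes>\<^bsub>G\<^esub> x \<in> set_pmf \<mu>"
      using False by (auto simp: boundary_def)
    then have "y \<otimes>\<^bsub>G\<^esub> (inv\<^bsub>G\<^esub> y \<otimes>\<^bsub>G\<^esub> x) = x" using assms by (simp add: subset_iff flip: G.m_assoc)
    then show "x \<in> (\<lambda>(y, s). y \<otimes>\<^bsub>G\<^esub> s) ` (A \<times> set_pmf \<mu>)"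
      using y by (intro image_eqI[of _ _ "(y, inv\<^bsub>G\<^esub> y \<otimes>\<^bsub>G\<^esub> x)"]) auto
  qed
  then show ?thesis using assms finite_supp by (auto intro: finite_subset)
qed (simp add: boundary_def)

lemma shapes_finite: "A \<in> shapes \<Longrightarrow> finite A" "A \<in> shapes \<Longrightarrow> A \<subseteq> carrier G"
  by (auto simp: cluster_shapes_def)

text \<open>For a shape \<open>A\<close> this is the event that the cluster equals \<open>A\<close>,
  expressed as a condition on finitely many sites.\<close>

definition fits :: "'g set \<Rightarrow> ('g \<Rightarrow> bool) \<Rightarrow> bool" where
  "fits A \<omega> \<longleftrightarrow> (\<forall>v\<in>A. \<omega> v) \<and> (\<forall>v\<in>boundary A. \<not> \<omega> v)"

lemma cluster_alt:
  "x \<in> cluster G (set_pmf \<mu>) \<omega> \<longleftrightarrow> \<omega> \<one>\<^bsub>G\<^esub> \<and> x \<in> carrier G \<and> \<omega> x \<and>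
     (\<lambda>u v. u \<in> {v \<in> carrier G. \<omega> v} \<and> v \<in> {v \<in> carrier G. \<omega> v} \<and> {u, v} \<in> edges)\<^sup>*\<^sup>* \<one>\<^bsub>G\<^esub> x"
  by (auto simp: cluster_def joined_in_def)

lemma cluster_step:
  assumes "u \<in> cluster G (set_pmf \<mu>) \<omega>" "v \<in> carrier G" "\<omega> v" "{u, v} \<in> edges"
  shows "v \<in> cluster G (set_pmf \<mu>) \<omega>"
  using assms unfolding cluster_alt by (auto intro: rtranclp.rtrancl_into_rtrancl)

lemma fits_cluster: "fits (cluster G (set_pmf \<mu>) \<omega>) \<omega>"
  unfolding fits_def
proof (intro conjI ballI)
  let ?C = "cluster G (set_pmf \<mu>) \<omega>"
  show "\<omega> v" if "v \<in> ?C" for v using that by (simp add: cluster_alt)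
  fix v assume v: "v \<in> boundary ?C"
  show "\<not> \<omega> v"
  proof (cases "?C = {}")
    case True
    then have "v = \<one>\<^bsub>G\<^esub>" using v by (simp add: boundary_def)
    moreover have "\<one>\<^bsub>G\<^esub> \<in> ?C" if "\<omega> \<one>\<^bsub>G\<^esub>" using that by (simp add: cluster_alt)
    ultimately show ?thesis using True by blast
  next
    case False
    then obtain y where y: "v \<in> carrier G" "v \<notin> ?C" "y \<in> ?C" "inv\<^bsub>G\<^esub> y \<otimes>\<^bsub>G\<^esub> v \<in> set_pmf \<mu>"
      using v by (auto simp: boundary_def)
    then have "{y, v} \<in> edges" by (subst edge_iff) (auto simp: cluster_alt)
    then show ?thesis using cluster_step[OF y(3,1)] y(2) by blast
  qed
qed

text \<open>An open path from the identity never leaves the cluster, and two such paths, one of them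
  reversed, join any two of its points.\<close>

lemma cluster_in_shapes:
  assumes fin: "finite (cluster G (set_pmf \<mu>) \<omega>)"
  shows "cluster G (set_pmf \<mu>) \<omega> \<in> shapes"
proof (cases "cluster G (set_pmf \<mu>) \<omega> = {}")
  case False
  define C where "C = cluster G (set_pmf \<mu>) \<omega>"
  define step where "step u v \<longleftrightarrow> u \<in> C \<and> v \<in> C \<and> {u, v} \<in> edges" for u v
  have one: "\<one>\<^bsub>G\<^esub> \<in> C" using False by (auto simp: C_def cluster_alt)
  have conn: "step\<^sup>*\<^sup>* \<one>\<^bsub>G\<^esub> x" if "x \<in> C" for x
  proof -
    have "(\<lambda>u v. u \<in> {v \<in> carrier G. \<omega> v} \<and> v \<in> {v \<in> carrier G. \<omega> v} \<and> {u, v} \<in> edges)\<^sup>*\<^sup>* \<one>\<^bsub>G\<^esub> x"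
      using that by (simp add: C_def cluster_alt)
    then have "step\<^sup>*\<^sup>* \<one>\<^bsub>G\<^esub> x \<and> x \<in> C"
    proof induction
      case (step u v)
      then have "v \<in> C" using cluster_step[of u \<omega> v] by (simp add: C_def)
      then show ?case using step by (auto simp: step_def intro: rtranclp.rtrancl_into_rtrancl)
    qed (use one in simp)
    then show ?thesis by simp
  qed
  have "symp step" by (auto simp: symp_def step_def insert_commute)
  then have sym: "step\<^sup>*\<^sup>* x y" if "step\<^sup>*\<^sup>* y x" for x y
    using that symp_rtranclp sympD by metis
  have "joined_in edges C x y" if "x \<in> C" "y \<in> C" for x y
    using rtranclp_trans[OF sym[OF conn[OF that(1)]] conn[OF that(2)]] that
    unfolding joined_in_def step_def by simp
  then have "C \<in> shapes"
    using fin one by (auto simp: cluster_shapes_def C_def cluster_alt)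
  then show ?thesis by (simp add: C_def)
qed (simp add: cluster_shapes_def)

text \<open>Connectedness of \<open>A\<close> puts all of it into the cluster. Conversely, the first
  step of an open path out of \<open>A\<close> would land on the boundary, which is closed.\<close>

lemma cluster_eq_if_fits:
  assumes A: "A \<in> shapes" and f: "fits A \<omega>"
  shows "cluster G (set_pmf \<mu>) \<omega> = A"
proof (cases "A = {}")
  case True
  then have "\<not> \<omega> \<one>\<^bsub>G\<^esub>" using f by (simp add: fits_def boundary_def)
  then show ?thesis using True by (auto simp: cluster_alt)
next
  case False
  then have one: "\<one>\<^bsub>G\<^esub> \<in> A" and AG: "A \<subseteq> carrier G"
    and conn: "\<And>x y. x \<in> A \<Longrightarrow> y \<in> A \<Longrightarrow> joined_in edges A x y"
    using A by (auto simp: cluster_shapes_def)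
  have open_A: "\<omega> v" if "v \<in> A" for v using f that by (simp add: fits_def)
  show ?thesis
  proof
    show "A \<subseteq> cluster G (set_pmf \<mu>) \<omega>"
    proof
      fix x assume x: "x \<in> A"
      have "(\<lambda>u v. u \<in> A \<and> v \<in> A \<and> {u, v} \<in> edges)\<^sup>*\<^sup>* \<one>\<^bsub>G\<^esub> x"
        using conn[OF one x] by (simp add: joined_in_def)
      then have "(\<lambda>u v. u \<in> {v \<in> carrier G. \<omega> v} \<and> v \<in> {v \<in> carrier G. \<omega> v} \<and> {u, v} \<in> edges)\<^sup>*\<^sup>* \<one>\<^bsub>G\<^esub> x"
        by (rule mono_rtranclp[rule_format, rotated]) (use AG open_A in auto)
      then show "x \<in> cluster G (set_pmf \<mu>) \<omega>" using x one AG open_A by (auto simp: cluster_alt)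
    qed
    show "cluster G (set_pmf \<mu>) \<omega> \<subseteq> A"
    proof
      fix x assume "x \<in> cluster G (set_pmf \<mu>) \<omega>"
      then have "(\<lambda>u v. u \<in> {v \<in> carrier G. \<omega> v} \<and> v \<in> {v \<in> carrier G. \<omega> v} \<and> {u, v} \<in> edges)\<^sup>*\<^sup>* \<one>\<^bsub>G\<^esub> x"
        by (simp add: cluster_alt)
      then show "x \<in> A"
      proof induction
        case (step u v)
        show ?case
        proof (rule ccontr)
          assume "v \<notin> A"
          moreover have "inv\<^bsub>G\<^esub> u \<otimes>\<^bsub>G\<^esub> v \<in> set_pmf \<mu>" using step edge_iff[of u v] by simp
          ultimately have "v \<in> boundary A" using step by (auto simp: boundary_def)
          then show False using f step by (auto simp: fits_def)
        qed
      qed (rule one)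
    qed
  qed
qed

text \<open>If neither shape met the boundary of the other, the configuration open exactly on their
  union would fit both, and its cluster would be two different sets.\<close>

lemma shapes_conflict:
  assumes "A \<in> shapes" "A' \<in> shapes" "A \<noteq> A'"
  shows "A \<inter> boundary A' \<noteq> {} \<or> A' \<inter> boundary A \<noteq> {}"
proof (rule ccontr)
  assume *: "\<not> ?thesis"
  let ?\<omega> = "\<lambda>v. v \<in> A \<union> A'"
  have "fits A ?\<omega>" "fits A' ?\<omega>" using * boundary_disjoint[of A] boundary_disjoint[of A'] by (auto simp: fits_def)
  then show False using assms cluster_eq_if_fits by metis
qed

section \<open>Probabilities of cluster shapes\<close>

lemma prob_fits:
  assumes A: "finite A" "A \<subseteq> carrier G"
  defines "M \<equiv> site_percolation G (1 / real (order H))"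
  shows "{\<omega> \<in> space M. fits A \<omega>} \<in> sets M"
    "measure M {\<omega> \<in> space M. fits A \<omega>} = weight A (boundary A)"
proof -
  let ?p = "1 / real (order H)"
  let ?B = "\<lambda>_ :: 'g. measure_pmf (bernoulli_pmf ?p)"
  interpret P: product_prob_space ?B "carrier G"
    by unfold_locales
  have p: "?p \<in> {0..1}" using order_H by auto
  define J where "J = A \<union> boundary A"
  define X where "X v = (if v \<in> A then {True} else {False})" for v
  have J: "finite J" "J \<subseteq> carrier G"
    using A finite_boundary[OF A] boundary_carrier by (auto simp: J_def)
  have eq: "{\<omega> \<in> space M. fits A \<omega>} = prod_emb (carrier G) ?B J (PiE J X)"
  proof -
    have "fits A \<omega> \<longleftrightarrow> (\<forall>v\<in>J. \<omega> v \<in> X v)" for \<omega>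
      using boundary_disjoint[of A] by (auto simp: fits_def J_def X_def)
    then have eq: "\<omega> \<in> {\<omega> \<in> space M. fits A \<omega>} \<longleftrightarrow> \<omega> \<in> prod_emb (carrier G) ?B J (PiE J X)" for \<omega>
      using J by (simp add: M_def site_percolation_def space_PiM prod_emb_iff PiE_iff)
    show ?thesis by (rule Set.set_eqI) (rule eq)
  qed
  show "{\<omega> \<in> space M. fits A \<omega>} \<in> sets M"
    unfolding eq unfolding M_def site_percolation_def using J by (intro sets_PiM_I) auto
  have "emeasure M {\<omega> \<in> space M. fits A \<omega>} = (\<Prod>v\<in>J. emeasure (?B v) (X v))"
    unfolding eq unfolding M_def site_percolation_def using J by (intro P.emeasure_PiM_emb) auto
  also have "\<dots> = (\<Prod>v\<in>J. ennreal (if v \<in> A then ?p else if v \<in> boundary A then 1 - ?p else 1))"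
    using p by (intro prod.cong refl) (auto simp: X_def J_def emeasure_pmf_single)
  also have "\<dots> = ennreal (\<Prod>v\<in>J. if v \<in> A then ?p else if v \<in> boundary A then 1 - ?p else 1)"
    using p by (intro prod_ennreal) auto
  also have "\<dots> = ennreal (weight A (boundary A))"
    using J by (subst prod_weight) (auto simp: J_def boundary_disjoint)
  finally show "measure M {\<omega> \<in> space M. fits A \<omega>} = weight A (boundary A)"
    using weight_pos[of A "boundary A"] by (simp add: measure_def)
qed

lemma countable_shapes: "countable shapes"
  by (rule countable_subset[OF _ countable_Collect_finite_subset[OF countable_G]])
     (auto simp: cluster_shapes_def)

text \<open>The percolation hypothesis enters here. Almost every configuration fits one of countably
  many shapes; continuity from below selects a finite subfamily, and the union bound passes to the
  sum of the weights.\<close>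

lemma weights_exhaust:
  assumes perc: "percolation_prob G (set_pmf \<mu>) (1 / real (order H)) = 0" and \<epsilon>: "\<epsilon> > 0"
  shows "\<exists>I. finite I \<and> I \<subseteq> shapes \<and> 1 - \<epsilon> < (\<Sum>A\<in>I. weight A (boundary A))"
proof -
  define M where "M = site_percolation G (1 / real (order H))"
  interpret P: product_prob_space "\<lambda>_ :: 'g. measure_pmf (bernoulli_pmf (1 / real (order H)))" "carrier G"
    by unfold_locales
  have "prob_space M" unfolding M_def site_percolation_def by (rule P.P.prob_space_axioms)
  then interpret M: prob_space M .
  define E where "E A = {\<omega> \<in> space M. fits A \<omega>}" for A
  have E: "E A \<in> sets M" "measure M (E A) = weight A (boundary A)" if "A \<in> shapes" for A
    using prob_fits[OF shapes_finite[OF that]] by (auto simp: E_def M_def)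
  define f where "f = from_nat_into shapes"
  \<comment> \<open>\<open>shapes\<close> is thereby nonempty, so \<open>from_nat_into\<close>
    enumerates exactly its elements.\<close>
  have "{} \<in> shapes" by (simp add: cluster_shapes_def)
  then have f: "range f = shapes" unfolding f_def using countable_shapes by (intro range_from_nat_into) auto
  then have fs: "f n \<in> shapes" for n by auto
  have compl: "{\<omega> \<in> space M. infinite (cluster G (set_pmf \<mu>) \<omega>)} = space M - (\<Union>n. E (f n))"
  proof -
    have "finite (cluster G (set_pmf \<mu>) \<omega>) \<longleftrightarrow> (\<exists>n. fits (f n) \<omega>)" for \<omega>
    proof
      assume "finite (cluster G (set_pmf \<mu>) \<omega>)"
      then have "cluster G (set_pmf \<mu>) \<omega> \<in> range f" using cluster_in_shapes f by simp
      then show "\<exists>n. fits (f n) \<omega>" using fits_cluster[of \<omega>] by auto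
    next
      assume "\<exists>n. fits (f n) \<omega>"
      then obtain n where "fits (f n) \<omega>" by blast
      then show "finite (cluster G (set_pmf \<mu>) \<omega>)"
        using cluster_eq_if_fits[OF fs] shapes_finite(1)[OF fs] by metis
    qed
    then show ?thesis by (auto simp: E_def)
  qed
  have un: "(\<Union>n. E (f n)) \<in> sets M" using E fs by auto
  have "measure M (space M - (\<Union>n. E (f n))) = 0"
    using perc compl by (simp add: percolation_prob_def M_def)
  then have one: "measure M (\<Union>n. E (f n)) = 1" using M.prob_compl[OF un] by simp
  have "(\<lambda>n. measure M (\<Union>i\<le>n. E (f i))) \<longlonglongrightarrow> measure M (\<Union>n. \<Union>i\<le>n. E (f i))"
  proof (rule M.finite_Lim_measure_incseq)
    show "range (\<lambda>n. \<Union>i\<le>n. E (f i)) \<subseteq> sets M" using E fs by auto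
    show "incseq (\<lambda>n. \<Union>i\<le>n. E (f i))" by (intro monoI UN_mono) auto
  qed
  moreover have "(\<Union>n. \<Union>i\<le>n. E (f i)) = (\<Union>n. E (f n))" by auto
  ultimately have "(\<lambda>n. measure M (\<Union>i\<le>n. E (f i))) \<longlonglongrightarrow> 1" using one by simp
  then have "eventually (\<lambda>n. 1 - \<epsilon> < measure M (\<Union>i\<le>n. E (f i))) sequentially"
    using \<epsilon> by (intro order_tendstoD) auto
  then obtain n where n: "1 - \<epsilon> < measure M (\<Union>i\<le>n. E (f i))"
    by (auto simp: eventually_sequentially)
  let ?I = "f ` {..n}"
  have "measure M (\<Union>i\<le>n. E (f i)) = measure M (\<Union>A\<in>?I. E A)" by (simp add: image_image)
  also have "\<dots> \<le> (\<Sum>A\<in>?I. measure M (E A))" using E fs by (intro measure_UNION_le) auto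
  also have "\<dots> = (\<Sum>A\<in>?I. weight A (boundary A))" using E fs by (intro sum.cong) auto
  finally show ?thesis using n fs by (intro exI[of _ ?I]) auto
qed

section \<open>Totality of the eigenfunctions\<close>

lemma transition_sym:
  assumes "x \<in> carrier G" "y \<in> carrier G"
  shows "transition G \<mu> x y = transition G \<mu> y x"
  using sym_mu[of "inv\<^bsub>G\<^esub> x \<otimes>\<^bsub>G\<^esub> y"] assms by (simp add: transition_def G.inv_mult_group)

lemma transition_translate:
  assumes "x \<in> carrier G" "y \<in> carrier G" "z \<in> carrier G"
  shows "transition G \<mu> (x \<otimes>\<^bsub>G\<^esub> y) (x \<otimes>\<^bsub>G\<^esub> z) = transition G \<mu> y z"
proof -
  have "inv\<^bsub>G\<^esub> x \<otimes>\<^bsub>G\<^esub> (x \<otimes>\<^bsub>G\<^esub> z) = z" using assms by (simp flip: G.m_assoc)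
  then show ?thesis using assms by (simp add: transition_def G.inv_mult_group G.m_assoc)
qed

lemma transition_boundary:
  assumes "A \<noteq> {}" "x \<in> carrier G - A - boundary A" "y \<in> A" "A \<subseteq> carrier G"
  shows "transition G \<mu> x y = 0"
proof -
  have "inv\<^bsub>G\<^esub> y \<otimes>\<^bsub>G\<^esub> x \<notin> set_pmf \<mu>" using assms by (auto simp: boundary_def)
  then show ?thesis
    using transition_sym[of x y] assms by (auto simp: transition_def set_pmf_iff)
qed

section \<open>Truncated walks and their eigenvalues\<close>

lemma truncated_kernel:
  assumes A: "finite A" "A \<subseteq> carrier G"
  shows "symmetric_kernel (carrier G) (truncated_transition G \<mu> A)"
proof
  show "countable (carrier G)" by (rule countable_G)
  show "truncated_transition G \<mu> A x y = truncated_transition G \<mu> A y x"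
    if "x \<in> carrier G" "y \<in> carrier G" for x y
    using that transition_sym by (auto simp: truncated_transition_def)
  show "0 \<le> truncated_transition G \<mu> A x y" for x y
    by (simp add: truncated_transition_def transition_def)
  show "finite {y \<in> carrier G. truncated_transition G \<mu> A x y \<noteq> 0}" for x
    using A(1) by (rule rev_finite_subset) (auto simp: truncated_transition_def)
  show "(\<Sum>y | y \<in> carrier G \<and> truncated_transition G \<mu> A x y \<noteq> 0. truncated_transition G \<mu> A x y) \<le> 1"
    if x: "x \<in> carrier G" for x
  proof -
    have inj: "inj_on (\<lambda>y. inv\<^bsub>G\<^esub> x \<otimes>\<^bsub>G\<^esub> y) A" using x A by (auto simp: inj_on_def subset_iff)
    have "(\<Sum>y | y \<in> carrier G \<and> truncated_transition G \<mu> A x y \<noteq> 0. truncated_transition G \<mu> A x y)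
        = (\<Sum>y\<in>A. truncated_transition G \<mu> A x y)"
      using A by (intro sum.mono_neutral_left) (auto simp: truncated_transition_def)
    also have "\<dots> \<le> (\<Sum>y\<in>A. pmf \<mu> (inv\<^bsub>G\<^esub> x \<otimes>\<^bsub>G\<^esub> y))"
      by (intro sum_mono) (simp add: truncated_transition_def transition_def)
    also have "\<dots> = (\<Sum>z\<in>(\<lambda>y. inv\<^bsub>G\<^esub> x \<otimes>\<^bsub>G\<^esub> y) ` A. pmf \<mu> z)" by (simp add: sum.reindex[OF inj])
    also have "\<dots> = measure (measure_pmf \<mu>) ((\<lambda>y. inv\<^bsub>G\<^esub> x \<otimes>\<^bsub>G\<^esub> y) ` A)"
      using A by (simp add: measure_measure_pmf_finite)
    finally show ?thesis using measure_pmf.prob_le_1 order_trans by blast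
  qed
qed

lemma truncated_operator_kernel:
  assumes "A \<subseteq> carrier G"
  shows "truncated_operator G \<mu> A = kernel_op (carrier G) (truncated_transition G \<mu> A)"
  using assms by (intro ext)
    (auto simp: truncated_operator_def kernel_op_def truncated_transition_def intro!: infsum_0)

lemma truncated_operator_eq:
  assumes "finite A" "A \<subseteq> carrier G"
  shows "truncated_operator G \<mu> A f x = (if x \<in> A then \<Sum>y\<in>A. of_real (transition G \<mu> x y) * f y else 0)"
proof -
  have "truncated_operator G \<mu> A f x =
      (\<Sum>\<^sub>\<infinity>y\<in>A. of_real (truncated_transition G \<mu> A x y) * f y)"
    unfolding truncated_operator_def
    by (rule infsum_cong_neutral) (use assms in \<open>auto simp: truncated_transition_def\<close>)
  then show ?thesis using assms by (auto simp: truncated_transition_def)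
qed

text \<open>Replaces the absence of a bounded inverse by an eigenvector. One direction extracts
  eigenfunctions from \<open>Lambda\<close>, the other shows that an eigenvalue found for a cluster
  belongs to \<open>Lambda\<close>.\<close>

lemma truncated_spectrum_iff:
  assumes A: "finite A" "A \<subseteq> carrier G"
  shows "c \<in> op_spectrum (carrier G) (truncated_operator G \<mu> A) \<longleftrightarrow>
    (\<exists>\<phi>\<in>finsupp (carrier G). \<phi> \<noteq> (\<lambda>x. 0) \<and> truncated_operator G \<mu> A \<phi> = (\<lambda>x. c * \<phi> x))"
proof -
  interpret S: symmetric_kernel "carrier G" "truncated_transition G \<mu> A" by (rule truncated_kernel[OF A])
  have "op_spectrum (carrier G) S.T = {c. \<exists>u\<in>S.eigenspace c. u \<noteq> (\<lambda>x. 0)}"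
    using A by (rule S.finite_rank_spectrum) (simp add: truncated_transition_def)
  then show ?thesis by (auto simp: S.eigenspace_def truncated_operator_kernel[OF A(2)])
qed

text \<open>The range of the truncated operator lives on \<open>A\<close>, hence so does an
  eigenvector for a nonzero eigenvalue. Zero is kept apart, since its eigenvectors may live off
  \<open>A\<close>.\<close>

lemma Lambda_cases:
  assumes "c \<in> Lambda G \<mu>"
  obtains "c = 0"
  | A \<phi> where "A \<in> shapes" "A \<noteq> {}" "\<And>x. x \<notin> A \<Longrightarrow> \<phi> x = 0" "\<phi> \<noteq> (\<lambda>x. 0)"
      "\<And>x. x \<in> A \<Longrightarrow> (\<Sum>y\<in>A. of_real (transition G \<mu> x y) * \<phi> y) = c * \<phi> x"
proof (cases "c = 0")
  case False
  then obtain A where A: "A \<in> shapes" "A \<noteq> {}" "c \<in> op_spectrum (carrier G) (truncated_operator G \<mu> A)"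
    using assms by (auto simp: Lambda_def)
  then obtain \<phi> where \<phi>: "\<phi> \<noteq> (\<lambda>x. 0)" "truncated_operator G \<mu> A \<phi> = (\<lambda>x. c * \<phi> x)"
    using truncated_spectrum_iff[OF shapes_finite[OF A(1)]] by blast
  have eq: "(if x \<in> A then \<Sum>y\<in>A. of_real (transition G \<mu> x y) * \<phi> y else 0) = c * \<phi> x" for x
    using fun_cong[OF \<phi>(2), of x] by (simp add: truncated_operator_eq[OF shapes_finite[OF A(1)]])
  show thesis
  proof (rule that(2)[OF A(1,2) _ \<phi>(1)])
    show "\<phi> x = 0" if "x \<notin> A" for x using eq[of x] that False by simp
    show "(\<Sum>y\<in>A. of_real (transition G \<mu> x y) * \<phi> y) = c * \<phi> x" if "x \<in> A" for x
      using eq[of x] that by simp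
  qed
qed (rule that(1))

lemma exists_config: "(\<lambda>x\<in>carrier G. \<one>\<^bsub>H\<^esub>) \<in> configs"
  by (auto simp: configs_iff cong: conj_cong)

text \<open>Zero is realised by a closed site, other values by a cluster. At its own centre \<zeta>
  the wave takes the value \<open>weight\<close>, which is positive, so the eigenfunction does not
  vanish.\<close>

lemma Lambda_eigenvalue:
  assumes "c \<in> Lambda G \<mu>"
  shows "\<exists>u\<in>R.eigenspace c. u \<noteq> (\<lambda>x. 0)"
  using assms
proof (cases rule: Lambda_cases)
  case 1
  define \<zeta> where "\<zeta> = (\<lambda>x\<in>carrier G. \<one>\<^bsub>H\<^esub>)"
  have \<zeta>: "\<zeta> \<in> configs" unfolding \<zeta>_def by (rule exists_config)
  let ?F = "tensor (\<lambda>y. of_bool (y = \<one>\<^bsub>G\<^esub>)) (wave {} {\<one>\<^bsub>G\<^esub>} \<zeta>)"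
  have "?F (\<zeta>, \<one>\<^bsub>G\<^esub>) = of_real (weight {} {\<one>\<^bsub>G\<^esub>})" using \<zeta> by (simp add: tensor_def wave_self)
  then have "?F \<noteq> (\<lambda>x. 0)" using weight_pos[of "{}" "{\<one>\<^bsub>G\<^esub>}"] by auto
  moreover have "?F \<in> R.eigenspace 0" using \<zeta> by (intro closed_site_eigenfunction) auto
  ultimately show ?thesis using 1 by blast
next
  case (2 A \<phi>)
  define \<zeta> where "\<zeta> = (\<lambda>x\<in>carrier G. \<one>\<^bsub>H\<^esub>)"
  have \<zeta>: "\<zeta> \<in> configs" unfolding \<zeta>_def by (rule exists_config)
  note A = shapes_finite[OF 2(1)]
  let ?F = "tensor \<phi> (wave A (boundary A) \<zeta>)"
  obtain x where x: "\<phi> x \<noteq> 0" using 2(4) by auto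
  have "?F (\<zeta>, x) = \<phi> x * of_real (weight A (boundary A))"
    using \<zeta> A by (simp add: tensor_def wave_self finite_boundary boundary_disjoint)
  then have "?F \<noteq> (\<lambda>x. 0)" using x weight_pos[of A "boundary A"] by auto
  moreover have "?F \<in> R.eigenspace c"
    using A 2 \<zeta> transition_boundary[OF 2(2)]
    by (intro cluster_eigenfunction finite_boundary boundary_carrier boundary_disjoint) auto
  ultimately show ?thesis by blast
qed

section \<open>Vanishing of functions orthogonal to all eigenfunctions\<close>

lemma translate_inj: "x \<in> carrier G \<Longrightarrow> inj_on (\<lambda>y. x \<otimes>\<^bsub>G\<^esub> y) (carrier G)"
  by (auto simp: inj_on_def)

text \<open>Shapes contain the identity, so a walker at \<open>x\<close> sees their left translates
  by \<open>x\<close>. Pairing \<open>F\<close> with the wave in the lamp variable gives \<psi>. If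
  \<psi> were nonzero at \<open>x\<close>, some eigenvector on the cluster would pair with it
  nontrivially and yield an eigenfunction not orthogonal to \<open>F\<close>.\<close>

lemma cluster_component_orthogonal:
  assumes orth: "\<And>c u. c \<in> Lambda G \<mu> \<Longrightarrow> u \<in> R.eigenspace c \<Longrightarrow> ell2_inner (carrier K) F u = 0"
    and x: "x \<in> carrier G" and \<zeta>: "\<zeta> \<in> configs" and A: "A \<in> shapes"
  defines "A' \<equiv> (\<lambda>y. x \<otimes>\<^bsub>G\<^esub> y) ` A" and "B' \<equiv> (\<lambda>y. x \<otimes>\<^bsub>G\<^esub> y) ` boundary A"
  shows "ell2_inner (carrier K) F (tensor (\<lambda>y. of_bool (y = x)) (wave A' B' \<zeta>)) = 0"
proof (cases "A = {}")
  case True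
  then have "A' = {}" "B' = {x}" using x by (auto simp: A'_def B'_def boundary_def)
  then show ?thesis
    using orth[OF _ closed_site_eigenfunction[OF x \<zeta>]] by (simp add: Lambda_def)
next
  case False
  note Af = shapes_finite[OF A]
  have one: "\<one>\<^bsub>G\<^esub> \<in> A" using A False by (auto simp: cluster_shapes_def)
  let ?l = "\<lambda>y. x \<otimes>\<^bsub>G\<^esub> y"
  have A': "finite A'" "A' \<subseteq> carrier G" using Af x by (auto simp: A'_def)
  have B': "finite B'" "B' \<subseteq> carrier G"
    using finite_boundary[OF Af] boundary_carrier x by (auto simp: B'_def)
  have disj: "A' \<inter> B' = {}"
    unfolding A'_def B'_def using inj_on_image_Int[OF translate_inj[OF x] Af(2) boundary_carrier[of A]]
      boundary_disjoint[of A] by auto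
  have injA: "inj_on ?l A" using inj_on_subset[OF translate_inj[OF x] Af(2)] .
  define D where "D = A' \<union> B'"
  have D: "finite D" "D \<subseteq> carrier G" using A' B' by (auto simp: D_def)
  define \<psi> where "\<psi> y = (\<Sum>\<eta>\<in>agree_off D \<zeta>. F (\<eta>, y) * of_real (wave A' B' \<zeta> \<eta>))" for y
  have inner: "ell2_inner (carrier K) F (tensor \<phi> (wave A' B' \<zeta>)) = (\<Sum>y\<in>C. \<psi> y * cnj (\<phi> y))"
    if "\<And>y. y \<notin> C \<Longrightarrow> \<phi> y = 0" "finite C" "C \<subseteq> carrier G" for C \<phi>
    unfolding \<psi>_def using wave_outside D \<zeta> that by (intro inner_tensor) (auto simp: D_def)
  have "\<psi> x = 0"
  proof (rule ccontr)
    assume "\<psi> x \<noteq> 0"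
    then have px: "\<psi> (?l \<one>\<^bsub>G\<^esub>) \<noteq> 0" using x by simp
    have "\<exists>\<phi> c. (\<forall>z. z \<notin> A \<longrightarrow> \<phi> z = 0) \<and>
        (\<forall>z\<in>A. (\<Sum>y\<in>A. of_real (transition G \<mu> z y) * \<phi> y) = c * \<phi> z) \<and>
        (\<Sum>z\<in>A. \<psi> (?l z) * cnj (\<phi> z)) \<noteq> 0"
      by (rule exists_nonorthogonal_eigenvector[where k = "transition G \<mu>" and \<psi> = "\<lambda>z. \<psi> (?l z)",
            OF Af(1) transition_sym one px]) (use Af in auto)
    then obtain \<phi> c where \<phi>: "\<And>z. z \<notin> A \<Longrightarrow> \<phi> z = 0"
      "\<And>z. z \<in> A \<Longrightarrow> (\<Sum>y\<in>A. of_real (transition G \<mu> z y) * \<phi> y) = c * \<phi> z"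
      "(\<Sum>z\<in>A. \<psi> (?l z) * cnj (\<phi> z)) \<noteq> 0" by blast
    have "\<phi> \<noteq> (\<lambda>z. 0)" using \<phi>(3) by auto
    moreover have "\<phi> \<in> finsupp (carrier G)"
      using \<phi>(1) Af by (auto simp: finsupp_def intro: finite_subset[of _ A])
    moreover have "truncated_operator G \<mu> A \<phi> = (\<lambda>z. c * \<phi> z)"
      using \<phi> by (auto simp: truncated_operator_eq[OF Af])
    ultimately have "c \<in> op_spectrum (carrier G) (truncated_operator G \<mu> A)"
      using truncated_spectrum_iff[OF Af] by blast
    then have c: "c \<in> Lambda G \<mu>" using A False by (auto simp: Lambda_def)
    \<comment> \<open>Left multiplication by \<open>x\<close> preserves transition probabilities, so
      the transported eigenvector keeps its eigenvalue \<open>c\<close>, which is already known to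
      lie in \<open>Lambda\<close>.\<close>
    define \<phi>' where "\<phi>' y = (if y \<in> A' then \<phi> (inv\<^bsub>G\<^esub> x \<otimes>\<^bsub>G\<^esub> y) else 0)" for y
    have \<phi>': "\<phi>' (?l z) = \<phi> z" if "z \<in> A" for z
    proof -
      have "inv\<^bsub>G\<^esub> x \<otimes>\<^bsub>G\<^esub> ?l z = z" using x that Af by (simp add: subset_iff flip: G.m_assoc)
      then show ?thesis using that by (auto simp: \<phi>'_def A'_def)
    qed
    have "tensor \<phi>' (wave A' B' \<zeta>) \<in> R.eigenspace c"
    proof (rule cluster_eigenfunction[OF A' _ B' disj \<zeta>])
      show "\<phi>' y = 0" if "y \<notin> A'" for y using that by (simp add: \<phi>'_def)
      fix w assume "w \<in> A'"
      then obtain z where z: "z \<in> A" "w = ?l z" by (auto simp: A'_def)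
      have "(\<Sum>y\<in>A'. of_real (transition G \<mu> w y) * \<phi>' y) =
          (\<Sum>y\<in>A. of_real (transition G \<mu> z y) * \<phi> y)"
        unfolding A'_def sum.reindex[OF injA] z(2) o_def
        using x z Af by (intro sum.cong refl) (simp add: transition_translate \<phi>' subset_iff)
      then show "(\<Sum>y\<in>A'. of_real (transition G \<mu> w y) * \<phi>' y) = c * \<phi>' w"
        using \<phi>(2) z \<phi>' by simp
    next
      fix w y assume w: "w \<in> carrier G - A' - B'" and "y \<in> A'"
      then obtain z where z: "z \<in> A" "y = ?l z" by (auto simp: A'_def)
      define w' where "w' = inv\<^bsub>G\<^esub> x \<otimes>\<^bsub>G\<^esub> w"
      have w': "w = ?l w'" "w' \<in> carrier G" using w x by (auto simp: w'_def simp flip: G.m_assoc)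
      have "w' \<in> carrier G - A - boundary A" using w w' by (auto simp: A'_def B'_def)
      then have "transition G \<mu> w' z = 0" using transition_boundary[OF False _ z(1) Af(2)] by blast
      then show "transition G \<mu> w y = 0"
        using w' z x Af by (simp add: transition_translate subset_iff)
    qed
    then have "ell2_inner (carrier K) F (tensor \<phi>' (wave A' B' \<zeta>)) = 0" by (rule orth[OF c])
    moreover have "ell2_inner (carrier K) F (tensor \<phi>' (wave A' B' \<zeta>)) = (\<Sum>y\<in>A'. \<psi> y * cnj (\<phi>' y))"
      using A' by (intro inner) (auto simp: \<phi>'_def)
    moreover have "(\<Sum>y\<in>A'. \<psi> y * cnj (\<phi>' y)) = (\<Sum>z\<in>A. \<psi> (?l z) * cnj (\<phi> z))"
      unfolding A'_def sum.reindex[OF injA] by (simp add: \<phi>')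
    ultimately show False using \<phi>(3) by simp
  qed
  then show ?thesis using x by (subst inner[of "{x}"]) auto
qed

text \<open>Finitely many shapes carry all but \<epsilon> of the weight. Their translates to
  \<open>x\<close> keep cardinalities and conflicts, so \<open>value_bound\<close> controls
  \<open>F (\<zeta>, x)\<close> by \<epsilon>.\<close>

lemma eigen_total_Lambda:
  assumes perc: "percolation_prob G (set_pmf \<mu>) (1 / real (order H)) = 0"
  shows "R.eigen_total (Lambda G \<mu>)"
  unfolding R.eigen_total_def
proof (intro conjI ballI impI)
  show "\<exists>u\<in>R.eigenspace c. u \<noteq> (\<lambda>x. 0)" if "c \<in> Lambda G \<mu>" for c
    using that by (rule Lambda_eigenvalue)
  fix F assume F: "F \<in> ell2 (carrier K)"
    and orth: "\<forall>c\<in>Lambda G \<mu>. \<forall>u\<in>R.eigenspace c. ell2_inner (carrier K) F u = 0"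
  have zero: "F (\<zeta>, x) = 0" if \<zeta>: "\<zeta> \<in> configs" and x: "x \<in> carrier G" for \<zeta> x
  proof -
    let ?t = "\<lambda>A. (\<lambda>y. x \<otimes>\<^bsub>G\<^esub> y) ` A"
    define N where "N = (ell2_norm (carrier K) F)\<^sup>2"
    have N: "N \<ge> 0" by (simp add: N_def)
    have card_t: "card (?t A) = card A" if "A \<subseteq> carrier G" for A
      using inj_on_subset[OF translate_inj[OF x] that] by (rule card_image)
    have bound: "(cmod (F (\<zeta>, x)))\<^sup>2 \<le> N * \<epsilon>" if \<epsilon>: "\<epsilon> > 0" for \<epsilon>
    proof -
      obtain I where I: "finite I" "I \<subseteq> shapes" "1 - \<epsilon> < (\<Sum>A\<in>I. weight A (boundary A))"
        using weights_exhaust[OF perc \<epsilon>] by blast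
      have int: "?t A \<inter> ?t B = ?t (A \<inter> B)" if "A \<subseteq> carrier G" "B \<subseteq> carrier G" for A B
        using inj_on_image_Int[OF translate_inj[OF x] that] by simp
      have "(cmod (F (\<zeta>, x)))\<^sup>2 \<le> N * (1 - (\<Sum>A\<in>I. weight (?t A) (?t (boundary A))))"
        unfolding N_def
      proof (rule value_bound[OF F x \<zeta> I(1)])
        fix A assume "A \<in> I"
        then have A: "A \<in> shapes" using I by auto
        note Af = shapes_finite[OF A]
        show "finite (?t A) \<and> finite (?t (boundary A)) \<and> ?t A \<union> ?t (boundary A) \<subseteq> carrier G \<and>
            ?t A \<inter> ?t (boundary A) = {}"
          using Af finite_boundary[OF Af] boundary_carrier[of A] x int[OF Af(2) boundary_carrier]
          by (auto simp: boundary_disjoint)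
        show "ell2_inner (carrier K) F (tensor (\<lambda>y. of_bool (y = x)) (wave (?t A) (?t (boundary A)) \<zeta>)) = 0"
          using orth by (intro cluster_component_orthogonal[OF _ x \<zeta> A]) auto
      next
        fix A A' assume "A \<in> I" "A' \<in> I" and ne: "A \<noteq> A'"
        then have A: "A \<in> shapes" "A' \<in> shapes" using I by auto
        show "?t A \<inter> ?t (boundary A') \<noteq> {} \<or> ?t A' \<inter> ?t (boundary A) \<noteq> {}"
          using shapes_conflict[OF A ne] shapes_finite[OF A(1)] shapes_finite[OF A(2)]
          by (simp add: int boundary_carrier)
      qed
      also have "(\<Sum>A\<in>I. weight (?t A) (?t (boundary A))) = (\<Sum>A\<in>I. weight A (boundary A))"
        using I shapes_finite(2) by (intro sum.cong refl) (auto simp: weight_def card_t boundary_carrier)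
      also have "N * (1 - (\<Sum>A\<in>I. weight A (boundary A))) \<le> N * \<epsilon>"
        using I(3) N by (intro mult_left_mono) auto
      finally show ?thesis .
    qed
    have "(cmod (F (\<zeta>, x)))\<^sup>2 \<le> 0"
    proof (rule field_le_epsilon)
      fix e :: real assume e: "e > 0"
      \<comment> \<open>The denominator \<open>N + 1\<close> covers the case
        \<open>N = 0\<close>.\<close>
      have "(cmod (F (\<zeta>, x)))\<^sup>2 \<le> N * (e / (N + 1))" using N e by (intro bound) auto
      also have "\<dots> \<le> e" using N e by (simp add: field_simps)
      finally show "(cmod (F (\<zeta>, x)))\<^sup>2 \<le> 0 + e" by simp
    qed
    then show ?thesis by simp
  qed
  show "F = (\<lambda>x. 0)"
  proof
    fix w show "F w = 0"
      using zero ell2_zero_outside[OF F, of w] by (cases w) (auto simp: carrier_K)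
  qed
qed

end

theorem mainTheorem3:
  fixes G :: "('g, 'm) monoid_scheme" and H :: "('h, 'n) monoid_scheme" and \<mu> :: "'g pmf"
  assumes "group G" and "group H"
    and "finite (carrier H)" and "order H \<ge> 2"
    and "set_pmf \<mu> \<subseteq> carrier G" and "finite (set_pmf \<mu>)"
    and "generate G (set_pmf \<mu>) = carrier G"
    and "\<And>x. x \<in> carrier G \<Longrightarrow> pmf \<mu> (inv\<^bsub>G\<^esub> x) = pmf \<mu> x"
    and "percolation_prob G (set_pmf \<mu>) (1 / real (order H)) = 0"
  shows "pure_point_spectrum (carrier (lamplighter H G)) (sws_operator H G \<mu>) \<and>
    op_spectrum (carrier (lamplighter H G)) (sws_operator H G \<mu>) = closure (Lambda G \<mu>) \<and>
    (\<exists>U. complete_orthonormal (carrier (lamplighter H G)) U \<and>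
           (\<forall>u\<in>U. finite {x. u x \<noteq> 0} \<and>
              (\<exists>c\<in>Lambda G \<mu>.
                 eigenfunction (carrier (lamplighter H G)) (sws_operator H G \<mu>) c u)) \<and>
           (\<forall>c\<in>Lambda G \<mu>. \<exists>u\<in>U.
              eigenfunction (carrier (lamplighter H G)) (sws_operator H G \<mu>) c u))"
proof -
  interpret G: group G by fact
  interpret H: group H by fact
  interpret lamplighter_walk G H \<mu>
    by unfold_locales (use assms in auto)
  have total: "R.eigen_total (Lambda G \<mu>)" by (rule eigen_total_Lambda) fact
  have spectrum: "op_spectrum (carrier K) (sws_operator H G \<mu>) = closure (Lambda G \<mu>)"
    using R.eigen_total_spectrum[OF total] by (simp add: sws_operator_kernel)
  obtain U where U: "complete_orthonormal (carrier K) U" "orthonormal (carrier K) U"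
    "\<forall>u\<in>U. \<exists>c\<in>Lambda G \<mu>. u \<in> R.eigenspace c \<and> u \<noteq> (\<lambda>x. 0)"
    "\<forall>c\<in>Lambda G \<mu>. \<exists>u\<in>U. u \<in> R.eigenspace c \<and> u \<noteq> (\<lambda>x. 0)"
    using R.eigen_total_orthonormal_basis[OF total] by blast
  have eig: "eigenfunction (carrier K) (sws_operator H G \<mu>) c u"
    if "u \<in> R.eigenspace c" "u \<noteq> (\<lambda>x. 0)" for c u
    using that R.eigenfunction_iff_eigenspace[OF R.eigenspace_finsupp[OF that(1)]]
    by (simp add: sws_operator_kernel)
  have fin: "finite {x. u x \<noteq> 0}" if "u \<in> U" for u
    using U(2) that by (auto simp: orthonormal_def finsupp_def)
  have "\<forall>u\<in>U. finite {x. u x \<noteq> 0} \<and>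
      (\<exists>c\<in>Lambda G \<mu>. eigenfunction (carrier K) (sws_operator H G \<mu>) c u)"
    using U(3) eig fin by blast
  moreover have "\<forall>c\<in>Lambda G \<mu>. \<exists>u\<in>U. eigenfunction (carrier K) (sws_operator H G \<mu>) c u"
    using U(4) eig by blast
  ultimately show ?thesis
    using U(1) spectrum unfolding pure_point_spectrum_def by blast
qed

end
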